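(* The group $$\Gamma_0 = \langle a, b, x, y, z, t \mid x^2, y^2, z^2, t^2,\ axb^{-1} z,\ aya^{-1}t,\ aza^{-1}x,\ ata^{-1}y,\ byb^{-1} x,\ bzb^{-1} t,\ btb^{-1} y\rangle$$ is an irreducible BMW group of degree $(4, 4)$. The elements $a$ and $xy$ span an anti-torus.
   Context: A BMW group of degree $(d_1,d_2)$ is a lattice $\Gamma\le\mathrm{Aut}(T_1)\times\mathrm{Aut}(T_2)$, where $T_1,T_2$ are regular trees of respective valencies $d_1,d_2$, acting regularly (i.e. sharply transitively) on the vertex set $V(T_1)\times V(T_2)$. Here the action of $\Gamma_0$ is the natural one on the square complex $T_1\times T_2$ whose $1$-skeleton is the Cayley graph of $\Gamma_0$ with respect to $\{a^{\pm1},b^{\pm1},x,y,z,t\}$ (each involutive generator giving a single unoriented edge) and whose squares are the $4$-cycles labelled by the relators of length four; $T_1$ (resp. $T_2$) is the tree factor whose direction corresponds to edges labelled by $a^{\pm1},b^{\pm1}$ (resp. $x,y,z,t$). Irreducible (usual meaning): $\Gamma$ has no finite index subgroup of the form $\Lambda_1\times\Lambda_2$ with $\Lambda_i\le\mathrm{Aut}(T_i)$. Anti-torus: let $X$ be a CAT(0) space (here $X=T_1\times T_2$) and $\Gamma$ a group acting properly and cocompactly on $X$ by isometries. An anti-torus is a $2$-dimensional flat $P$ in $X$ which is the convex hull of two non-parallel geodesic lines that are translation axes for two hyperbolic isometries $\gamma_1,\gamma_2\in\Gamma$, and such that the stabilizer of $P$ in $\Gamma$ does not act cocompactly on $P$.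 One then says that $P$ is spanned by $\gamma_1$ and $\gamma_2$, or that $\gamma_1$ and $\gamma_2$ span an anti-torus. *)

theory Defs
  imports "HOL-Analysis.Analysis" "HOL-Algebra.Group_Action"
begin

section \<open>Groups given by generators and relators\<close>

text \<open>The letter \<open>(g, True)\<close> stands for the generator \<open>g\<close> and \<open>(g, False)\<close> for its inverse.
  The generating set is the whole type.\<close>

type_synonym 'g word = "('g \<times> bool) list"

inductive pres_eq :: "'g word set \<Rightarrow> 'g word \<Rightarrow> 'g word \<Rightarrow> bool" for R where
  refl: "pres_eq R u u"
| sym: "pres_eq R u v \<Longrightarrow> pres_eq R v u"
| trans: "pres_eq R u v \<Longrightarrow> pres_eq R v w \<Longrightarrow> pres_eq R u w"
| cancel: "pres_eq R (u @ [(g, s), (g, \<not> s)] @ v) (u @ v)"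
| relator: "r \<in> R \<Longrightarrow> pres_eq R (u @ r @ v) (u @ v)"

definition pres_class :: "'g word set \<Rightarrow> 'g word \<Rightarrow> 'g word set" where
  "pres_class R w = {w'. pres_eq R w w'}"

definition presented_group :: "'g word set \<Rightarrow> 'g word set monoid" where
  "presented_group R =
    \<lparr>carrier = range (pres_class R),
     mult = (\<lambda>P Q. {w. \<exists>p\<in>P. \<exists>q\<in>Q. pres_eq R (p @ q) w}),
     one = pres_class R []\<rparr>"

text \<open>Cayley graph edges are unoriented, so inverse letters need not be listed and an involutive
  generator yields one edge. Edges and squares are represented by their sets of corners.\<close>

definition cayley_edges :: "'g word set \<Rightarrow> 'g set \<Rightarrow> 'g word set set set" where
  "cayley_edges R S = {{pres_class R w, pres_class R (w @ [(s, True)])} | w s. s \<in> S}"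

definition cayley_squares :: "'g word set \<Rightarrow> 'g word set set set" where
  "cayley_squares R =
    {(\<lambda>i. pres_class R (w @ take i r)) ` {..<4} | w r. r \<in> R \<and> length r = 4}"


section \<open>Trees and their automorphism groups\<close>

record 'v ugraph =
  verts :: "'v set"
  edges :: "'v set set"

definition simple_ugraph :: "'v ugraph \<Rightarrow> bool" where
  "simple_ugraph T \<longleftrightarrow>
    (\<forall>e\<in>edges T. \<exists>u\<in>verts T. \<exists>v\<in>verts T. u \<noteq> v \<and> e = {u, v})"

definition ugraph_connected :: "'v ugraph \<Rightarrow> bool" where
  "ugraph_connected T \<longleftrightarrow>
    (\<forall>u\<in>verts T. \<forall>v\<in>verts T. (u, v) \<in> {(p, q). {p, q} \<in> edges T}\<^sup>*)"

definition ugraph_cycle :: "'v ugraph \<Rightarrow> 'v list \<Rightarrow> bool" where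
  "ugraph_cycle T c \<longleftrightarrow> 3 \<le> length c \<and> distinct c \<and>
    (\<forall>i<length c. {c ! i, c ! (Suc i mod length c)} \<in> edges T)"

definition regular_tree :: "nat \<Rightarrow> 'v ugraph \<Rightarrow> bool" where
  "regular_tree d T \<longleftrightarrow> simple_ugraph T \<and> verts T \<noteq> {} \<and> ugraph_connected T \<and>
    \<not> (\<exists>c. ugraph_cycle T c) \<and>
    (\<forall>v\<in>verts T. finite {w. {v, w} \<in> edges T} \<and> card {w. {v, w} \<in> edges T} = d)"

definition tree_Aut_set :: "'v ugraph \<Rightarrow> ('v \<Rightarrow> 'v) set" where
  "tree_Aut_set T = {f \<in> Bij (verts T).
    \<forall>u\<in>verts T. \<forall>v\<in>verts T. {f u, f v} \<in> edges T \<longleftrightarrow> {u, v} \<in> edges T}"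

definition tree_Aut :: "'v ugraph \<Rightarrow> ('v \<Rightarrow> 'v) monoid" where
  "tree_Aut T = BijGroup (verts T) \<lparr>carrier := tree_Aut_set T\<rparr>"

text \<open>The topology of pointwise convergence.\<close>

definition tree_Aut_topology :: "'v ugraph \<Rightarrow> ('v \<Rightarrow> 'v) topology" where
  "tree_Aut_topology T =
    subtopology (product_topology (\<lambda>_. discrete_topology (verts T)) (verts T)) (tree_Aut_set T)"


section \<open>Lattices, BMW groups and irreducibility\<close>

text \<open>A lattice in the topological group \<open>G\<close> (with topology \<open>\<tau>\<close>) is a discrete subgroup \<open>\<Gamma>\<close>
  such that the coset space \<open>\<Gamma>\G\<close> carries a nonzero finite Borel measure (for the quotient
  topology) which is invariant under right translation by \<open>G\<close>.\<close>

definition coset_borel :: "('g, 'm) monoid_scheme \<Rightarrow> 'g topology \<Rightarrow> 'g set \<Rightarrow> 'g set set set" where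
  "coset_borel G \<tau> \<Gamma> =
    sigma_sets (rcosets\<^bsub>G\<^esub> \<Gamma>) {U. U \<subseteq> rcosets\<^bsub>G\<^esub> \<Gamma> \<and> openin \<tau> (\<Union>U)}"

definition lattice_in :: "('g, 'm) monoid_scheme \<Rightarrow> 'g topology \<Rightarrow> 'g set \<Rightarrow> bool" where
  "lattice_in G \<tau> \<Gamma> \<longleftrightarrow>
    subgroup \<Gamma> G \<and>
    subtopology \<tau> \<Gamma> = discrete_topology \<Gamma> \<and>
    (\<exists>M. space M = rcosets\<^bsub>G\<^esub> \<Gamma> \<and> sets M = coset_borel G \<tau> \<Gamma> \<and>
         finite_measure M \<and> emeasure M (space M) \<noteq> 0 \<and>
         (\<forall>g\<in>carrier G. \<forall>A\<in>sets M. emeasure M ((\<lambda>C. C #>\<^bsub>G\<^esub> g) ` A) = emeasure M A))"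

abbreviation Aut_prod :: "'u ugraph \<Rightarrow> 'v ugraph \<Rightarrow> (('u \<Rightarrow> 'u) \<times> ('v \<Rightarrow> 'v)) monoid" where
  "Aut_prod T1 T2 \<equiv> tree_Aut T1 \<times>\<times> tree_Aut T2"

definition BMW_group ::
  "nat \<Rightarrow> nat \<Rightarrow> 'u ugraph \<Rightarrow> 'v ugraph \<Rightarrow> (('u \<Rightarrow> 'u) \<times> ('v \<Rightarrow> 'v)) set \<Rightarrow> bool" where
  "BMW_group d1 d2 T1 T2 \<Gamma> \<longleftrightarrow>
    regular_tree d1 T1 \<and> regular_tree d2 T2 \<and>
    lattice_in (Aut_prod T1 T2)
      (prod_topology (tree_Aut_topology T1) (tree_Aut_topology T2)) \<Gamma> \<and>
    (\<forall>p\<in>verts T1 \<times> verts T2. \<forall>q\<in>verts T1 \<times> verts T2.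
       \<exists>!\<gamma>. \<gamma> \<in> \<Gamma> \<and> map_prod (fst \<gamma>) (snd \<gamma>) p = q)"

definition irreducible_lattice ::
  "'u ugraph \<Rightarrow> 'v ugraph \<Rightarrow> (('u \<Rightarrow> 'u) \<times> ('v \<Rightarrow> 'v)) set \<Rightarrow> bool" where
  "irreducible_lattice T1 T2 \<Gamma> \<longleftrightarrow>
    \<not> (\<exists>\<Lambda>1 \<Lambda>2. subgroup \<Lambda>1 (tree_Aut T1) \<and> subgroup \<Lambda>2 (tree_Aut T2) \<and>
         subgroup (\<Lambda>1 \<times> \<Lambda>2) (Aut_prod T1 T2 \<lparr>carrier := \<Gamma>\<rparr>) \<and>
         finite (rcosets\<^bsub>Aut_prod T1 T2 \<lparr>carrier := \<Gamma>\<rparr>\<^esub> (\<Lambda>1 \<times> \<Lambda>2)))"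


section \<open>The geometric realization of a tree\<close>

text \<open>Points are barycentric coordinates supported on a vertex or an edge. Edges have length one,
  and the distance is the length metric: the infimum of the lengths of strings, i.e. of finite
  sequences of points in which any two consecutive ones lie in a common cell.\<close>

definition cells :: "'v ugraph \<Rightarrow> 'v set set" where
  "cells T = (\<lambda>v. {v}) ` verts T \<union> edges T"

definition cell_points :: "'v set \<Rightarrow> ('v \<Rightarrow> real) set" where
  "cell_points e = {p. (\<forall>v. 0 \<le> p v) \<and> (\<forall>v. v \<notin> e \<longrightarrow> p v = 0) \<and> (\<Sum>v\<in>e. p v) = 1}"

definition tree_points :: "'v ugraph \<Rightarrow> ('v \<Rightarrow> real) set" where
  "tree_points T = (\<Union>e\<in>cells T. cell_points e)"

text \<open>For \<open>e = {u, v}\<close> this is \<open>\<bar>p u - q u\<bar> = \<bar>p v - q v\<bar>\<close>.\<close>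

definition cell_dist :: "'v set \<Rightarrow> ('v \<Rightarrow> real) \<Rightarrow> ('v \<Rightarrow> real) \<Rightarrow> real" where
  "cell_dist e p q = (\<Sum>v\<in>e. \<bar>p v - q v\<bar>) / 2"

inductive string_length :: "'v ugraph \<Rightarrow> ('v \<Rightarrow> real) \<Rightarrow> ('v \<Rightarrow> real) \<Rightarrow> real \<Rightarrow> bool" for T where
  start: "p \<in> tree_points T \<Longrightarrow> string_length T p p 0"
| step: "string_length T p q l \<Longrightarrow> e \<in> cells T \<Longrightarrow> q \<in> cell_points e \<Longrightarrow> r \<in> cell_points e \<Longrightarrow>
    string_length T p r (l + cell_dist e q r)"

definition tree_dist :: "'v ugraph \<Rightarrow> ('v \<Rightarrow> real) \<Rightarrow> ('v \<Rightarrow> real) \<Rightarrow> real" where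
  "tree_dist T p q = Inf {l. string_length T p q l}"

definition realize :: "'v ugraph \<Rightarrow> ('v \<Rightarrow> 'v) \<Rightarrow> ('v \<Rightarrow> real) \<Rightarrow> ('v \<Rightarrow> real)" where
  "realize T f p = (\<lambda>v. if v \<in> verts T then p (inv_into (verts T) f v) else 0)"

abbreviation prod_points ::
  "'u ugraph \<Rightarrow> 'v ugraph \<Rightarrow> (('u \<Rightarrow> real) \<times> ('v \<Rightarrow> real)) set" where
  "prod_points T1 T2 \<equiv> tree_points T1 \<times> tree_points T2"

text \<open>\<open>prod_dist\<close> is the \<open>\<ell>\<^sup>2\<close> product metric, so squares are Euclidean unit squares.\<close>

abbreviation prod_tree_dist ::
  "'u ugraph \<Rightarrow> 'v ugraph \<Rightarrow> ('u \<Rightarrow> real) \<times> ('v \<Rightarrow> real) \<Rightarrow> ('u \<Rightarrow> real) \<times> ('v \<Rightarrow> real) \<Rightarrow> real" where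
  "prod_tree_dist T1 T2 \<equiv> prod_dist (tree_dist T1) (tree_dist T2)"

definition realize_prod ::
  "'u ugraph \<Rightarrow> 'v ugraph \<Rightarrow> ('u \<Rightarrow> 'u) \<times> ('v \<Rightarrow> 'v) \<Rightarrow>
    ('u \<Rightarrow> real) \<times> ('v \<Rightarrow> real) \<Rightarrow> ('u \<Rightarrow> real) \<times> ('v \<Rightarrow> real)" where
  "realize_prod T1 T2 \<gamma> =
    restrict (map_prod (realize T1 (fst \<gamma>)) (realize T2 (snd \<gamma>))) (prod_points T1 T2)"


section \<open>Anti-tori\<close>

text \<open>Here \<open>(X, d)\<close> is the metric space and \<open>G\<close> acts on it through \<open>act\<close>. The notions below make
  sense in any metric space; they are meant for \<open>X\<close> CAT(0), such as a product of two trees.\<close>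

definition cocompact_on ::
  "'x set \<Rightarrow> ('x \<Rightarrow> 'x \<Rightarrow> real) \<Rightarrow> ('g \<Rightarrow> 'x \<Rightarrow> 'x) \<Rightarrow> 'g set \<Rightarrow> 'x set \<Rightarrow> bool" where
  "cocompact_on X d act S P \<longleftrightarrow>
    (\<exists>K. compactin (Metric_space.mtopology X d) K \<and> K \<subseteq> P \<and> (\<Union>g\<in>S. act g ` K) = P)"

definition geometric_action ::
  "'x set \<Rightarrow> ('x \<Rightarrow> 'x \<Rightarrow> real) \<Rightarrow> ('g, 'm) monoid_scheme \<Rightarrow> ('g \<Rightarrow> 'x \<Rightarrow> 'x) \<Rightarrow> bool" where
  "geometric_action X d G act \<longleftrightarrow>
    Metric_space X d \<and> group_action G X act \<and>
    (\<forall>g\<in>carrier G. \<forall>p\<in>X. \<forall>q\<in>X. d (act g p) (act g q) = d p q) \<and>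
    (\<forall>p\<in>X. \<exists>r>0. finite {g \<in> carrier G.
       act g ` Metric_space.mball X d p r \<inter> Metric_space.mball X d p r \<noteq> {}}) \<and>
    cocompact_on X d act (carrier G) X"

definition geodesic_line :: "'x set \<Rightarrow> ('x \<Rightarrow> 'x \<Rightarrow> real) \<Rightarrow> (real \<Rightarrow> 'x) \<Rightarrow> bool" where
  "geodesic_line X d c \<longleftrightarrow> range c \<subseteq> X \<and> (\<forall>s t. d (c s) (c t) = \<bar>s - t\<bar>)"

definition geodesically_convex :: "'x set \<Rightarrow> ('x \<Rightarrow> 'x \<Rightarrow> real) \<Rightarrow> 'x set \<Rightarrow> bool" where
  "geodesically_convex X d C \<longleftrightarrow> C \<subseteq> X \<and>
    (\<forall>l\<ge>0. \<forall>c. c ` {0..l} \<subseteq> X \<and> (\<forall>s\<in>{0..l}. \<forall>t\<in>{0..l}. d (c s) (c t) = \<bar>s - t\<bar>) \<and>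
       c 0 \<in> C \<and> c l \<in> C \<longrightarrow> c ` {0..l} \<subseteq> C)"

text \<open>Parallelism of lines as unoriented objects.\<close>

definition parallel_lines :: "('x \<Rightarrow> 'x \<Rightarrow> real) \<Rightarrow> (real \<Rightarrow> 'x) \<Rightarrow> (real \<Rightarrow> 'x) \<Rightarrow> bool" where
  "parallel_lines d c c' \<longleftrightarrow>
    (\<exists>K. (\<forall>t. d (c t) (c' t) \<le> K) \<or> (\<forall>t. d (c t) (c' (- t)) \<le> K))"

definition hyperbolic_isometry :: "'x set \<Rightarrow> ('x \<Rightarrow> 'x \<Rightarrow> real) \<Rightarrow> ('x \<Rightarrow> 'x) \<Rightarrow> bool" where
  "hyperbolic_isometry X d f \<longleftrightarrow>
    bij_betw f X X \<and> (\<forall>p\<in>X. \<forall>q\<in>X. d (f p) (f q) = d p q) \<and>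
    (\<exists>p\<in>X. 0 < d p (f p) \<and> (\<forall>q\<in>X. d p (f p) \<le> d q (f q)))"

definition translation_axis ::
  "'x set \<Rightarrow> ('x \<Rightarrow> 'x \<Rightarrow> real) \<Rightarrow> ('x \<Rightarrow> 'x) \<Rightarrow> (real \<Rightarrow> 'x) \<Rightarrow> bool" where
  "translation_axis X d f c \<longleftrightarrow>
    geodesic_line X d c \<and> (\<exists>\<tau>>0. \<forall>t. f (c t) = c (t + \<tau>))"

definition flat_plane :: "'x set \<Rightarrow> ('x \<Rightarrow> 'x \<Rightarrow> real) \<Rightarrow> 'x set \<Rightarrow> bool" where
  "flat_plane X d P \<longleftrightarrow> P \<subseteq> X \<and>
    (\<exists>f :: real \<times> real \<Rightarrow> 'x. range f = P \<and> (\<forall>p q. d (f p) (f q) = dist p q))"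

definition span_anti_torus ::
  "'x set \<Rightarrow> ('x \<Rightarrow> 'x \<Rightarrow> real) \<Rightarrow> ('g, 'm) monoid_scheme \<Rightarrow> ('g \<Rightarrow> 'x \<Rightarrow> 'x) \<Rightarrow>
    'g \<Rightarrow> 'g \<Rightarrow> bool" where
  "span_anti_torus X d G act \<gamma>1 \<gamma>2 \<longleftrightarrow>
    geometric_action X d G act \<and> \<gamma>1 \<in> carrier G \<and> \<gamma>2 \<in> carrier G \<and>
    hyperbolic_isometry X d (act \<gamma>1) \<and> hyperbolic_isometry X d (act \<gamma>2) \<and>
    (\<exists>c1 c2 P. translation_axis X d (act \<gamma>1) c1 \<and> translation_axis X d (act \<gamma>2) c2 \<and>
       \<not> parallel_lines d c1 c2 \<and>
       flat_plane X d P \<and> P = geodesically_convex X d hull (range c1 \<union> range c2) \<and>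
       \<not> cocompact_on X d act {g \<in> carrier G. act g ` P = P} P)"


section \<open>The group \<open>\<Gamma>\<^sub>0\<close>\<close>

datatype gen = gA | gB | gX | gY | gZ | gT

abbreviation pos :: "gen \<Rightarrow> gen \<times> bool" where "pos g \<equiv> (g, True)"
abbreviation neg :: "gen \<Rightarrow> gen \<times> bool" where "neg g \<equiv> (g, False)"

definition relators0 :: "gen word set" where
  "relators0 =
    {[pos gX, pos gX], [pos gY, pos gY], [pos gZ, pos gZ], [pos gT, pos gT],
     [pos gA, pos gX, neg gB, pos gZ],
     [pos gA, pos gY, neg gA, pos gT],
     [pos gA, pos gZ, neg gA, pos gX],
     [pos gA, pos gT, neg gA, pos gY],
     [pos gB, pos gY, neg gB, pos gX],
     [pos gB, pos gZ, neg gB, pos gT],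
     [pos gB, pos gT, neg gB, pos gY]}"

definition Gamma0 :: "gen word set monoid" where
  "Gamma0 = presented_group relators0"

abbreviation elt :: "gen word \<Rightarrow> gen word set" where
  "elt w \<equiv> pres_class relators0 w"

text \<open>The bijection \<open>\<phi>\<close> identifies the Cayley square complex of \<open>\<Gamma>\<^sub>0\<close> with \<open>T\<^sub>1 \<times> T\<^sub>2\<close>, edges
  labelled \<open>a\<close> and \<open>b\<close> running in the direction of \<open>T\<^sub>1\<close> and those labelled \<open>x, y, z, t\<close> in the
  direction of \<open>T\<^sub>2\<close>; the homomorphism \<open>\<rho>\<close> is left multiplication transported along \<open>\<phi>\<close>.
  These conditions determine the data up to isomorphism of the trees.\<close>

definition natural_action ::
  "'u ugraph \<Rightarrow> 'v ugraph \<Rightarrow> (gen word set \<Rightarrow> 'u \<times> 'v) \<Rightarrow>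
    (gen word set \<Rightarrow> ('u \<Rightarrow> 'u) \<times> ('v \<Rightarrow> 'v)) \<Rightarrow> bool" where
  "natural_action T1 T2 \<phi> \<rho> \<longleftrightarrow>
    bij_betw \<phi> (carrier Gamma0) (verts T1 \<times> verts T2) \<and>
    (\<lambda>e. \<phi> ` e) ` cayley_edges relators0 {gA, gB} =
      {e \<times> {v} | e v. e \<in> edges T1 \<and> v \<in> verts T2} \<and>
    (\<lambda>e. \<phi> ` e) ` cayley_edges relators0 {gX, gY, gZ, gT} =
      {{u} \<times> e | u e. u \<in> verts T1 \<and> e \<in> edges T2} \<and>
    (\<lambda>q. \<phi> ` q) ` cayley_squares relators0 =
      {e \<times> e' | e e'. e \<in> edges T1 \<and> e' \<in> edges T2} \<and>
    \<rho> \<in> hom Gamma0 (Aut_prod T1 T2) \<and>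
    (\<forall>g\<in>carrier Gamma0. \<forall>h\<in>carrier Gamma0.
       \<phi> (g \<otimes>\<^bsub>Gamma0\<^esub> h) = map_prod (fst (\<rho> g)) (snd (\<rho> g)) (\<phi> h))"

end

theory Submission
  imports Defs
begin

text \<open>Both trees are realized as trees of reduced words: \<open>T\<^sub>1\<close> over \<open>a\<^sup>\<plusminus>\<^sup>1, b\<^sup>\<plusminus>\<^sup>1\<close> and \<open>T\<^sub>2\<close> over the
  involutions \<open>x, y, z, t\<close>. Each relator of length four is a rule for moving a letter of one kind past a
  letter of the other kind, so \<open>\<Gamma>\<^sub>0\<close> acts on each tree by multiplication with the letters of its own
  alphabet and by a bireversible automaton with the others; moving all of \<open>a, b\<close> to the left gives a
  normal form, hence a simply transitive action on pairs of vertices. For a simply transitive group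
  \<open>\<Gamma>\<close> the invariant measure on \<open>\<Gamma>\G\<close> comes from counting the restrictions of the elements of a coset to
  a finite window: refining the window multiplies all counts by the same factor because \<open>\<Gamma>\<close> acts freely.

  The anti-torus and irreducibility both come from one fact: no power \<open>a\<^sup>N\<close> with \<open>N > 0\<close> fixes the axis
  \<open>...xyxy...\<close> of \<open>xy\<close> in \<open>T\<^sub>2\<close> pointwise. The tiling of the quarter plane with sides \<open>aaa...\<close> and
  \<open>xyxy...\<close> is generated by a substitution of size two on 14 tiles, from which one reads off that
  \<open>a\<close> to the power \<open>4 \<cdot> 2\<^sup>k\<close> fixes the first half of the word \<open>xyxy...\<close> of length \<open>4 \<cdot> 2\<^sup>k\<close>, but not the
  whole word. So these powers act differently on the axis, whereas they would take finitely many values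
  if some \<open>a\<^sup>N\<close> were trivial on it.\<close>

section \<open>Simply transitive groups of permutations are lattices\<close>

text \<open>One aperiodicity statement serves both conclusions because each reduces to a power of
  \<open>a\<close>. A product subgroup of finite index would contain a positive power of
  \<open>a\<close>, hence also the identity paired with its second component; this pair fixes a
  vertex of the product, and a free action leaves only the identity. For the flat, the obstacle is
  that an element stabilizing it may reflect either axis. Along the axis of \<open>a\<close> this is
  excluded by the exponent sum in \<open>a\<close> and \<open>b\<close>, a height that every group
  element shifts by a constant; along the axis of \<open>xy\<close> it is removed by squaring. What
  remains is a positive power of \<open>a\<close> fixing the axis of \<open>xy\<close> pointwise.
  The fourteen tiles are exactly those reached from the tile with sides \<open>aaa...\<close> and
  \<open>xyxy...\<close> by repeated division into four. For the measure, finite additivity is a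
  matter of counting; countable additivity comes from compactness of a vertex stabilizer, which
  meets every coset.\<close>

lemma card_image_eq_card_image:
  assumes "\<And>x y. x \<in> A \<Longrightarrow> y \<in> A \<Longrightarrow> f x = f y \<longleftrightarrow> g x = g y"
  shows "card (f ` A) = card (g ` A)"
proof (rule bij_betw_same_card[OF bij_betwI'[where f = "\<lambda>y. g (SOME x. x \<in> A \<and> f x = y)"]])
  have *: "g (SOME x. x \<in> A \<and> f x = f a) = g a" if "a \<in> A" for a
    by (rule someI2[of _ a]) (use that assms in auto)
  fix y z assume "y \<in> f ` A" "z \<in> f ` A"
  then show "(g (SOME x. x \<in> A \<and> f x = y) = g (SOME x. x \<in> A \<and> f x = z)) = (y = z)"
    using assms by (auto simp: *)
next
  fix y assume "y \<in> f ` A"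
  then obtain a where a: "a \<in> A" "y = f a" by auto
  show "g (SOME x. x \<in> A \<and> f x = y) \<in> g ` A"
    by (rule someI2[of _ a]) (use a in auto)
next
  fix y assume "y \<in> g ` A"
  then obtain a where a: "a \<in> A" "y = g a" by auto
  have "g (SOME x. x \<in> A \<and> f x = f a) = g a"
    by (rule someI2[of _ a]) (use a assms in auto)
  then show "\<exists>x\<in>f ` A. y = g (SOME xa. xa \<in> A \<and> f xa = x)"
    using a by (intro bexI[of _ "f a"]) auto
qed

lemma card_image_fibres:
  assumes "finite S" "\<And>y. y \<in> f ` S \<Longrightarrow> card {x \<in> S. f x = y} = k"
  shows "card S = card (f ` S) * k"
proof -
  have "card S = (\<Sum>y\<in>f ` S. \<Sum>x\<in>{x \<in> S. f x = y}. 1)"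
    using sum.image_gen[OF assms(1), of "\<lambda>_. 1::nat" f] by simp
  then show ?thesis using assms(2) by simp
qed

text \<open>\<open>window\<close> reads off a group element on a finite set \<open>B\<close> of points, \<open>coset_window\<close> does so
  for all elements of a coset; cosets with equal windows form a basic clopen set.\<close>

locale permutation_lattice = group G for G (structure) +
  fixes ev :: "'a \<Rightarrow> 'p \<Rightarrow> 'p" and V :: "'p set" and \<tau> :: "'a topology" and \<Gamma> :: "'a set" and o0 :: 'p
  assumes ev_closed: "g \<in> carrier G \<Longrightarrow> p \<in> V \<Longrightarrow> ev g p \<in> V"
    and ev_mult: "g \<in> carrier G \<Longrightarrow> h \<in> carrier G \<Longrightarrow> p \<in> V \<Longrightarrow> ev (g \<otimes> h) p = ev g (ev h p)"
    and ev_one: "p \<in> V \<Longrightarrow> ev \<one> p = p"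
    and countable_V: "countable V" and o0: "o0 \<in> V"
    and topspace_\<tau>: "topspace \<tau> = carrier G"
    and open_window: "finite B \<Longrightarrow> B \<subseteq> V \<Longrightarrow> g \<in> carrier G \<Longrightarrow>
      openin \<tau> {h \<in> carrier G. \<forall>p\<in>B. ev h p = ev g p}"
    and window_nbhd: "openin \<tau> U \<Longrightarrow> g \<in> U \<Longrightarrow>
      \<exists>B. finite B \<and> B \<subseteq> V \<and> (\<forall>h\<in>carrier G. (\<forall>p\<in>B. ev h p = ev g p) \<longrightarrow> h \<in> U)"
    and compact_stabilizer: "compactin \<tau> {g \<in> carrier G. ev g o0 = o0}"
    and subgroup_\<Gamma>: "subgroup \<Gamma> G"
    and simply_transitive: "p \<in> V \<Longrightarrow> q \<in> V \<Longrightarrow> \<exists>!\<gamma>. \<gamma> \<in> \<Gamma> \<and> ev \<gamma> p = q"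
begin

definition window :: "'p set \<Rightarrow> 'a \<Rightarrow> 'p \<Rightarrow> 'p" where
  "window B g = restrict (ev g) B"

definition coset_window :: "'p set \<Rightarrow> 'a set \<Rightarrow> ('p \<Rightarrow> 'p) set" where
  "coset_window B C = window B ` C"

text \<open>The cylinder sets of level \<open>B\<close>: unions of classes of cosets with the same
  window.\<close>

definition saturated :: "'p set \<Rightarrow> 'a set set \<Rightarrow> bool" where
  "saturated B A \<longleftrightarrow> A \<subseteq> rcosets \<Gamma> \<and>
    (\<forall>C\<in>A. \<forall>C'\<in>rcosets \<Gamma>. coset_window B C = coset_window B C' \<longrightarrow> C' \<in> A)"

definition base :: "'p set \<Rightarrow> bool" where
  "base B \<longleftrightarrow> finite B \<and> B \<subseteq> V \<and> B \<noteq> {}"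

definition clopen :: "'a set set set" where
  "clopen = {A. \<exists>B. base B \<and> saturated B A}"

text \<open>Normalised counting at level \<open>B\<close>: all window classes get equal mass and the
  whole coset space gets mass 1.\<close>

definition ratio :: "'p set \<Rightarrow> 'a set set \<Rightarrow> real" where
  "ratio B A = card (coset_window B ` A) / card (coset_window B ` (rcosets \<Gamma>))"

text \<open>Any admissible level gives the same value, since refining a level multiplies numerator
  and denominator by the same factor (\<open>content_eq_ratio\<close>).\<close>

definition content :: "'a set set \<Rightarrow> real" where
  "content A = ratio (SOME B. base B \<and> saturated B A) A"

lemma \<Gamma>_carrier: "\<gamma> \<in> \<Gamma> \<Longrightarrow> \<gamma> \<in> carrier G"
  using subgroup.mem_carrier[OF subgroup_\<Gamma>] .

lemma \<Gamma>_free: "\<gamma> \<in> \<Gamma> \<Longrightarrow> p \<in> V \<Longrightarrow> ev \<gamma> p = p \<Longrightarrow> \<gamma> = \<one>"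
  using simply_transitive[of p p] subgroup.one_closed[OF subgroup_\<Gamma>] ev_one by blast

lemma window_eq_iff: "window B g = window B h \<longleftrightarrow> (\<forall>p\<in>B. ev g p = ev h p)"
  by (auto simp: window_def fun_eq_iff restrict_def)

lemma window_mult_left:
  "B \<subseteq> V \<Longrightarrow> \<gamma> \<in> carrier G \<Longrightarrow> g \<in> carrier G \<Longrightarrow> h \<in> carrier G \<Longrightarrow>
    window B g = window B h \<Longrightarrow> window B (\<gamma> \<otimes> g) = window B (\<gamma> \<otimes> h)"
  by (auto simp: window_eq_iff ev_mult subset_iff)

lemma mem_coset: "x \<in> \<Gamma> #> g \<longleftrightarrow> (\<exists>\<gamma>\<in>\<Gamma>. x = \<gamma> \<otimes> g)"
  by (auto simp: r_coset_def)

lemma mem_rcosets: "C \<in> rcosets \<Gamma> \<longleftrightarrow> (\<exists>g\<in>carrier G. C = \<Gamma> #> g)"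
  by (auto simp: RCOSETS_def)

lemma coset_in_rcosets: "g \<in> carrier G \<Longrightarrow> \<Gamma> #> g \<in> rcosets \<Gamma>"
  by (auto simp: mem_rcosets)

lemma self_mem_coset: "g \<in> carrier G \<Longrightarrow> g \<in> \<Gamma> #> g"
  by (rule rcos_self[OF _ subgroup_\<Gamma>])

lemma coset_eqI: "x \<in> \<Gamma> #> g \<Longrightarrow> g \<in> carrier G \<Longrightarrow> \<Gamma> #> x = \<Gamma> #> g"
  using repr_independence[OF _ _ subgroup_\<Gamma>] by blast

lemma coset_mult_left: "\<gamma> \<in> \<Gamma> \<Longrightarrow> g \<in> carrier G \<Longrightarrow> \<Gamma> #> (\<gamma> \<otimes> g) = \<Gamma> #> g"
  using coset_eqI[of "\<gamma> \<otimes> g" g] by (auto simp: mem_coset)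

lemma coset_eq_of_mem: "C \<in> rcosets \<Gamma> \<Longrightarrow> g \<in> C \<Longrightarrow> C = \<Gamma> #> g"
  using coset_eqI by (auto simp: mem_rcosets)

lemma coset_carrier: "C \<in> rcosets \<Gamma> \<Longrightarrow> g \<in> C \<Longrightarrow> g \<in> carrier G"
  by (auto simp: mem_rcosets mem_coset \<Gamma>_carrier)

text \<open>Left multiplication by \<Gamma> descends to windows, so a coset window is a
  \<Gamma>-orbit of windows; two orbits agree as soon as they meet.\<close>

lemma coset_window_eq_iff:
  assumes B: "B \<subseteq> V" and g: "g \<in> carrier G" "h \<in> carrier G"
  shows "coset_window B (\<Gamma> #> g) = coset_window B (\<Gamma> #> h) \<longleftrightarrow>
    (\<exists>\<gamma>\<in>\<Gamma>. window B h = window B (\<gamma> \<otimes> g))"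
proof
  assume "coset_window B (\<Gamma> #> g) = coset_window B (\<Gamma> #> h)"
  then have "window B h \<in> coset_window B (\<Gamma> #> g)"
    using self_mem_coset[OF g(2)] by (auto simp: coset_window_def)
  then show "\<exists>\<gamma>\<in>\<Gamma>. window B h = window B (\<gamma> \<otimes> g)"
    by (auto simp: coset_window_def mem_coset)
next
  assume "\<exists>\<gamma>\<in>\<Gamma>. window B h = window B (\<gamma> \<otimes> g)"
  then obtain \<gamma> where \<gamma>: "\<gamma> \<in> \<Gamma>" "window B h = window B (\<gamma> \<otimes> g)" by blast
  have c: "\<gamma> \<otimes> g \<in> carrier G" "\<gamma> \<in> carrier G" using \<gamma> g \<Gamma>_carrier by auto
  have sub: "coset_window B (\<Gamma> #> x) \<subseteq> coset_window B (\<Gamma> #> y)"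
    if "x \<in> carrier G" "y \<in> carrier G" "window B x = window B y" for x y
  proof
    fix e assume "e \<in> coset_window B (\<Gamma> #> x)"
    then obtain \<gamma> where \<gamma>: "\<gamma> \<in> \<Gamma>" "e = window B (\<gamma> \<otimes> x)" by (auto simp: coset_window_def mem_coset)
    then have "e = window B (\<gamma> \<otimes> y)" using that window_mult_left[OF B \<Gamma>_carrier, of \<gamma> x y] by simp
    then show "e \<in> coset_window B (\<Gamma> #> y)"
      using \<gamma> unfolding coset_window_def by (intro image_eqI[of _ _ "\<gamma> \<otimes> y"]) (auto simp: mem_coset)
  qed
  have "coset_window B (\<Gamma> #> (\<gamma> \<otimes> g)) = coset_window B (\<Gamma> #> h)"
    using sub[of h "\<gamma> \<otimes> g"] sub[of "\<gamma> \<otimes> g" h] \<gamma> c g by auto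
  then show "coset_window B (\<Gamma> #> g) = coset_window B (\<Gamma> #> h)"
    by (simp add: coset_mult_left[OF \<gamma>(1) g(1)])
qed

lemma coset_window_eqI:
  assumes B: "B \<subseteq> V" and g: "g \<in> carrier G" "h \<in> carrier G" and "window B g = window B h"
  shows "coset_window B (\<Gamma> #> g) = coset_window B (\<Gamma> #> h)"
  unfolding coset_window_eq_iff[OF B g]
  using assms subgroup.one_closed[OF subgroup_\<Gamma>] by (intro bexI[of _ \<one>]) auto

text \<open>Transitivity of \<Gamma> carries the image of \<open>o0\<close> back to
  \<open>o0\<close>. The coset space is thus an image of the compact stabilizer, through which all
  finiteness arguments pass.\<close>

lemma obtain_stabilizer_rep:
  assumes "C \<in> rcosets \<Gamma>"
  obtains k where "k \<in> carrier G" "ev k o0 = o0" "C = \<Gamma> #> k"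
proof -
  obtain g where g: "g \<in> carrier G" "C = \<Gamma> #> g" using assms by (auto simp: mem_rcosets)
  obtain \<gamma> where \<gamma>: "\<gamma> \<in> \<Gamma>" "ev \<gamma> (ev g o0) = o0"
    using simply_transitive[OF ev_closed[OF g(1) o0] o0] by blast
  show ?thesis
  proof
    show "\<gamma> \<otimes> g \<in> carrier G" using \<gamma> g \<Gamma>_carrier by auto
    show "ev (\<gamma> \<otimes> g) o0 = o0" using \<gamma> g \<Gamma>_carrier by (simp add: ev_mult o0)
    show "C = \<Gamma> #> (\<gamma> \<otimes> g)" using coset_mult_left \<gamma> g by simp
  qed
qed

text \<open>Equality of windows cuts the compact stabilizer into open pieces, so finitely many
  pieces cover it.\<close>

lemma finite_stabilizer_windows:
  assumes "finite B" "B \<subseteq> V"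
  shows "finite (window B ` {g \<in> carrier G. ev g o0 = o0})"
proof -
  let ?K = "{g \<in> carrier G. ev g o0 = o0}"
  let ?O = "\<lambda>g. {h \<in> carrier G. \<forall>p\<in>B. ev h p = ev g p}"
  have "\<exists>\<F>. finite \<F> \<and> \<F> \<subseteq> ?O ` ?K \<and> ?K \<subseteq> \<Union>\<F>"
    using compact_stabilizer open_window[OF assms] by (intro compactinD) auto
  then obtain F where F: "finite F" "F \<subseteq> ?K" "?K \<subseteq> \<Union>(?O ` F)"
    by (metis (no_types, lifting) finite_subset_image)
  have "window B ` ?K \<subseteq> window B ` F"
    using F(3) by (fastforce simp: window_eq_iff image_iff)
  then show ?thesis using F(1) finite_subset by blast
qed

text \<open>A coset window depends only on the window of a representative, and representatives taken
  in the stabilizer have finitely many windows.\<close>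

lemma finite_coset_windows:
  assumes "finite B" "B \<subseteq> V"
  shows "finite (coset_window B ` (rcosets \<Gamma>))"
proof -
  let ?K = "{g \<in> carrier G. ev g o0 = o0}"
  have "coset_window B ` (rcosets \<Gamma>) \<subseteq> (\<lambda>k. coset_window B (\<Gamma> #> k)) ` ?K"
    by (auto elim!: obtain_stabilizer_rep)
  moreover have "finite ((\<lambda>k. coset_window B (\<Gamma> #> k)) ` ?K)"
  proof (rule finite_subset)
    \<comment> \<open>\<open>SOME\<close> picks one stabilizer element per window, which turns this
      dependence into a map defined on the finite set of windows.\<close>
    show "(\<lambda>k. coset_window B (\<Gamma> #> k)) ` ?K \<subseteq>
       (\<lambda>e. coset_window B (\<Gamma> #> (SOME k. k \<in> ?K \<and> window B k = e))) ` window B ` ?K"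
    proof clarify
      fix k assume k: "k \<in> carrier G" "ev k o0 = o0"
      define k' where "k' = (SOME x. x \<in> ?K \<and> window B x = window B k)"
      have k': "k' \<in> ?K \<and> window B k' = window B k"
        unfolding k'_def by (rule someI[of _ k]) (use k in auto)
      have "coset_window B (\<Gamma> #> k') = coset_window B (\<Gamma> #> k)"
        using k k' by (intro coset_window_eqI[OF assms(2)]) auto
      then show "coset_window B (\<Gamma> #> k) \<in>
         (\<lambda>e. coset_window B (\<Gamma> #> (SOME k. k \<in> ?K \<and> window B k = e))) ` window B ` ?K"
        using k unfolding k'_def by (auto simp: image_iff intro!: exI[of _ k])
    qed
  qed (use finite_stabilizer_windows[OF assms] in simp)
  ultimately show ?thesis by (rule finite_subset)
qed

lemma saturated_mono:
  assumes "saturated B A" "B \<subseteq> B'"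
  shows "saturated B' A"
proof -
  have "coset_window B C = (\<lambda>f. restrict f B) ` coset_window B' C" for C
    using assms(2) by (auto simp: coset_window_def window_def image_image Int_absorb1)
  then show ?thesis using assms(1) unfolding saturated_def by metis
qed

text \<open>The factor \<open>k\<close> is the same for all cosets because \<open>\<Gamma>\<close> acts freely.\<close>

lemma card_coset_windows_refine:
  assumes B: "base B" "B \<subseteq> B'" "finite B'" "B' \<subseteq> V"
  shows "\<exists>k>0. \<forall>A. saturated B A \<longrightarrow> card (coset_window B' ` A) = card (coset_window B ` A) * k"
proof -
  \<comment> \<open>\<open>U\<close> fixes \<open>B\<close> pointwise; right multiplication by
    \<open>U\<close> runs through the classes of level \<open>B'\<close> lying over one class of
    level \<open>B\<close>.\<close>
  define U where "U = {u \<in> carrier G. window B u = window B \<one>}"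
  define k where "k = card ((\<lambda>u. coset_window B' (\<Gamma> #> u)) ` U)"
  define r where "r = (\<lambda>X :: ('p \<Rightarrow> 'p) set. (\<lambda>f. restrict f B) ` X)"
  have BV: "B \<subseteq> V" using B by auto
  have r: "r (coset_window B' C) = coset_window B C" for C
    using B(2) by (auto simp: r_def coset_window_def window_def image_image Int_absorb1)
  have U_carrier: "u \<in> carrier G" if "u \<in> U" for u using that by (simp add: U_def)
  have U_ev: "ev u p = p" if "u \<in> U" "p \<in> B" for u p
    using that BV ev_one by (auto simp: U_def window_eq_iff)
  \<comment> \<open>A \<gamma> that matches the two windows fixes \<open>ev g p\<close> for
    \<open>p \<in> B\<close>, because \<open>u\<close> and \<open>v\<close> fix \<open>p\<close>;
    freeness gives \<gamma> = 1. The criterion obtained no longer mentions \<open>g\<close>.\<close>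
  have free: "coset_window B' (\<Gamma> #> (g \<otimes> u)) = coset_window B' (\<Gamma> #> (g \<otimes> v)) \<longleftrightarrow> window B' u = window B' v"
    if g: "g \<in> carrier G" and u: "u \<in> U" and v: "v \<in> U" for g u v
  proof -
    have "window B' (g \<otimes> v) = window B' (\<gamma> \<otimes> (g \<otimes> u)) \<Longrightarrow> \<gamma> = \<one>" if "\<gamma> \<in> \<Gamma>" for \<gamma>
    proof -
      assume *: "window B' (g \<otimes> v) = window B' (\<gamma> \<otimes> (g \<otimes> u))"
      obtain p where p: "p \<in> B" using B by (auto simp: base_def)
      have "ev (g \<otimes> v) p = ev (\<gamma> \<otimes> (g \<otimes> u)) p" using * p B by (auto simp: window_eq_iff)
      then have "ev \<gamma> (ev g p) = ev g p"
        using p BV g u v that U_ev U_carrier \<Gamma>_carrier by (auto simp: ev_mult ev_closed subset_iff)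
      then show "\<gamma> = \<one>" using \<Gamma>_free[OF that] ev_closed g p BV by blast
    qed
    then have "coset_window B' (\<Gamma> #> (g \<otimes> u)) = coset_window B' (\<Gamma> #> (g \<otimes> v)) \<longleftrightarrow>
       window B' (g \<otimes> v) = window B' (g \<otimes> u)"
      using coset_window_eq_iff[OF B(4), of "g \<otimes> u" "g \<otimes> v"] coset_window_eqI[OF B(4), of "g \<otimes> u" "g \<otimes> v"]
        g U_carrier[OF u] U_carrier[OF v] by (metis l_one m_closed)
    also have "\<dots> \<longleftrightarrow> window B' u = window B' v"
    proof
      assume "window B' (g \<otimes> v) = window B' (g \<otimes> u)"
      then have "window B' (inv g \<otimes> (g \<otimes> v)) = window B' (inv g \<otimes> (g \<otimes> u))"
        by (rule window_mult_left[OF B(4) inv_closed[OF g] m_closed[OF g U_carrier[OF v]] m_closed[OF g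
            U_carrier[OF u]]])
      then show "window B' u = window B' v"
        using g U_carrier[OF u] U_carrier[OF v] by (metis inv_closed l_inv l_one m_assoc)
    next
      assume "window B' u = window B' v"
      then show "window B' (g \<otimes> v) = window B' (g \<otimes> u)"
        using window_mult_left[OF B(4) g, of v u] U_carrier u v by simp
    qed
    finally show ?thesis .
  qed
  have fibre: "card {X \<in> coset_window B' ` A. r X = Y} = k"
    if A: "saturated B A" and Y: "Y \<in> r ` coset_window B' ` A" for A Y
  proof -
    have AR: "A \<subseteq> rcosets \<Gamma>" using A by (simp add: saturated_def)
    obtain C0 where C0: "C0 \<in> A" "Y = coset_window B C0" using Y by (auto simp: r)
    then obtain g where g: "g \<in> carrier G" "\<Gamma> #> g \<in> A" "Y = coset_window B (\<Gamma> #> g)"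
      using AR by (auto simp: subset_iff mem_rcosets)
    have "{X \<in> coset_window B' ` A. r X = Y} = (\<lambda>u. coset_window B' (\<Gamma> #> (g \<otimes> u))) ` U"
    proof (intro equalityI subsetI)
      fix X assume "X \<in> {X \<in> coset_window B' ` A. r X = Y}"
      then obtain C where C: "C \<in> A" "X = coset_window B' C" "coset_window B C = Y" by (auto simp: r)
      then obtain h where h: "h \<in> carrier G" "C = \<Gamma> #> h" using AR by (auto simp: subset_iff mem_rcosets)
      have "coset_window B (\<Gamma> #> g) = coset_window B (\<Gamma> #> h)" using C g h by simp
      then obtain \<gamma> where \<gamma>: "\<gamma> \<in> \<Gamma>" "window B g = window B (\<gamma> \<otimes> h)"
        using coset_window_eq_iff[OF BV h(1) g(1)] by metis
      \<comment> \<open>Solves \<open>g \<otimes> u = \<gamma> \<otimes> h\<close>: the coset of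
        \<open>h\<close> gets a representative that differs from \<open>g\<close> by an element
        trivial on \<open>B\<close>.\<close>
      define u where "u = inv g \<otimes> (\<gamma> \<otimes> h)"
      have u: "u \<in> carrier G" "g \<otimes> u = \<gamma> \<otimes> h"
        using \<gamma> g h \<Gamma>_carrier by (auto simp: u_def m_assoc[symmetric])
      have "window B (inv g \<otimes> g) = window B u"
        unfolding u_def using \<gamma> g h \<Gamma>_carrier by (intro window_mult_left BV) auto
      then have "u \<in> U" using u g by (simp add: U_def)
      moreover have "\<Gamma> #> (g \<otimes> u) = C"
        using coset_mult_left \<gamma> h u by simp
      ultimately show "X \<in> (\<lambda>u. coset_window B' (\<Gamma> #> (g \<otimes> u))) ` U"
        using C by (intro image_eqI[of _ _ u]) auto
    next
      fix X assume "X \<in> (\<lambda>u. coset_window B' (\<Gamma> #> (g \<otimes> u))) ` U"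
      then obtain u where u: "u \<in> U" "X = coset_window B' (\<Gamma> #> (g \<otimes> u))" by auto
      have "window B (g \<otimes> u) = window B (g \<otimes> \<one>)"
        using u by (intro window_mult_left[OF BV g(1) U_carrier[OF u(1)] one_closed]) (simp add: U_def)
      then have "coset_window B (\<Gamma> #> g) = coset_window B (\<Gamma> #> (g \<otimes> u))"
        using u g U_carrier by (intro coset_window_eqI[OF BV]) auto
      moreover from this have "\<Gamma> #> (g \<otimes> u) \<in> A"
        using A g coset_in_rcosets[OF m_closed[OF g(1) U_carrier[OF u(1)]]] unfolding saturated_def by blast
      ultimately show "X \<in> {X \<in> coset_window B' ` A. r X = Y}" using u g by (auto simp: r)
    qed
    moreover have "card ((\<lambda>u. coset_window B' (\<Gamma> #> (g \<otimes> u))) ` U) = k"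
      unfolding k_def
      by (rule card_image_eq_card_image) (use free[OF g(1)] free[OF one_closed] U_carrier in auto)
    ultimately show ?thesis by simp
  qed
  have "finite (coset_window B' ` A)" if "saturated B A" for A
    using that finite_coset_windows[OF B(3,4)] by (meson finite_subset image_mono saturated_def)
  then have "card (coset_window B' ` A) = card (coset_window B ` A) * k" if "saturated B A" for A
    using card_image_fibres[of "coset_window B' ` A" r k] fibre[OF that] that by (simp add: image_image r)
  moreover have "k > 0"
  proof -
    have "(\<lambda>u. coset_window B' (\<Gamma> #> u)) ` U \<subseteq> coset_window B' ` (rcosets \<Gamma>)"
      using U_carrier coset_in_rcosets by auto
    then have "finite ((\<lambda>u. coset_window B' (\<Gamma> #> u)) ` U)"
      using finite_coset_windows[OF B(3,4)] finite_subset by blast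
    moreover have "\<one> \<in> U" by (simp add: U_def)
    ultimately show ?thesis by (auto simp: k_def card_gt_0_iff)
  qed
  ultimately show ?thesis by blast
qed

section \<open>Independence of the content from the level\<close>

lemma saturated_rcosets: "saturated B (rcosets \<Gamma>)"
  by (simp add: saturated_def)

lemma card_windows_pos: "base B \<Longrightarrow> 0 < card (coset_window B ` (rcosets \<Gamma>))"
  using finite_coset_windows[of B] coset_in_rcosets[OF one_closed] by (auto simp: base_def card_gt_0_iff)

lemma ratio_refine:
  assumes "base B" "saturated B A" "base B'" "B \<subseteq> B'"
  shows "ratio B' A = ratio B A"
proof -
  obtain k where k: "k > 0" "\<And>A. saturated B A \<Longrightarrow> card (coset_window B' ` A) = card (coset_window B ` A) * k"
    using card_coset_windows_refine[of B B'] assms by (auto simp: base_def)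
  show ?thesis
    using k card_windows_pos[OF assms(1)] assms(2) saturated_rcosets by (simp add: ratio_def)
qed

lemma base_Un: "base B \<Longrightarrow> base B' \<Longrightarrow> base (B \<union> B')"
  by (auto simp: base_def)

text \<open>Two levels are compared through their union, a common refinement.\<close>

lemma content_eq_ratio:
  assumes "base B" "saturated B A"
  shows "content A = ratio B A"
proof -
  define B' where "B' = (SOME B. base B \<and> saturated B A)"
  have B': "base B' \<and> saturated B' A" unfolding B'_def by (rule someI[of _ B]) (use assms in simp)
  have "ratio B' A = ratio (B \<union> B') A" using B' assms by (intro ratio_refine[symmetric] base_Un) auto
  also have "\<dots> = ratio B A" using B' assms by (intro ratio_refine base_Un) auto
  finally show ?thesis by (simp add: content_def B'_def)
qed

lemma clopenE:
  assumes "A \<in> clopen" obtains B where "base B" "saturated B A"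
  using assms by (auto simp: clopen_def)

lemma clopenE2:
  assumes "A \<in> clopen" "A' \<in> clopen" obtains B where "base B" "saturated B A" "saturated B A'"
proof -
  obtain B B' where "base B" "saturated B A" "base B'" "saturated B' A'"
    using assms by (metis clopenE)
  then show ?thesis using that[of "B \<union> B'"] base_Un saturated_mono by (metis Un_upper1 Un_upper2)
qed

lemma base_o0: "base {o0}"
  using o0 by (simp add: base_def)

section \<open>Extension of the content to a Borel measure\<close>

lemma algebra_clopen: "algebra (rcosets \<Gamma>) clopen"
  unfolding algebra_iff_Un
proof (intro conjI ballI)
  show "clopen \<subseteq> Pow (rcosets \<Gamma>)" by (auto simp: clopen_def saturated_def)
  show "{} \<in> clopen" using base_o0 by (auto simp: clopen_def saturated_def)
  show "rcosets \<Gamma> - A \<in> clopen" if "A \<in> clopen" for A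
    using that unfolding clopen_def saturated_def by (fastforce dest: sym)
  show "A \<union> A' \<in> clopen" if A: "A \<in> clopen" "A' \<in> clopen" for A A'
  proof -
    obtain B where "base B" "saturated B A" "saturated B A'" using A by (rule clopenE2)
    then have "base B \<and> saturated B (A \<union> A')" by (auto simp: saturated_def)
    then show ?thesis by (auto simp: clopen_def)
  qed
qed

lemma content_nonneg: "0 \<le> content A"
  by (simp add: content_def ratio_def)

lemma content_empty: "content {} = 0"
  by (simp add: content_def ratio_def)

lemma content_Un:
  assumes "A \<in> clopen" "A' \<in> clopen" "A \<inter> A' = {}"
  shows "content (A \<union> A') = content A + content A'"
proof -
  obtain B where B: "base B" "saturated B A" "saturated B A'" using assms(1,2) by (rule clopenE2)
  have U: "saturated B (A \<union> A')" using B by (auto simp: saturated_def)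
  have fin: "finite (coset_window B ` X)" if "saturated B X" for X
    using that B finite_coset_windows[of B] by (meson base_def finite_subset image_mono saturated_def)
  have "coset_window B ` A \<inter> coset_window B ` A' = {}"
  proof (rule ccontr)
    assume "\<not> ?thesis"
    then obtain C C' where "C \<in> A" "C' \<in> A'" "coset_window B C = coset_window B C'" by auto
    then have "C' \<in> A" using B by (auto simp: saturated_def)
    then show False using \<open>C' \<in> A'\<close> assms(3) by blast
  qed
  then have "card (coset_window B ` (A \<union> A')) = card (coset_window B ` A) + card (coset_window B ` A')"
    using fin B by (simp add: image_Un card_Un_disjoint)
  then show ?thesis
    using content_eq_ratio[OF B(1) U] content_eq_ratio[OF B(1,2)] content_eq_ratio[OF B(1,3)]
    by (simp add: ratio_def add_divide_distrib)
qed

text \<open>Elements with equal windows on \<open>B\<close> lie in cosets with equal coset windows,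
  so the union contains the open window around each of its points.\<close>

lemma openin_clopen_Union:
  assumes "saturated B A" "finite B" "B \<subseteq> V"
  shows "openin \<tau> (\<Union>A)"
proof (subst openin_subopen, intro ballI)
  fix g assume "g \<in> \<Union>A"
  then obtain C where C: "C \<in> A" "g \<in> C" by auto
  then have CR: "C \<in> rcosets \<Gamma>" using assms by (auto simp: saturated_def)
  have g: "g \<in> carrier G" "C = \<Gamma> #> g" using C CR coset_carrier coset_eq_of_mem by auto
  have "h \<in> \<Union>A" if h: "h \<in> carrier G" "\<forall>p\<in>B. ev h p = ev g p" for h
  proof -
    have "coset_window B (\<Gamma> #> g) = coset_window B (\<Gamma> #> h)"
      using g h by (intro coset_window_eqI[OF assms(3)]) (auto simp: window_eq_iff)
    then have "\<Gamma> #> h \<in> A" using assms(1) C g h coset_in_rcosets by (auto simp: saturated_def)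
    then show ?thesis using self_mem_coset[OF h(1)] by blast
  qed
  then show "\<exists>T. openin \<tau> T \<and> g \<in> T \<and> T \<subseteq> \<Union>A"
    using open_window[OF assms(2,3) g(1)] g(1)
    by (intro exI[of _ "{h \<in> carrier G. \<forall>p\<in>B. ev h p = ev g p}"]) auto
qed

text \<open>This yields continuity at the empty set for the extension theorem. If no member were
  empty, the preimages in the compact stabilizer would be nonempty, closed and nested, hence have a
  common point.\<close>

lemma decseq_clopen_empty:
  assumes A: "\<And>n. A n \<in> clopen" and dec: "decseq A" and empty: "(\<Inter>n. A n) = {}"
  shows "\<exists>n. A n = {}"
proof (rule ccontr)
  assume "\<nexists>n. A n = {}"
  then have ne: "\<And>n. A n \<noteq> {}" by blast
  let ?K = "{g \<in> carrier G. ev g o0 = o0}"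
  define C where "C = (\<lambda>n. {k \<in> ?K. \<Gamma> #> k \<in> A n})"
  have AR: "A n \<subseteq> rcosets \<Gamma>" for n using A[of n] by (auto simp: clopen_def saturated_def)
  have "(\<Inter>n. C n) \<noteq> {}"
  proof (rule compact_space_imp_nest)
    show "compact_space (subtopology \<tau> ?K)" using compact_stabilizer by (rule compact_space_subtopology)
    show "closedin (subtopology \<tau> ?K) (C n)" for n
    proof -
      have "rcosets \<Gamma> - A n \<in> clopen" using algebra_clopen A unfolding algebra_iff_Un by blast
      then obtain B where "base B" "saturated B (rcosets \<Gamma> - A n)" by (rule clopenE)
      then have "openin \<tau> (\<Union>(rcosets \<Gamma> - A n))" by (intro openin_clopen_Union) (auto simp: base_def)
      then have "openin (subtopology \<tau> ?K) (?K \<inter> \<Union>(rcosets \<Gamma> - A n))" by (rule openin_subtopology_Int2)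
      moreover have "?K \<inter> \<Union>(rcosets \<Gamma> - A n) = topspace (subtopology \<tau> ?K) - C n"
        using self_mem_coset coset_in_rcosets coset_eq_of_mem
        by (auto simp: C_def topspace_\<tau>) blast+
      ultimately show ?thesis by (auto simp: closedin_def C_def topspace_\<tau>)
    qed
    show "C n \<noteq> {}" for n
    proof -
      obtain X where X: "X \<in> A n" using ne by blast
      then obtain k where "k \<in> ?K" "X = \<Gamma> #> k" using AR[of n] by (auto elim!: obtain_stabilizer_rep)
      then show ?thesis using X by (auto simp: C_def)
    qed
    show "decseq C" using dec by (auto simp: decseq_def C_def)
  qed
  then show False using empty by (auto simp: C_def)
qed

text \<open>Since \<open>V\<close> is countable there are only countably many levels, so an open set
  of cosets is a countable union of cylinder sets.\<close>

lemma sigma_sets_clopen: "sigma_sets (rcosets \<Gamma>) clopen = coset_borel G \<tau> \<Gamma>"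
  unfolding coset_borel_def
proof (rule sigma_sets_eqI)
  fix A assume "A \<in> clopen"
  then obtain B where "base B" "saturated B A" by (rule clopenE)
  then show "A \<in> sigma_sets (rcosets \<Gamma>) {U. U \<subseteq> rcosets \<Gamma> \<and> openin \<tau> (\<Union>U)}"
    using openin_clopen_Union by (intro sigma_sets.Basic) (auto simp: base_def saturated_def)
next
  fix U assume "U \<in> {U. U \<subseteq> rcosets \<Gamma> \<and> openin \<tau> (\<Union>U)}"
  then have U: "U \<subseteq> rcosets \<Gamma>" "openin \<tau> (\<Union>U)" by auto
  \<comment> \<open>\<open>I B\<close> is the largest part of \<open>U\<close> that is saturated at
    level \<open>B\<close>.\<close>
  define I where "I = (\<lambda>B. {C \<in> rcosets \<Gamma>. \<forall>C'\<in>rcosets \<Gamma>. coset_window B C' = coset_window B C \<longrightarrow> C' \<in> U})"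
  let ?\<B> = "{B. finite B \<and> B \<subseteq> V} \<inter> {B. base B}"
  have "U = \<Union>(I ` ?\<B>)"
  proof (intro equalityI subsetI)
    fix C assume C: "C \<in> U"
    then obtain g where g: "g \<in> carrier G" "C = \<Gamma> #> g" using U by (auto simp: subset_iff mem_rcosets)
    have gU: "g \<in> \<Union>U" using C g self_mem_coset by blast
    obtain B where B: "finite B" "B \<subseteq> V" "\<And>h. h \<in> carrier G \<Longrightarrow> (\<forall>p\<in>B. ev h p = ev g p) \<Longrightarrow> h \<in> \<Union>U"
      using window_nbhd[OF U(2) gU] by blast
    define B' where "B' = insert o0 B"
    have B': "base B'" using B o0 by (auto simp: B'_def base_def)
    have "C' \<in> U" if C': "C' \<in> rcosets \<Gamma>" "coset_window B' C' = coset_window B' C" for C'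
    proof -
      obtain h where h: "h \<in> carrier G" "C' = \<Gamma> #> h" using C' by (auto simp: mem_rcosets)
      obtain \<gamma> where \<gamma>: "\<gamma> \<in> \<Gamma>" "window B' g = window B' (\<gamma> \<otimes> h)"
        using coset_window_eq_iff[of B' h g] C' h g B' by (auto simp: base_def)
      have "\<gamma> \<otimes> h \<in> \<Union>U"
        using \<gamma> h \<Gamma>_carrier by (intro B(3)) (auto simp: window_eq_iff B'_def)
      then obtain D where D: "D \<in> U" "\<gamma> \<otimes> h \<in> D" by blast
      then have "D = \<Gamma> #> (\<gamma> \<otimes> h)" using U coset_eq_of_mem by blast
      also have "\<dots> = C'" using coset_mult_left \<gamma> h by simp
      finally show ?thesis using D by simp
    qed
    then have "C \<in> I B'" using C U by (auto simp: I_def)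
    then show "C \<in> \<Union>(I ` ?\<B>)" using B' by (auto simp: base_def)
  qed (auto simp: I_def)
  moreover have "\<Union>(I ` ?\<B>) \<in> sigma_sets (rcosets \<Gamma>) clopen"
  proof (rule sigma_sets_UNION)
    show "countable (I ` ?\<B>)"
      using countable_Collect_finite_subset[OF countable_V] by (intro countable_image countable_Int1)
    show "b \<in> sigma_sets (rcosets \<Gamma>) clopen" if b: "b \<in> I ` ?\<B>" for b
    proof (rule sigma_sets.Basic)
      obtain B where "base B" "b = I B" using b by auto
      moreover have "saturated B (I B)" unfolding saturated_def I_def by auto
      ultimately show "b \<in> clopen" by (auto simp: clopen_def)
    qed
  qed
  ultimately show "U \<in> sigma_sets (rcosets \<Gamma>) clopen" by simp
qed

lemma ex_measure:
  "\<exists>M. space M = rcosets \<Gamma> \<and> sets M = coset_borel G \<tau> \<Gamma> \<and> (\<forall>A\<in>clopen. emeasure M A = ennreal (content A))"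
proof -
  interpret algebra "rcosets \<Gamma>" clopen by (rule algebra_clopen)
  have "\<exists>\<mu>. (\<forall>s\<in>clopen. \<mu> s = ennreal (content s)) \<and>
     measure_space (rcosets \<Gamma>) (sigma_sets (rcosets \<Gamma>) clopen) \<mu>"
  proof (rule caratheodory_empty_continuous)
    show "positive clopen (\<lambda>A. ennreal (content A))" by (simp add: positive_def content_empty)
    show "additive clopen (\<lambda>A. ennreal (content A))"
      by (auto simp: additive_def content_Un content_nonneg)
    fix A :: "nat \<Rightarrow> 'a set set"
    assume A: "range A \<subseteq> clopen" "decseq A" "(\<Inter>i. A i) = {}"
    then obtain n where n: "A n = {}" using decseq_clopen_empty[of A] by auto
    have "\<forall>\<^sub>F i in sequentially. ennreal (content (A i)) = 0"
      unfolding eventually_sequentially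
    proof (intro exI allI impI)
      fix i assume "n \<le> i"
      then have "A i = {}" using A(2) n by (auto simp: decseq_def)
      then show "ennreal (content (A i)) = 0" by (simp add: content_empty)
    qed
    then show "(\<lambda>i. ennreal (content (A i))) \<longlonglongrightarrow> 0" by (rule tendsto_eventually)
  qed simp
  then obtain \<mu> where \<mu>: "\<And>s. s \<in> clopen \<Longrightarrow> \<mu> s = ennreal (content s)"
     "measure_space (rcosets \<Gamma>) (sigma_sets (rcosets \<Gamma>) clopen) \<mu>" by blast
  define M where "M = measure_of (rcosets \<Gamma>) (sigma_sets (rcosets \<Gamma>) clopen) \<mu>"
  have sub: "sigma_sets (rcosets \<Gamma>) clopen \<subseteq> Pow (rcosets \<Gamma>)"
    using sigma_sets_into_sp[OF space_closed] by blast
  have sets: "sets M = sigma_sets (rcosets \<Gamma>) clopen"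
    unfolding M_def using \<mu>(2) by (simp add: measure_space_def sigma_algebra.sets_measure_of_eq)
  have "emeasure M A = \<mu> A" if "A \<in> clopen" for A
    using \<mu>(2) that unfolding M_def measure_space_def
    by (intro emeasure_measure_of_sigma) auto
  then show ?thesis
    using sets \<mu>(1) sub by (intro exI[of _ M]) (auto simp: sigma_sets_clopen M_def space_measure_of)
qed

section \<open>Invariance under right translation\<close>

lemma translate_window_iff:
  assumes B: "B \<subseteq> V" and g: "g \<in> carrier G" "g' \<in> carrier G" "h \<in> carrier G"
  shows "window (ev (inv h) ` B) (g \<otimes> h) = window (ev (inv h) ` B) (g' \<otimes> h) \<longleftrightarrow> window B g = window B g'"
proof -
  have "ev (x \<otimes> h) (ev (inv h) p) = ev x p" if "x \<in> carrier G" "p \<in> B" for x p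
  proof -
    have "ev (x \<otimes> h) (ev (inv h) p) = ev (x \<otimes> h \<otimes> inv h) p"
      using that g B by (subst ev_mult) auto
    also have "x \<otimes> h \<otimes> inv h = x" using that g by (simp add: m_assoc)
    finally show ?thesis .
  qed
  then show ?thesis using g by (simp add: window_eq_iff)
qed

lemma translate_coset: "g \<in> carrier G \<Longrightarrow> h \<in> carrier G \<Longrightarrow> (\<Gamma> #> g) #> h = \<Gamma> #> (g \<otimes> h)"
  using coset_mult_assoc subgroup.subset[OF subgroup_\<Gamma>] by blast

lemma translate_coset_window_iff:
  assumes B: "B \<subseteq> V" and C: "C \<in> rcosets \<Gamma>" "C' \<in> rcosets \<Gamma>" and h: "h \<in> carrier G"
  shows "coset_window (ev (inv h) ` B) (C #> h) = coset_window (ev (inv h) ` B) (C' #> h) \<longleftrightarrow>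
    coset_window B C = coset_window B C'"
proof -
  obtain g g' where g: "g \<in> carrier G" "C = \<Gamma> #> g" "g' \<in> carrier G" "C' = \<Gamma> #> g'"
    using C by (auto simp: mem_rcosets)
  have hB: "ev (inv h) ` B \<subseteq> V" using B h ev_closed by auto
  have "\<gamma> \<in> \<Gamma> \<Longrightarrow> window (ev (inv h) ` B) (g' \<otimes> h) = window (ev (inv h) ` B) (\<gamma> \<otimes> (g \<otimes> h)) \<longleftrightarrow>
     window B g' = window B (\<gamma> \<otimes> g)" for \<gamma>
    using translate_window_iff[OF B, of g' "\<gamma> \<otimes> g" h] g h \<Gamma>_carrier by (simp add: m_assoc)
  then show ?thesis
    using g h by (simp add: translate_coset coset_window_eq_iff[OF hB] coset_window_eq_iff[OF B])
qed

lemma translate_in_rcosets: "C \<in> rcosets \<Gamma> \<Longrightarrow> h \<in> carrier G \<Longrightarrow> C #> h \<in> rcosets \<Gamma>"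
  by (auto simp: mem_rcosets translate_coset)

lemma translate_inv: "C \<in> rcosets \<Gamma> \<Longrightarrow> h \<in> carrier G \<Longrightarrow> C #> h #> inv h = C"
  by (auto simp: mem_rcosets translate_coset m_assoc)

lemma translate_inv': "C \<in> rcosets \<Gamma> \<Longrightarrow> h \<in> carrier G \<Longrightarrow> C #> inv h #> h = C"
  using translate_inv[of C "inv h"] by simp

text \<open>Translation by \<open>h\<close> matches the window classes on \<open>B\<close> with
  those on the image of \<open>B\<close> under \<open>inv h\<close>, and it permutes the set of all
  cosets. Numerator and denominator of \<open>ratio\<close> are both preserved.\<close>

lemma translate_clopen:
  assumes A: "A \<in> clopen" and h: "h \<in> carrier G"
  shows "(\<lambda>C. C #> h) ` A \<in> clopen" and "content ((\<lambda>C. C #> h) ` A) = content A"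
proof -
  obtain B where B: "base B" "saturated B A" using A by (rule clopenE)
  have BV: "B \<subseteq> V" using B by (simp add: base_def)
  define B' where "B' = ev (inv h) ` B"
  have B': "base B'" using B h ev_closed by (auto simp: B'_def base_def)
  have AR: "A \<subseteq> rcosets \<Gamma>" using B by (auto simp: saturated_def)
  have sat: "saturated B' ((\<lambda>C. C #> h) ` A)"
    unfolding saturated_def
  proof (intro conjI ballI impI)
    show "(\<lambda>C. C #> h) ` A \<subseteq> rcosets \<Gamma>" using AR h translate_in_rcosets by auto
    fix D C' assume D: "D \<in> (\<lambda>C. C #> h) ` A" and C': "C' \<in> rcosets \<Gamma>" and eq: "coset_window B' D
        = coset_window B' C'"
    obtain C where C: "C \<in> A" "D = C #> h" using D by auto
    have "coset_window B' (C #> h) = coset_window B' ((C' #> inv h) #> h)"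
      using eq C C' h by (simp add: translate_inv')
    then have "coset_window B C = coset_window B (C' #> inv h)"
      using translate_coset_window_iff[OF BV, of C "C' #> inv h" h] C AR C' h translate_in_rcosets
      unfolding B'_def by auto
    then have "C' #> inv h \<in> A" using B(2) C C' h translate_in_rcosets by (auto simp: saturated_def)
    then show "C' \<in> (\<lambda>C. C #> h) ` A" using translate_inv'[OF C' h] by (metis image_eqI)
  qed
  then show "(\<lambda>C. C #> h) ` A \<in> clopen" using B' by (auto simp: clopen_def)
  have card: "card (coset_window B' ` (\<lambda>C. C #> h) ` X)
      = card (coset_window B ` X)" if "X \<subseteq> rcosets \<Gamma>" for X
    unfolding image_image
  proof (rule card_image_eq_card_image)
    fix C D assume "C \<in> X" "D \<in> X"
    then show "coset_window B' (C #> h) = coset_window B' (D #> h) \<longleftrightarrow> coset_window B C = coset_window B D"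
      unfolding B'_def using that h by (intro translate_coset_window_iff[OF BV]) auto
  qed
  have "(\<lambda>C. C #> h) ` (rcosets \<Gamma>) = rcosets \<Gamma>"
  proof (intro equalityI subsetI)
    fix C assume C: "C \<in> rcosets \<Gamma>"
    show "C \<in> (\<lambda>C. C #> h) ` (rcosets \<Gamma>)"
      by (rule image_eqI[of _ _ "C #> inv h"]) (use C h translate_inv' translate_in_rcosets in auto)
  qed (use h translate_in_rcosets in auto)
  then show "content ((\<lambda>C. C #> h) ` A) = content A"
    using card[OF AR] card[OF order_refl]
    by (simp add: content_eq_ratio[OF B' sat] content_eq_ratio[OF B] ratio_def)
qed

theorem lattice: "lattice_in G \<tau> \<Gamma>"
  unfolding lattice_in_def
proof (intro conjI)
  show "subgroup \<Gamma> G" by (rule subgroup_\<Gamma>)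
  \<comment> \<open>By simple transitivity the window on the single point \<open>o0\<close> already
    isolates each element of \<Gamma>.\<close>
  have "openin (subtopology \<tau> \<Gamma>) {\<gamma>}" if "\<gamma> \<in> \<Gamma>" for \<gamma>
  proof -
    have "openin \<tau> {h \<in> carrier G. \<forall>p\<in>{o0}. ev h p = ev \<gamma> p}"
      using o0 \<Gamma>_carrier[OF that] by (intro open_window) auto
    moreover have "{\<gamma>} = \<Gamma> \<inter> {h \<in> carrier G. \<forall>p\<in>{o0}. ev h p = ev \<gamma> p}"
    proof (intro equalityI subsetI)
      fix h assume "h \<in> \<Gamma> \<inter> {h \<in> carrier G. \<forall>p\<in>{o0}. ev h p = ev \<gamma> p}"
      then show "h \<in> {\<gamma>}"
        using simply_transitive[OF o0 ev_closed[OF \<Gamma>_carrier[OF that] o0]] that by auto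
    qed (use that \<Gamma>_carrier in auto)
    ultimately show ?thesis by (simp only: openin_subtopology_Int2)
  qed
  then have "discrete_topology \<Gamma> = subtopology \<tau> \<Gamma>"
    unfolding discrete_topology_unique using \<Gamma>_carrier by (auto simp: topspace_\<tau>)
  then show "subtopology \<tau> \<Gamma> = discrete_topology \<Gamma>" by simp
  obtain M where M: "space M = rcosets \<Gamma>" "sets M = coset_borel G \<tau> \<Gamma>"
    "\<And>A. A \<in> clopen \<Longrightarrow> emeasure M A = ennreal (content A)"
    using ex_measure by blast
  have R: "rcosets \<Gamma> \<in> clopen" using base_o0 saturated_rcosets by (auto simp: clopen_def)
  have cR: "content (rcosets \<Gamma>) = 1"
    using content_eq_ratio[OF base_o0 saturated_rcosets] card_windows_pos[OF base_o0]
    by (simp add: ratio_def)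
  have "emeasure M ((\<lambda>C. C #> h) ` A) = emeasure M A" if h: "h \<in> carrier G" and A: "A \<in> sets M" for h A
  proof -
    let ?t = "\<lambda>C. C #> inv h"
    have vim: "?t -` X \<inter> rcosets \<Gamma> = (\<lambda>C. C #> h) ` X" if "X \<subseteq> rcosets \<Gamma>" for X
    proof (intro equalityI subsetI)
      fix C assume "C \<in> ?t -` X \<inter> rcosets \<Gamma>"
      then show "C \<in> (\<lambda>C. C #> h) ` X"
        using translate_inv'[of C h] h by (metis IntD1 IntD2 image_eqI vimageD)
    next
      fix C assume "C \<in> (\<lambda>C. C #> h) ` X"
      then show "C \<in> ?t -` X \<inter> rcosets \<Gamma>"
        using that h translate_inv translate_in_rcosets by (auto simp: subset_iff)
    qed
    have cl: "X \<subseteq> rcosets \<Gamma>" if "X \<in> clopen" for X using that by (auto simp: clopen_def saturated_def)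
    have setsM: "sets M = sigma_sets (rcosets \<Gamma>) clopen" using M sigma_sets_clopen by simp
    have meas: "?t \<in> measurable M M"
    proof (rule measurable_sigma_sets[OF setsM])
      show "clopen \<subseteq> Pow (rcosets \<Gamma>)" using cl by auto
      show "?t \<in> space M \<rightarrow> rcosets \<Gamma>" using M h translate_in_rcosets by auto
      show "?t -` X \<inter> space M \<in> sets M" if "X \<in> clopen" for X
        using vim[OF cl[OF that]] translate_clopen(1)[OF that h] M setsM by auto
    qed
    \<comment> \<open>Both measures agree on the intersection-stable generator
      \<open>clopen\<close>, hence on all Borel sets.\<close>
    have "M = distr M M ?t"
    proof (rule measure_eqI_generator_eq)
      show "Int_stable clopen"
        using algebra_clopen by (auto simp: Int_stable_def algebra_iff_Int)
      show "clopen \<subseteq> Pow (rcosets \<Gamma>)" using cl by auto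
      show "emeasure M X = emeasure (distr M M ?t) X" if "X \<in> clopen" for X
      proof -
        have "X \<in> sets M" using that setsM by auto
        then have "emeasure (distr M M ?t) X = emeasure M ((\<lambda>C. C #> h) ` X)"
          using vim[OF cl[OF that]] by (simp add: emeasure_distr[OF meas] M)
        then show ?thesis using translate_clopen[OF that h] M(3) that by simp
      qed
      show "sets M = sigma_sets (rcosets \<Gamma>) clopen" "sets (distr M M ?t) = sigma_sets (rcosets \<Gamma>) clopen"
        using setsM by auto
      show "range (\<lambda>_::nat. rcosets \<Gamma>) \<subseteq> clopen" "(\<Union>i::nat. rcosets \<Gamma>) = rcosets \<Gamma>" using R by auto
      show "emeasure M (rcosets \<Gamma>) \<noteq> \<infinity>" using M(3)[OF R] by simp
    qed
    then have "emeasure M A = emeasure (distr M M ?t) A" by simp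
    also have "\<dots> = emeasure M ((\<lambda>C. C #> h) ` A)"
      using vim[of A] A sets.sets_into_space[OF A] by (simp add: emeasure_distr[OF meas] M)
    finally show ?thesis by simp
  qed
  moreover have "finite_measure M" using M(1) M(3)[OF R] by (intro finite_measureI) simp
  moreover have "emeasure M (space M) \<noteq> 0" using M(1) M(3)[OF R] cR by simp
  ultimately show "\<exists>M. space M = rcosets \<Gamma> \<and> sets M = coset_borel G \<tau> \<Gamma> \<and> finite_measure M \<and>
     emeasure M (space M) \<noteq> 0 \<and> (\<forall>g\<in>carrier G. \<forall>A\<in>sets M. emeasure M ((\<lambda>C. C #> g) ` A) = emeasure M A)"
    using M by blast
qed

end

section \<open>The topological group of automorphisms of a product of two trees\<close>

lemma tree_Aut_set_Bij: "f \<in> tree_Aut_set T \<Longrightarrow> f \<in> Bij (verts T)"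
  by (simp add: tree_Aut_set_def)

lemma tree_Aut_verts: "f \<in> tree_Aut_set T \<Longrightarrow> v \<in> verts T \<Longrightarrow> f v \<in> verts T"
  by (auto simp: tree_Aut_set_def Bij_def bij_betw_def)

lemma tree_Aut_inj: "f \<in> tree_Aut_set T \<Longrightarrow> inj_on f (verts T)"
  by (auto simp: tree_Aut_set_def Bij_def bij_betw_def)

lemma tree_Aut_surj: "f \<in> tree_Aut_set T \<Longrightarrow> w \<in> verts T \<Longrightarrow> \<exists>v\<in>verts T. f v = w"
  by (auto simp: tree_Aut_set_def Bij_def bij_betw_def image_iff) (metis image_iff)

lemma tree_Aut_edge: "f \<in> tree_Aut_set T \<Longrightarrow> u \<in> verts T \<Longrightarrow> v \<in> verts T \<Longrightarrow>
    {f u, f v} \<in> edges T \<longleftrightarrow> {u, v} \<in> edges T"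
  by (simp add: tree_Aut_set_def)

lemma tree_Aut_extensional: "f \<in> tree_Aut_set T \<Longrightarrow> f \<in> extensional (verts T)"
  by (auto simp: tree_Aut_set_def Bij_def)

lemma inverse_in_tree_Aut_set:
  assumes f: "f \<in> tree_Aut_set T"
  shows "restrict (inv_into (verts T) f) (verts T) \<in> tree_Aut_set T"
proof -
  have bij: "bij_betw f (verts T) (verts T)" using f by (simp add: tree_Aut_set_def Bij_def)
  have iv: "inv_into (verts T) f v \<in> verts T" "f (inv_into (verts T) f v) = v" if "v \<in> verts T" for v
    using bij that by (auto simp: bij_betw_def inv_into_into f_inv_into_f)
  show ?thesis
    using restrict_inv_into_Bij[OF tree_Aut_set_Bij[OF f]] iv tree_Aut_edge[OF f iv(1) iv(1)]
    by (auto simp: tree_Aut_set_def)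
qed

lemma subgroup_tree_Aut_set: "subgroup (tree_Aut_set T) (BijGroup (verts T))"
proof (rule group.subgroupI[OF group_BijGroup])
  show "tree_Aut_set T \<subseteq> carrier (BijGroup (verts T))"
    by (auto simp: tree_Aut_set_def BijGroup_def)
  show "tree_Aut_set T \<noteq> {}"
    using id_Bij[of "verts T"] by (auto simp: tree_Aut_set_def intro!: exI[of _ "\<lambda>x\<in>verts T. x"])
  fix f assume f: "f \<in> tree_Aut_set T"
  show "inv\<^bsub>BijGroup (verts T)\<^esub> f \<in> tree_Aut_set T"
    using inverse_in_tree_Aut_set[OF f] by (simp add: inv_BijGroup tree_Aut_set_Bij[OF f])
  fix g assume g: "g \<in> tree_Aut_set T"
  show "f \<otimes>\<^bsub>BijGroup (verts T)\<^esub> g \<in> tree_Aut_set T"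
    using f g tree_Aut_verts[OF g] compose_Bij[of f "verts T" g]
    by (auto simp: BijGroup_def tree_Aut_set_def compose_eq)
qed

lemma group_tree_Aut: "group (tree_Aut T)"
  unfolding tree_Aut_def by (rule subgroup.subgroup_is_group[OF subgroup_tree_Aut_set group_BijGroup])

lemma carrier_tree_Aut: "carrier (tree_Aut T) = tree_Aut_set T"
  by (simp add: tree_Aut_def)

lemma mult_tree_Aut:
  "f \<in> tree_Aut_set T \<Longrightarrow> g \<in> tree_Aut_set T \<Longrightarrow> f \<otimes>\<^bsub>tree_Aut T\<^esub> g = compose (verts T) f g"
  by (simp add: tree_Aut_def BijGroup_def tree_Aut_set_Bij)

lemma one_tree_Aut: "\<one>\<^bsub>tree_Aut T\<^esub> = (\<lambda>x\<in>verts T. x)"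
  by (simp add: tree_Aut_def BijGroup_def)

lemma carrier_Aut_prod: "carrier (Aut_prod T1 T2) = tree_Aut_set T1 \<times> tree_Aut_set T2"
  by (simp add: carrier_tree_Aut)

lemma group_Aut_prod: "group (Aut_prod T1 T2)"
  by (intro DirProd_group group_tree_Aut)

locale locally_finite_graph =
  fixes T :: "'v ugraph"
  assumes edge_verts: "{u, v} \<in> edges T \<Longrightarrow> u \<in> verts T"
    and finite_neighbours: "v \<in> verts T \<Longrightarrow> finite {w. {v, w} \<in> edges T}"
    and connected: "u \<in> verts T \<Longrightarrow> v \<in> verts T \<Longrightarrow> (u, v) \<in> {(p, q). {p, q} \<in> edges T}\<^sup>*"
begin

text \<open>Along a path from \<open>u\<close>, the image of the next vertex is a neighbour of one
  of the finitely many images of the previous one.\<close>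

lemma finite_stabilizer_orbit:
  assumes "u \<in> verts T" "v \<in> verts T"
  shows "finite {f v | f. f \<in> tree_Aut_set T \<and> f u = u}"
  using connected[OF assms]
proof (induction rule: rtrancl_induct)
  case base
  show ?case by (rule finite_subset[of _ "{u}"]) auto
next
  case (step y z)
  have e: "{y, z} \<in> edges T" using step by simp
  have yz: "y \<in> verts T" "z \<in> verts T" using e edge_verts by (metis insert_commute)+
  have "{f z | f. f \<in> tree_Aut_set T \<and> f u = u} \<subseteq>
    (\<Union>p\<in>{f y | f. f \<in> tree_Aut_set T \<and> f u = u}. {w. {p, w} \<in> edges T})"
    using tree_Aut_edge[OF _ yz] e by blast
  moreover have "finite (\<Union>p\<in>{f y | f. f \<in> tree_Aut_set T \<and> f u = u}. {w. {p, w} \<in> edges T})"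
    using step.IH finite_neighbours tree_Aut_verts[OF _ yz(1)] by auto
  ultimately show ?case by (rule finite_subset)
qed

lemma topspace_tree_Aut_topology: "topspace (tree_Aut_topology T) = tree_Aut_set T"
  using tree_Aut_verts tree_Aut_extensional
  by (auto simp: tree_Aut_topology_def PiE_def)

lemma openin_agree:
  assumes "finite B" "B \<subseteq> verts T" "g \<in> verts T \<rightarrow> verts T"
  shows "openin (product_topology (\<lambda>_. discrete_topology (verts T)) (verts T))
    {h \<in> (\<Pi>\<^sub>E v\<in>verts T. verts T). \<forall>v\<in>B. h v = g v}"
proof -
  have "{h \<in> (\<Pi>\<^sub>E v\<in>verts T. verts T). \<forall>v\<in>B. h v = g v} =
     (\<Pi>\<^sub>E v\<in>verts T. if v \<in> B then {g v} else verts T)"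
  proof (intro equalityI subsetI)
    fix h assume h: "h \<in> {h \<in> (\<Pi>\<^sub>E v\<in>verts T. verts T). \<forall>v\<in>B. h v = g v}"
    then show "h \<in> (\<Pi>\<^sub>E v\<in>verts T. if v \<in> B then {g v} else verts T)"
      by (auto simp: PiE_iff)
  next
    fix h assume h: "h \<in> (\<Pi>\<^sub>E v\<in>verts T. if v \<in> B then {g v} else verts T)"
    have "h v \<in> (if v \<in> B then {g v} else verts T)" if "v \<in> verts T" for v
      using h that by (rule PiE_mem)
    then have "h v \<in> verts T" "v \<in> B \<Longrightarrow> h v = g v" if "v \<in> verts T" for v
      using assms that by (fastforce split: if_splits)+
    then show "h \<in> {h \<in> (\<Pi>\<^sub>E v\<in>verts T. verts T). \<forall>v\<in>B. h v = g v}"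
      using h assms(2) by (auto simp: PiE_iff)
  qed
  moreover have "openin (product_topology (\<lambda>_. discrete_topology (verts T)) (verts T)) \<dots>"
    unfolding openin_PiE_gen
  proof (intro disjI2 conjI ballI)
    show "finite {i \<in> verts T. (if i \<in> B then {g i} else verts T) \<noteq> topspace (discrete_topology (verts T))}"
      by (rule finite_subset[OF _ assms(1)]) auto
  qed (use assms in auto)
  ultimately show ?thesis by simp
qed

lemma openin_Aut_window:
  assumes "finite B" "B \<subseteq> verts T" "g \<in> tree_Aut_set T"
  shows "openin (tree_Aut_topology T) {h \<in> tree_Aut_set T. \<forall>v\<in>B. h v = g v}"
proof -
  have g: "g \<in> verts T \<rightarrow> verts T" using tree_Aut_verts[OF assms(3)] by auto
  have "{h \<in> tree_Aut_set T. \<forall>v\<in>B. h v = g v} =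
    tree_Aut_set T \<inter> {h \<in> (\<Pi>\<^sub>E v\<in>verts T. verts T). \<forall>v\<in>B. h v = g v}"
    using tree_Aut_verts tree_Aut_extensional by (auto simp: PiE_def)
  then show ?thesis
    unfolding tree_Aut_topology_def using openin_subtopology_Int2[OF openin_agree[OF assms(1,2) g]] by simp
qed

lemma Aut_window_nbhd:
  assumes "openin (tree_Aut_topology T) U" "g \<in> U"
  shows "\<exists>B. finite B \<and> B \<subseteq> verts T \<and> (\<forall>h\<in>tree_Aut_set T. (\<forall>v\<in>B. h v = g v) \<longrightarrow> h \<in> U)"
proof -
  obtain W where W: "openin (product_topology (\<lambda>_. discrete_topology (verts T)) (verts T)) W"
    "U = W \<inter> tree_Aut_set T"
    using assms(1) by (auto simp: tree_Aut_topology_def openin_subtopology)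
  obtain S where S: "finite {i \<in> verts T. S i \<noteq> verts T}" "g \<in> Pi\<^sub>E (verts T) S" "Pi\<^sub>E (verts T) S \<subseteq> W"
    using W assms(2) unfolding openin_product_topology_alt by fastforce
  show ?thesis
  proof (intro exI conjI ballI impI)
    fix h assume h: "h \<in> tree_Aut_set T" "\<forall>v\<in>{i \<in> verts T. S i \<noteq> verts T}. h v = g v"
    have "h v \<in> S v" if "v \<in> verts T" for v
      using h S(2) that tree_Aut_verts[OF h(1)] by (cases "S v = verts T") (auto simp: PiE_iff)
    then have "h \<in> Pi\<^sub>E (verts T) S" using tree_Aut_extensional[OF h(1)] by (auto simp: PiE_def)
    then show "h \<in> U" using S(3) W(2) h(1) by auto
  qed (use S(1) in auto)
qed

text \<open>The stabilizer lies in the product of its finite vertex orbits, which is compact by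
  Tychonoff; it remains to see that it is closed among all functions.\<close>

lemma compactin_stabilizer:
  assumes u: "u \<in> verts T"
  shows "compactin (tree_Aut_topology T) {f \<in> tree_Aut_set T. f u = u}"
proof -
  let ?K = "{f \<in> tree_Aut_set T. f u = u}"
  let ?P = "product_topology (\<lambda>_. discrete_topology (verts T)) (verts T)"
  define Orb where "Orb v = {f v | f. f \<in> tree_Aut_set T \<and> f u = u}" for v
  have fin: "finite (Orb v)" "Orb v \<subseteq> verts T" if "v \<in> verts T" for v
    using finite_stabilizer_orbit[OF u that] tree_Aut_verts that by (auto simp: Orb_def)
  have "closedin ?P ?K"
    unfolding closedin_def
  proof (intro conjI)
    show "?K \<subseteq> topspace ?P" using tree_Aut_verts tree_Aut_extensional by (auto simp: PiE_def)
    show "openin ?P (topspace ?P - ?K)"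
    proof (subst openin_subopen, intro ballI)
      fix f assume f: "f \<in> topspace ?P - ?K"
      then have fV: "f \<in> verts T \<rightarrow> verts T" "f \<in> extensional (verts T)" by (auto simp: PiE_def)
      \<comment> \<open>Otherwise \<open>f\<close> agrees with stabilizer elements on every finite
        set and inherits every property that a finite set of vertices can test.\<close>
      have "\<exists>B. finite B \<and> B \<subseteq> verts T \<and> (\<forall>h. (\<forall>v\<in>B. h v = f v) \<longrightarrow> h \<notin> ?K)"
      proof (rule ccontr)
        assume "\<not> ?thesis"
        then have H: "\<And>B. finite B \<Longrightarrow> B \<subseteq> verts T \<Longrightarrow> \<exists>h. (\<forall>v\<in>B. h v = f v) \<and> h \<in> ?K" by blast
        have fu: "f u = u" using H[of "{u}"] u by auto
        have ed: "{f v, f w} \<in> edges T \<longleftrightarrow> {v, w} \<in> edges T" if "v \<in> verts T" "w \<in> verts T" for v w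
          using H[of "{v, w}"] that tree_Aut_edge by fastforce
        have "inj_on f (verts T)"
        proof (rule inj_onI)
          fix v w assume vw: "v \<in> verts T" "w \<in> verts T" "f v = f w"
          obtain h where "h v = f v" "h w = f w" "h \<in> ?K" using H[of "{v, w}"] vw by auto
          then show "v = w" using vw tree_Aut_inj by (metis (no_types, lifting) inj_onD mem_Collect_eq)
        qed
        moreover have "w \<in> f ` verts T" if w: "w \<in> verts T" for w
        proof -
          \<comment> \<open>Surjectivity is not testable on finite sets by itself. It becomes so
            because the preimage of \<open>w\<close> under a stabilizer element lies in the finite
            orbit of \<open>w\<close>.\<close>
          obtain h where h: "\<forall>v\<in>Orb w. h v = f v" "h \<in> ?K" using H[OF fin[OF w]] by blast
          then obtain v where v: "v \<in> verts T" "h v = w" using tree_Aut_surj[of h T w] w by auto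
          let ?i = "restrict (inv_into (verts T) h) (verts T)"
          have "?i \<in> tree_Aut_set T" using h inverse_in_tree_Aut_set by blast
          moreover have "?i w = v" using v w h tree_Aut_inj[of h T] by (auto simp: inv_into_f_eq)
          moreover have "?i u = u" using u h tree_Aut_inj[of h T] by (auto simp: inv_into_f_eq)
          ultimately have "v \<in> Orb w" unfolding Orb_def by (metis (mono_tags, lifting) mem_Collect_eq)
          then show ?thesis using h v by (metis image_eqI)
        qed
        ultimately have "f \<in> ?K"
          using fV fu ed by (auto simp: tree_Aut_set_def Bij_def bij_betw_def)
        then show False using f by blast
      qed
      then obtain B where B: "finite B" "B \<subseteq> verts T" "\<And>h. (\<forall>v\<in>B. h v = f v) \<Longrightarrow> h \<notin> ?K" by blast
      show "\<exists>W. openin ?P W \<and> f \<in> W \<and> W \<subseteq> topspace ?P - ?K"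
        using openin_agree[OF B(1,2) fV(1)] f B(3)
        by (intro exI[of _ "{h \<in> (\<Pi>\<^sub>E v\<in>verts T. verts T). \<forall>v\<in>B. h v = f v}"]) auto
    qed
  qed
  moreover have "compactin ?P (Pi\<^sub>E (verts T) Orb)"
    unfolding compactin_PiE using fin by (auto simp: compactin_discrete_topology)
  moreover have "?K \<subseteq> Pi\<^sub>E (verts T) Orb"
    using tree_Aut_extensional by (auto simp: PiE_def Orb_def)
  ultimately have "compactin ?P ?K" by (meson closed_compactin)
  then show ?thesis unfolding tree_Aut_topology_def by (auto simp: compactin_subtopology)
qed

lemma countable_verts: "verts T \<noteq> {} \<Longrightarrow> countable (verts T)"
proof -
  assume "verts T \<noteq> {}"
  then obtain u where u: "u \<in> verts T" by blast
  let ?E = "{(p, q). {p, q} \<in> edges T}"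
  have fin: "finite {v. (u, v) \<in> ?E ^^ n}" for n
  proof (induction n)
    case (Suc n)
    have "{v. (u, v) \<in> ?E ^^ Suc n} \<subseteq> (\<Union>w\<in>{v. (u, v) \<in> ?E ^^ n}. if w \<in> verts T then {v. {w, v} \<in> edges T} else {})"
      using edge_verts by (auto simp: relcomp_unfold split: if_splits)
    then show ?case using Suc finite_neighbours by (elim finite_subset) auto
  qed simp
  have "verts T \<subseteq> (\<Union>n. {v. (u, v) \<in> ?E ^^ n})"
    using connected[OF u] by (auto simp: rtrancl_power)
  then show ?thesis using fin countable_subset by (meson countable_UN countableI_type countable_finite)
qed

end

lemma regular_tree_locally_finite:
  assumes "regular_tree d T"
  shows "locally_finite_graph T"
proof
  show "u \<in> verts T" if "{u, v} \<in> edges T" for u v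
    using assms that unfolding regular_tree_def simple_ugraph_def
    by (metis doubleton_eq_iff)
qed (use assms in \<open>auto simp: regular_tree_def ugraph_connected_def\<close>)

text \<open>For a subgroup, being a lattice is a consequence of simple transitivity:
  \<open>permutation_lattice\<close> is instantiated with the action on pairs of vertices.\<close>

theorem BMW_groupI:
  assumes T1: "regular_tree d1 T1" and T2: "regular_tree d2 T2"
    and \<Gamma>: "subgroup \<Gamma> (Aut_prod T1 T2)"
    and st: "\<And>p q. p \<in> verts T1 \<times> verts T2 \<Longrightarrow> q \<in> verts T1 \<times> verts T2 \<Longrightarrow>
       \<exists>!\<gamma>. \<gamma> \<in> \<Gamma> \<and> map_prod (fst \<gamma>) (snd \<gamma>) p = q"
  shows "BMW_group d1 d2 T1 T2 \<Gamma>"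
proof -
  interpret A: locally_finite_graph T1 by (rule regular_tree_locally_finite[OF T1])
  interpret B: locally_finite_graph T2 by (rule regular_tree_locally_finite[OF T2])
  obtain u v where uv: "u \<in> verts T1" "v \<in> verts T2"
    using T1 T2 by (auto simp: regular_tree_def)
  let ?\<tau> = "prod_topology (tree_Aut_topology T1) (tree_Aut_topology T2)"
  interpret permutation_lattice "Aut_prod T1 T2" "\<lambda>\<gamma>. map_prod (fst \<gamma>) (snd \<gamma>)" "verts T1 \<times> verts T2"
    ?\<tau> \<Gamma> "(u, v)"
  proof (intro permutation_lattice.intro permutation_lattice_axioms.intro)
    show "group (Aut_prod T1 T2)" by (rule group_Aut_prod)
    show "map_prod (fst g) (snd g) p \<in> verts T1 \<times> verts T2"
      if "g \<in> carrier (Aut_prod T1 T2)" "p \<in> verts T1 \<times> verts T2" for g p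
      using that tree_Aut_verts[of "fst g" T1] tree_Aut_verts[of "snd g" T2]
      by (auto simp: carrier_tree_Aut)
    show "map_prod (fst (g \<otimes>\<^bsub>Aut_prod T1 T2\<^esub> h)) (snd (g \<otimes>\<^bsub>Aut_prod T1 T2\<^esub> h)) p =
       map_prod (fst g) (snd g) (map_prod (fst h) (snd h) p)"
      if "g \<in> carrier (Aut_prod T1 T2)" "h \<in> carrier (Aut_prod T1 T2)" "p \<in> verts T1 \<times> verts T2" for g h p
      using that
      by (cases g; cases h) (auto simp: carrier_Aut_prod mult_tree_Aut compose_eq carrier_tree_Aut)
    show "map_prod (fst \<one>\<^bsub>Aut_prod T1 T2\<^esub>) (snd \<one>\<^bsub>Aut_prod T1 T2\<^esub>) p = p"
      if "p \<in> verts T1 \<times> verts T2" for p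
      using that by (auto simp: one_tree_Aut)
    show "countable (verts T1 \<times> verts T2)" "(u, v) \<in> verts T1 \<times> verts T2"
      using A.countable_verts B.countable_verts uv by auto
    show "topspace ?\<tau> = carrier (Aut_prod T1 T2)"
      by (simp add: A.topspace_tree_Aut_topology B.topspace_tree_Aut_topology carrier_tree_Aut)
    show "openin ?\<tau> {h \<in> carrier (Aut_prod T1 T2). \<forall>p\<in>B. map_prod (fst h) (snd h) p
        = map_prod (fst g) (snd g) p}"
      if B: "finite B" "B \<subseteq> verts T1 \<times> verts T2" and gc: "g \<in> carrier (Aut_prod T1 T2)" for B g
    proof -
      obtain g1 g2 where g: "g = (g1, g2)" "g1 \<in> tree_Aut_set T1" "g2 \<in> tree_Aut_set T2"
        using gc by (cases g) (auto simp: carrier_tree_Aut)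
      have "{h \<in> carrier (Aut_prod T1 T2). \<forall>p\<in>B. map_prod (fst h) (snd h) p = map_prod (fst g) (snd g) p} =
        {h \<in> tree_Aut_set T1. \<forall>v\<in>fst ` B. h v = g1 v} \<times> {h \<in> tree_Aut_set T2. \<forall>v\<in>snd ` B. h v = g2 v}"
        using g by (fastforce simp: carrier_tree_Aut)
      moreover have "openin (tree_Aut_topology T1) {h \<in> tree_Aut_set T1. \<forall>v\<in>fst ` B. h v = g1 v}"
        using B g by (intro A.openin_Aut_window) auto
      moreover have "openin (tree_Aut_topology T2) {h \<in> tree_Aut_set T2. \<forall>v\<in>snd ` B. h v = g2 v}"
        using B g by (intro B.openin_Aut_window) auto
      ultimately show ?thesis by (simp add: openin_prod_Times_iff)
    qed
    show "\<exists>B. finite B \<and> B \<subseteq> verts T1 \<times> verts T2 \<and> (\<forall>h\<in>carrier (Aut_prod T1 T2).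
       (\<forall>p\<in>B. map_prod (fst h) (snd h) p = map_prod (fst g) (snd g) p) \<longrightarrow> h \<in> U)"
      if U: "openin ?\<tau> U" and gU: "g \<in> U" for U g
    proof -
      obtain g1 g2 where g: "g = (g1, g2)" by (cases g)
      obtain U1 U2 where U: "openin (tree_Aut_topology T1) U1" "openin (tree_Aut_topology T2) U2"
        "g1 \<in> U1" "g2 \<in> U2" "U1 \<times> U2 \<subseteq> U"
        using U gU g unfolding openin_prod_topology_alt by metis
      obtain B1 where B1: "finite B1" "B1 \<subseteq> verts T1" "\<And>h. h \<in> tree_Aut_set T1 \<Longrightarrow> (\<forall>v\<in>B1. h v = g1 v) \<Longrightarrow>
          h \<in> U1"
        using A.Aut_window_nbhd[OF U(1,3)] by blast
      obtain B2 where B2: "finite B2" "B2 \<subseteq> verts T2" "\<And>h. h \<in> tree_Aut_set T2 \<Longrightarrow> (\<forall>v\<in>B2. h v = g2 v) \<Longrightarrow>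
          h \<in> U2"
        using B.Aut_window_nbhd[OF U(2,4)] by blast
      show ?thesis
      \<comment> \<open>A cross through the base pair: its first bar controls the first component of
        \<open>h\<close>, its second bar the second.\<close>
      proof (intro exI[of _ "B1 \<times> {v} \<union> {u} \<times> B2"] conjI ballI impI)
        show "finite (B1 \<times> {v} \<union> {u} \<times> B2)" using B1 B2 by auto
        show "B1 \<times> {v} \<union> {u} \<times> B2 \<subseteq> verts T1 \<times> verts T2" using B1 B2 uv by auto
        fix h assume h: "h \<in> carrier (Aut_prod T1 T2)"
          "\<forall>p\<in>B1 \<times> {v} \<union> {u} \<times> B2. map_prod (fst h) (snd h) p = map_prod (fst g) (snd g) p"
        have "fst h w = g1 w" if "w \<in> B1" for w using h(2) g that by (cases h) force
        then have "fst h \<in> U1" using h by (intro B1(3)) (auto simp: carrier_tree_Aut)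
        moreover have "snd h w = g2 w" if "w \<in> B2" for w using h(2) g that by (cases h) force
        then have "snd h \<in> U2" using h by (intro B2(3)) (auto simp: carrier_tree_Aut)
        ultimately show "h \<in> U" using U(5) by (cases h) auto
      qed
    qed
    have "{g \<in> carrier (Aut_prod T1 T2). map_prod (fst g) (snd g) (u, v) = (u, v)} =
       {f \<in> tree_Aut_set T1. f u = u} \<times> {f \<in> tree_Aut_set T2. f v = v}"
      by (force simp: carrier_tree_Aut)
    then show "compactin ?\<tau> {g \<in> carrier (Aut_prod T1 T2). map_prod (fst g) (snd g) (u, v) = (u, v)}"
      using A.compactin_stabilizer[OF uv(1)] B.compactin_stabilizer[OF uv(2)] by (simp add: compactin_Times)
    show "subgroup \<Gamma> (Aut_prod T1 T2)" by (rule \<Gamma>)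
    show "\<exists>!\<gamma>. \<gamma> \<in> \<Gamma> \<and> map_prod (fst \<gamma>) (snd \<gamma>) p = q"
      if "p \<in> verts T1 \<times> verts T2" "q \<in> verts T1 \<times> verts T2" for p q
      using that by (rule st)
  qed
  show ?thesis
    unfolding BMW_group_def by (intro conjI ballI T1 T2 lattice st)
qed

text \<open>With finite index, two powers of \<alpha> share a coset, so a positive power
  \<open>s\<close> lies in the product subgroup. The subgroup then also contains the identity paired
  with the second component of \<open>s\<close>. This element fixes \<open>(u, v)\<close>, so it is
  trivial, against the last assumption on \<alpha>.\<close>

lemma irreducible_latticeI:
  fixes T1 :: "'u ugraph" and T2 :: "'v ugraph"
  assumes \<Gamma>: "subgroup \<Gamma> (Aut_prod T1 T2)"
    and free: "\<And>\<gamma>. \<gamma> \<in> \<Gamma> \<Longrightarrow> fst \<gamma> u = u \<Longrightarrow> snd \<gamma> v = v \<Longrightarrow> \<gamma> = \<one>\<^bsub>Aut_prod T1 T2\<^esub>"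
    and u: "u \<in> verts T1"
    and \<alpha>: "\<alpha> \<in> \<Gamma>" "\<And>n :: nat. snd (\<alpha> [^]\<^bsub>Aut_prod T1 T2\<^esub> n) v = v"
      "\<And>n :: nat. 0 < n \<Longrightarrow> snd (\<alpha> [^]\<^bsub>Aut_prod T1 T2\<^esub> n) \<noteq> \<one>\<^bsub>tree_Aut T2\<^esub>"
  shows "irreducible_lattice T1 T2 \<Gamma>"
  unfolding irreducible_lattice_def
proof (rule notI, elim exE conjE)
  fix \<Lambda>1 :: "('u \<Rightarrow> 'u) set" and \<Lambda>2 :: "('v \<Rightarrow> 'v) set"
  let ?G = "Aut_prod T1 T2" and ?H = "Aut_prod T1 T2 \<lparr>carrier := \<Gamma>\<rparr>" and ?S = "\<Lambda>1 \<times> \<Lambda>2"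
  assume L: "subgroup \<Lambda>1 (tree_Aut T1)" "subgroup \<Lambda>2 (tree_Aut T2)" "subgroup ?S ?H"
    and fin: "finite (rcosets\<^bsub>?H\<^esub> ?S)"
  interpret G: group ?G by (rule group_Aut_prod)
  interpret H: group ?H by (rule G.subgroup_imp_group[OF \<Gamma>])
  have pow: "\<alpha> [^]\<^bsub>?G\<^esub> n \<in> \<Gamma>" for n :: nat
    using \<alpha>(1) subgroup.one_closed[OF \<Gamma>] subgroup.m_closed[OF \<Gamma>] by (induction n) auto
  have \<alpha>G: "\<alpha> \<in> carrier ?G" using \<alpha>(1) subgroup.subset[OF \<Gamma>] by blast
  have "\<not> inj (\<lambda>n::nat. ?S #>\<^bsub>?H\<^esub> (\<alpha> [^]\<^bsub>?G\<^esub> n))"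
  proof
    assume "inj (\<lambda>n::nat. ?S #>\<^bsub>?H\<^esub> (\<alpha> [^]\<^bsub>?G\<^esub> n))"
    moreover have "finite (range (\<lambda>n::nat. ?S #>\<^bsub>?H\<^esub> (\<alpha> [^]\<^bsub>?G\<^esub> n)))"
      by (rule finite_subset[OF _ fin]) (use pow in \<open>auto simp: RCOSETS_def\<close>)
    ultimately show False using finite_imageD infinite_UNIV_nat by blast
  qed
  then obtain m n :: nat where "m \<noteq> n" "?S #>\<^bsub>?H\<^esub> (\<alpha> [^]\<^bsub>?G\<^esub> m) = ?S #>\<^bsub>?H\<^esub> (\<alpha> [^]\<^bsub>?G\<^esub> n)"
    unfolding inj_def by blast
  then obtain m n :: nat where mn: "m < n" "?S #>\<^bsub>?H\<^esub> (\<alpha> [^]\<^bsub>?G\<^esub> m) = ?S #>\<^bsub>?H\<^esub> (\<alpha> [^]\<^bsub>?G\<^esub> n)"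
    by (metis nat_neq_iff)
  have "\<alpha> [^]\<^bsub>?G\<^esub> n \<in> ?S #>\<^bsub>?H\<^esub> (\<alpha> [^]\<^bsub>?G\<^esub> m)"
    unfolding mn(2) by (rule H.rcos_self[OF _ L(3)]) (use pow in simp)
  then obtain s where s: "s \<in> ?S" "\<alpha> [^]\<^bsub>?G\<^esub> n = s \<otimes>\<^bsub>?G\<^esub> \<alpha> [^]\<^bsub>?G\<^esub> m" by (auto simp: r_coset_def)
  have sG: "s \<in> carrier ?G" using s(1) subgroup.subset[OF L(3)] subgroup.subset[OF \<Gamma>] by auto
  have "\<alpha> [^]\<^bsub>?G\<^esub> n = \<alpha> [^]\<^bsub>?G\<^esub> (n - m) \<otimes>\<^bsub>?G\<^esub> \<alpha> [^]\<^bsub>?G\<^esub> m"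
    using mn(1) G.nat_pow_mult[OF \<alpha>G, of "n - m" m] by simp
  then have s_pow: "s = \<alpha> [^]\<^bsub>?G\<^esub> (n - m)" using s(2) sG \<alpha>G by (metis G.nat_pow_closed G.right_cancel)
  have "(\<one>\<^bsub>tree_Aut T1\<^esub>, snd s) \<in> ?S"
    using s(1) subgroup.one_closed[OF L(1)] by (cases s) auto
  then have "(\<one>\<^bsub>tree_Aut T1\<^esub>, snd s) \<in> \<Gamma>" using subgroup.subset[OF L(3)] by auto
  then have "(\<one>\<^bsub>tree_Aut T1\<^esub>, snd s) = \<one>\<^bsub>?G\<^esub>"
    by (rule free) (use u \<alpha>(2) s_pow in \<open>auto simp: one_tree_Aut\<close>)
  then show False using \<alpha>(3)[of "n - m"] mn(1) s_pow by simp
qed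

section \<open>The geometric realization of a tree\<close>

definition vertex_point :: "'v \<Rightarrow> 'v \<Rightarrow> real" where
  "vertex_point u = (\<lambda>v. if v = u then 1 else 0)"

lemma vertex_point_inj: "vertex_point u = vertex_point v \<longleftrightarrow> u = v"
  by (metis vertex_point_def zero_neq_one)

text \<open>Barycentric interpolation of \<open>F\<close>. Summing over the support of
  \<open>p\<close> avoids a choice of cell containing \<open>p\<close>.\<close>

definition affine_ext :: "('v \<Rightarrow> real) \<Rightarrow> ('v \<Rightarrow> real) \<Rightarrow> real" where
  "affine_ext F p = (\<Sum>v | p v \<noteq> 0. p v * F v)"

text \<open>With \<open>ex_edge\<close> every point, vertices included, lies in an edge, so that
  products of edges cover a product of two trees.\<close>

locale metric_graph = locally_finite_graph T for T :: "'v ugraph" +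
  assumes edgeE: "e \<in> edges T \<Longrightarrow> \<exists>u v. u \<noteq> v \<and> e = {u, v} \<and> u \<in> verts T \<and> v \<in> verts T"
    and ex_edge: "u \<in> verts T \<Longrightarrow> \<exists>v. {u, v} \<in> edges T"
    and nonempty: "verts T \<noteq> {}"
begin

abbreviation "pts \<equiv> tree_points T"
abbreviation "d \<equiv> tree_dist T"

lemma cell_cases:
  assumes "e \<in> cells T"
  obtains (vertex) u where "u \<in> verts T" "e = {u}"
  | (edge) u v where "u \<in> verts T" "v \<in> verts T" "u \<noteq> v" "e = {u, v}" "{u, v} \<in> edges T"
proof (cases "e \<in> edges T")
  case True
  then obtain u v where "u \<noteq> v" "e = {u, v}" "u \<in> verts T" "v \<in> verts T" using edgeE by blast
  then show ?thesis using True edge by blast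
next
  case False
  then show ?thesis using assms vertex by (auto simp: cells_def)
qed

lemma edge_in_cells: "e \<in> edges T \<Longrightarrow> e \<in> cells T"
  by (simp add: cells_def)

lemma vertex_in_cells: "u \<in> verts T \<Longrightarrow> {u} \<in> cells T"
  by (simp add: cells_def)

lemma cell_subset: "e \<in> cells T \<Longrightarrow> e \<subseteq> verts T"
  by (erule cell_cases) auto

lemma finite_cell: "e \<in> cells T \<Longrightarrow> finite e"
  by (erule cell_cases) auto

lemma cell_nonempty: "e \<in> cells T \<Longrightarrow> e \<noteq> {}"
  by (erule cell_cases) auto

lemma ptsI: "p \<in> cell_points e \<Longrightarrow> e \<in> cells T \<Longrightarrow> p \<in> pts"
  by (auto simp: tree_points_def)

lemma vertex_point_in_cell: "e \<in> cells T \<Longrightarrow> u \<in> e \<Longrightarrow> vertex_point u \<in> cell_points e"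
  using finite_cell[of e] by (auto simp: cell_points_def vertex_point_def)

lemma cell_points_singleton: "p \<in> cell_points {u} \<longleftrightarrow> p = vertex_point u"
  by (auto simp: cell_points_def vertex_point_def)

lemma cell_points_edge:
  "u \<noteq> v \<Longrightarrow> p \<in> cell_points {u, v} \<longleftrightarrow>
    0 \<le> p u \<and> 0 \<le> p v \<and> p u + p v = 1 \<and> (\<forall>w. w \<noteq> u \<longrightarrow> w \<noteq> v \<longrightarrow> p w = 0)"
  by (auto simp: cell_points_def)

lemma cell_dist_edge:
  assumes "u \<noteq> v" "p \<in> cell_points {u, v}" "q \<in> cell_points {u, v}"
  shows "cell_dist {u, v} p q = \<bar>p u - q u\<bar>"
proof -
  have "p v - q v = - (p u - q u)" using assms by (auto simp: cell_points_edge)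
  then have "\<bar>p v - q v\<bar> = \<bar>p u - q u\<bar>" by (simp only: abs_minus_cancel)
  then show ?thesis using assms(1) by (simp add: cell_dist_def)
qed

lemma cell_dist_nonneg: "0 \<le> cell_dist e p q"
  by (auto simp: cell_dist_def intro: sum_nonneg)

lemma cell_dist_commute: "cell_dist e p q = cell_dist e q p"
  by (simp add: cell_dist_def abs_minus_commute)

lemma value_le_cell_dist:
  assumes "e \<in> cells T" "p \<in> cell_points e" "q \<in> cell_points e"
  shows "\<bar>p v - q v\<bar> \<le> cell_dist e p q"
  using assms(1)
proof (cases rule: cell_cases)
  case (vertex u)
  then show ?thesis using assms cell_dist_nonneg by (auto simp: cell_points_singleton)
next
  case (edge u w)
  then have pq: "p \<in> cell_points {u, w}" "q \<in> cell_points {u, w}" using assms by auto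
  then have "p w - q w = - (p u - q u)" "v \<noteq> u \<Longrightarrow> v \<noteq> w \<Longrightarrow> p v - q v = 0"
    using edge by (auto simp: cell_points_edge)
  then show ?thesis using cell_dist_edge[OF edge(3) pq] edge(4)
    by (cases "v = u"; cases "v = w") auto
qed

lemma affine_ext_cell:
  assumes "e \<in> cells T" "p \<in> cell_points e"
  shows "affine_ext F p = (\<Sum>v\<in>e. p v * F v)"
  unfolding affine_ext_def
  using finite_cell[OF assms(1)] assms(2)
  by (intro sum.mono_neutral_left) (auto simp: cell_points_def)

lemma affine_ext_edge:
  assumes "{u, v} \<in> edges T" "u \<noteq> v" "p \<in> cell_points {u, v}"
  shows "affine_ext F p = F u + p v * (F v - F u)"
proof -
  have u: "p u = 1 - p v" using assms by (auto simp: cell_points_edge)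
  have "affine_ext F p = p u * F u + p v * F v"
    using assms affine_ext_cell[OF edge_in_cells[OF assms(1)] assms(3)] by simp
  then show ?thesis unfolding u by (simp add: algebra_simps)
qed

definition lipschitz :: "('v \<Rightarrow> real) \<Rightarrow> bool" where
  "lipschitz F \<longleftrightarrow> (\<forall>u v. {u, v} \<in> edges T \<longrightarrow> \<bar>F u - F v\<bar> \<le> 1)"

lemma affine_ext_le_cell_dist:
  assumes F: "lipschitz F" and e: "e \<in> cells T" and p: "p \<in> cell_points e" "q \<in> cell_points e"
  shows "\<bar>affine_ext F p - affine_ext F q\<bar> \<le> cell_dist e p q"
  using e
proof (cases rule: cell_cases)
  case (vertex u)
  then show ?thesis using p cell_dist_nonneg by (auto simp: cell_points_singleton)
next
  case (edge u w)
  then have pq: "p \<in> cell_points {w, u}" "q \<in> cell_points {w, u}" "{w, u} \<in> edges T"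
    using p by (auto simp: insert_commute)
  have "affine_ext F p - affine_ext F q = (p u - q u) * (F u - F w)"
    using affine_ext_edge[OF pq(3) _ pq(1), of F] affine_ext_edge[OF pq(3) _ pq(2), of F] edge(3)
    by (simp add: algebra_simps)
  moreover have "\<bar>p u - q u\<bar> * \<bar>F u - F w\<bar> \<le> \<bar>p u - q u\<bar> * 1"
    using F edge(5) unfolding lipschitz_def by (intro mult_left_mono) auto
  ultimately have "\<bar>affine_ext F p - affine_ext F q\<bar> \<le> \<bar>p u - q u\<bar> * 1"
    by (simp add: abs_mult)
  then show ?thesis using cell_dist_edge[OF edge(3), of p q] edge(4) p by simp
qed

section \<open>The length metric\<close>

lemma string_length_nonneg: "string_length T p q l \<Longrightarrow> 0 \<le> l"
  by (induction rule: string_length.induct) (auto intro: add_nonneg_nonneg cell_dist_nonneg)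

lemma string_length_trans:
  "string_length T q r m \<Longrightarrow> string_length T p q l \<Longrightarrow> string_length T p r (l + m)"
proof (induction rule: string_length.induct)
  case (step q r m e s)
  then have "string_length T p s ((l + m) + cell_dist e r s)" by (intro string_length.step) auto
  then show ?case by (simp add: add.assoc)
qed simp

lemma string_length_cell:
  assumes "e \<in> cells T" "p \<in> cell_points e" "q \<in> cell_points e"
  shows "string_length T p q (cell_dist e p q)"
  using string_length.step[OF string_length.start[OF ptsI] assms] assms by simp

lemma string_length_sym: "string_length T p q l \<Longrightarrow> string_length T q p l"
proof (induction rule: string_length.induct)
  case (step p q l e r)
  have "string_length T r q (cell_dist e q r)"
    using string_length_cell[of e r q] step by (simp add: cell_dist_commute)
  from string_length_trans[OF step.IH this] show ?case by (simp add: add.commute)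
qed (rule string_length.start)

lemma ex_string_to_vertex:
  assumes "p \<in> pts" "u \<in> verts T"
  shows "\<exists>l. string_length T p (vertex_point u) l"
proof -
  obtain e where e: "e \<in> cells T" "p \<in> cell_points e" using assms by (auto simp: tree_points_def)
  obtain v where v: "v \<in> e" using cell_nonempty[OF e(1)] by blast
  have "(v, u) \<in> {(p, q). {p, q} \<in> edges T}\<^sup>*" using connected cell_subset[OF e(1)] v assms by blast
  then show ?thesis
  proof (induction rule: rtrancl_induct)
    case base
    show ?case using string_length_cell[OF e vertex_point_in_cell[OF e(1) v]] by blast
  next
    case (step y z)
    then have "{y, z} \<in> cells T" using edge_in_cells by auto
    then show ?case using step.IH string_length.step vertex_point_in_cell by (metis insertI1 insert_commute)
  qed
qed

lemma ex_string: "p \<in> pts \<Longrightarrow> q \<in> pts \<Longrightarrow> \<exists>l. string_length T p q l"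
  using ex_string_to_vertex nonempty string_length_trans string_length_sym by (metis ex_in_conv)

lemma d_le_string: "string_length T p q l \<Longrightarrow> d p q \<le> l"
  unfolding tree_dist_def by (rule cInf_lower) (auto intro!: bdd_belowI[of _ 0] string_length_nonneg)

lemma le_dI: "p \<in> pts \<Longrightarrow> q \<in> pts \<Longrightarrow> (\<And>l. string_length T p q l \<Longrightarrow> c \<le> l) \<Longrightarrow> c \<le> d p q"
  unfolding tree_dist_def using ex_string by (intro cInf_greatest) auto

lemma d_nonneg: "p \<in> pts \<Longrightarrow> q \<in> pts \<Longrightarrow> 0 \<le> d p q"
  by (rule le_dI) (auto intro: string_length_nonneg)

lemma d_commute: "d p q = d q p"
proof -
  have "{l. string_length T p q l} = {l. string_length T q p l}" using string_length_sym by blast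
  then show ?thesis by (simp add: tree_dist_def)
qed

lemma d_self: "p \<in> pts \<Longrightarrow> d p p = 0"
  using d_le_string[OF string_length.start] d_nonneg by (metis antisym)

lemma d_triangle:
  assumes "p \<in> pts" "q \<in> pts" "r \<in> pts"
  shows "d p r \<le> d p q + d q r"
proof -
  have "d p r - m \<le> d p q" if "string_length T q r m" for m
  proof (rule le_dI[OF assms(1,2)])
    fix l assume "string_length T p q l"
    then show "d p r - m \<le> l" using d_le_string[OF string_length_trans[OF that]] by force
  qed
  then have "d p r - d p q \<le> d q r"
    by (intro le_dI[OF assms(2,3)]) force
  then show ?thesis by simp
qed

text \<open>Lower bounds for an infimum over strings come from functions that vary on each step by
  at most its length.\<close>

lemma affine_ext_le_d:
  assumes "lipschitz F" "p \<in> pts" "q \<in> pts"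
  shows "\<bar>affine_ext F p - affine_ext F q\<bar> \<le> d p q"
proof (rule le_dI[OF assms(2,3)])
  fix l assume "string_length T p q l"
  then show "\<bar>affine_ext F p - affine_ext F q\<bar> \<le> l"
  proof (induction rule: string_length.induct)
    case (step p q l e r)
    then show ?case using affine_ext_le_cell_dist[OF assms(1) step(2,3,4)] by linarith
  qed simp
qed

text \<open>Each barycentric coordinate is 1-Lipschitz on cells. This separates points and locates
  points close to a given one.\<close>

lemma value_le_d:
  assumes "p \<in> pts" "q \<in> pts"
  shows "\<bar>p v - q v\<bar> \<le> d p q"
proof (rule le_dI[OF assms])
  fix l assume "string_length T p q l"
  then show "\<bar>p v - q v\<bar> \<le> l"
  proof (induction rule: string_length.induct)
    case (step p q l e r)
    then show ?case using value_le_cell_dist[OF step(2,3,4), of v] by linarith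
  qed simp
qed

lemma d_eq_0_iff: "p \<in> pts \<Longrightarrow> q \<in> pts \<Longrightarrow> d p q = 0 \<longleftrightarrow> p = q"
  using value_le_d[of p q] by (auto simp: d_self)

lemma d_le_cell_dist: "e \<in> cells T \<Longrightarrow> p \<in> cell_points e \<Longrightarrow> q \<in> cell_points e \<Longrightarrow> d p q \<le> cell_dist e p q"
  by (intro d_le_string string_length_cell)

section \<open>Automorphisms acting on the realization\<close>

lemma realize_apply:
  "f \<in> tree_Aut_set T \<Longrightarrow> v \<in> verts T \<Longrightarrow> realize T f p (f v) = p v"
  using tree_Aut_inj[of f T] tree_Aut_verts[of f T v] by (simp add: realize_def)

lemma realize_outside: "v \<notin> verts T \<Longrightarrow> realize T f p v = 0"
  by (simp add: realize_def)

lemma pts_outside: "p \<in> pts \<Longrightarrow> v \<notin> verts T \<Longrightarrow> p v = 0"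
  using cell_subset by (fastforce simp: tree_points_def cell_points_def)

text \<open>The definition of \<open>realize\<close> uses an inverse function; prescribing values at
  \<open>f v\<close> avoids computing with it.\<close>

lemma realize_eqI:
  assumes f: "f \<in> tree_Aut_set T" and q: "\<And>v. v \<in> verts T \<Longrightarrow> q (f v) = p v" "\<And>v. v \<notin> verts T \<Longrightarrow> q v = 0"
  shows "realize T f p = q"
proof
  fix v
  show "realize T f p v = q v"
  proof (cases "v \<in> verts T")
    case True
    then obtain u where "u \<in> verts T" "f u = v" using tree_Aut_surj[OF f] by blast
    then show ?thesis using realize_apply[OF f] q by auto
  qed (simp add: realize_outside q)
qed

lemma Aut_cells:
  assumes f: "f \<in> tree_Aut_set T" and e: "e \<in> cells T"
  shows "f ` e \<in> cells T"
  using e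
proof (cases rule: cell_cases)
  case (vertex u)
  then show ?thesis using tree_Aut_verts[OF f] by (auto intro: vertex_in_cells)
next
  case (edge u v)
  then have "{f u, f v} \<in> edges T" using tree_Aut_edge[OF f] by simp
  then show ?thesis using edge by (auto intro: edge_in_cells)
qed

lemma realize_cell_points:
  assumes f: "f \<in> tree_Aut_set T" and e: "e \<in> cells T" and p: "p \<in> cell_points e"
  shows "realize T f p \<in> cell_points (f ` e)"
proof -
  have inj: "inj_on f e" using tree_Aut_inj[OF f] cell_subset[OF e] inj_on_subset by blast
  have "(\<Sum>v\<in>f ` e. realize T f p v) = (\<Sum>v\<in>e. p v)"
    unfolding sum.reindex[OF inj] comp_def
    using cell_subset[OF e] realize_apply[OF f] by (intro sum.cong) auto
  moreover have "realize T f p w = 0" if w: "w \<notin> f ` e" for w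
  proof (cases "w \<in> verts T")
    case True
    then obtain u where "u \<in> verts T" "f u = w" using tree_Aut_surj[OF f] by blast
    then show ?thesis using realize_apply[OF f] w p by (auto simp: cell_points_def)
  qed (rule realize_outside)
  moreover have "0 \<le> realize T f p w" for w
    using p by (simp add: realize_def cell_points_def)
  ultimately show ?thesis using p by (simp add: cell_points_def)
qed

lemma realize_pts: "f \<in> tree_Aut_set T \<Longrightarrow> p \<in> pts \<Longrightarrow> realize T f p \<in> pts"
  unfolding tree_points_def using Aut_cells realize_cell_points by blast

lemma realize_cell_dist:
  assumes f: "f \<in> tree_Aut_set T" and e: "e \<in> cells T"
  shows "cell_dist (f ` e) (realize T f p) (realize T f q) = cell_dist e p q"
proof -
  have inj: "inj_on f e" using tree_Aut_inj[OF f] cell_subset[OF e] inj_on_subset by blast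
  have "(\<Sum>v\<in>f ` e. \<bar>realize T f p v - realize T f q v\<bar>) = (\<Sum>v\<in>e. \<bar>p v - q v\<bar>)"
    unfolding sum.reindex[OF inj] comp_def
    using cell_subset[OF e] realize_apply[OF f] by (intro sum.cong) auto
  then show ?thesis by (simp add: cell_dist_def)
qed

lemma realize_string:
  assumes f: "f \<in> tree_Aut_set T"
  shows "string_length T p q l \<Longrightarrow> string_length T (realize T f p) (realize T f q) l"
proof (induction rule: string_length.induct)
  case (start p)
  then show ?case by (intro string_length.start realize_pts[OF f])
next
  case (step p q l e r)
  then show ?case
    using string_length.step[OF step.IH Aut_cells[OF f step(2)] realize_cell_points[OF f step(2,3)]
        realize_cell_points[OF f step(2,4)]]
    by (simp add: realize_cell_dist[OF f])
qed

lemma realize_compose: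
  assumes "f \<in> tree_Aut_set T" "g \<in> tree_Aut_set T"
  shows "realize T (compose (verts T) f g) p = realize T f (realize T g p)"
proof (rule realize_eqI)
  have "f \<otimes>\<^bsub>tree_Aut T\<^esub> g \<in> tree_Aut_set T"
    using group_tree_Aut[of T] assms by (metis carrier_tree_Aut group.is_monoid monoid.m_closed)
  then show "compose (verts T) f g \<in> tree_Aut_set T" using assms by (simp add: mult_tree_Aut)
qed (use assms tree_Aut_verts[OF assms(2)] in \<open>auto simp: compose_eq realize_apply realize_outside\<close>)

lemma realize_id: "p \<in> pts \<Longrightarrow> realize T (\<lambda>x\<in>verts T. x) p = p"
proof (rule realize_eqI)
  show "(\<lambda>x\<in>verts T. x) \<in> tree_Aut_set T"
    using group_tree_Aut[of T] by (metis carrier_tree_Aut group.is_monoid monoid.one_closed one_tree_Aut)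
qed (auto simp: pts_outside)

lemma realize_inverse:
  assumes f: "f \<in> tree_Aut_set T" and p: "p \<in> pts"
  shows "realize T (restrict (inv_into (verts T) f) (verts T)) (realize T f p) = p"
proof (rule realize_eqI[OF inverse_in_tree_Aut_set[OF f]])
  fix v assume v: "v \<in> verts T"
  then obtain u where "u \<in> verts T" "f u = v" using tree_Aut_surj[OF f] by blast
  then show "p (restrict (inv_into (verts T) f) (verts T) v) = realize T f p v"
    using v realize_apply[OF f] tree_Aut_inj[OF f] by (auto simp: inv_into_f_eq)
qed (use p in \<open>simp add: pts_outside\<close>)

text \<open>Strings go to strings of the same length, so no automorphism increases distances; the
  inverse gives the other inequality.\<close>

lemma realize_isometry:
  assumes f: "f \<in> tree_Aut_set T" and pq: "p \<in> pts" "q \<in> pts"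
  shows "d (realize T f p) (realize T f q) = d p q"
proof (rule antisym)
  have le: "d (realize T g x) (realize T g y) \<le> d x y" if "g \<in> tree_Aut_set T" "x \<in> pts" "y \<in> pts" for g x y
    by (rule le_dI[OF that(2,3)]) (use that realize_string d_le_string in blast)
  show "d (realize T f p) (realize T f q) \<le> d p q" by (rule le[OF f pq])
  show "d p q \<le> d (realize T f p) (realize T f q)"
    using le[OF inverse_in_tree_Aut_set[OF f] realize_pts[OF f pq(1)] realize_pts[OF f pq(2)]]
    by (simp add: realize_inverse[OF f] pq)
qed

lemma realize_vertex_point:
  assumes f: "f \<in> tree_Aut_set T" and u: "u \<in> verts T"
  shows "realize T f (vertex_point u) = vertex_point (f u)"
  by (rule realize_eqI[OF f])
    (use u tree_Aut_verts[OF f u] tree_Aut_inj[OF f] in \<open>auto simp: vertex_point_def inj_on_eq_iff\<close>)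

lemma affine_ext_realize:
  assumes f: "f \<in> tree_Aut_set T" and p: "p \<in> pts"
    and F: "\<And>v. v \<in> verts T \<Longrightarrow> F (f v) = F v + c"
  shows "affine_ext F (realize T f p) = affine_ext F p + c"
proof -
  obtain e where e: "e \<in> cells T" "p \<in> cell_points e" using p by (auto simp: tree_points_def)
  have inj: "inj_on f e" using tree_Aut_inj[OF f] cell_subset[OF e(1)] inj_on_subset by blast
  have "affine_ext F (realize T f p) = (\<Sum>v\<in>f ` e. realize T f p v * F v)"
    by (rule affine_ext_cell[OF Aut_cells[OF f e(1)] realize_cell_points[OF f e]])
  also have "\<dots> = (\<Sum>v\<in>e. p v * F v + p v * c)"
    unfolding sum.reindex[OF inj] comp_def
    using cell_subset[OF e(1)] realize_apply[OF f] F by (intro sum.cong) (auto simp: distrib_left)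
  also have "\<dots> = affine_ext F p + c"
    using e affine_ext_cell[OF e] by (simp add: sum.distrib sum_distrib_right[symmetric] cell_points_def)
  finally show ?thesis .
qed

lemma ex_big_coord: "p \<in> pts \<Longrightarrow> \<exists>v\<in>verts T. 1/2 \<le> p v"
proof -
  assume "p \<in> pts"
  then obtain e where e: "e \<in> cells T" "p \<in> cell_points e" by (auto simp: tree_points_def)
  show ?thesis
    using e(1)
  proof (cases rule: cell_cases)
    case (vertex u)
    then show ?thesis using e by (auto simp: cell_points_singleton vertex_point_def)
  next
    case (edge u v)
    then have "p u + p v = 1" using e cell_points_edge[OF edge(3), of p] by simp
    then have "1/2 \<le> p u \<or> 1/2 \<le> p v" by linarith
    then show ?thesis using edge by blast
  qed
qed

lemma positive_coords_adjacent:
  assumes "p \<in> pts" "0 < p u" "0 < p v"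
  shows "v \<in> insert u {w. {u, w} \<in> edges T}"
proof -
  obtain e where e: "e \<in> cells T" "p \<in> cell_points e" using assms by (auto simp: tree_points_def)
  have "u \<in> e" "v \<in> e" using e assms by (auto simp: cell_points_def)
  then show ?thesis using e(1) by (auto elim!: cell_cases simp: insert_commute)
qed

text \<open>Within distance 1/4 of \<open>p\<close> the coordinate at \<open>v\<close> stays
  positive. The translate of \<open>q\<close> is then positive at \<open>v\<close> and, by
  equivariance, at \<open>f v\<close>, and two such vertices share a cell.\<close>

lemma nearby_translates:
  assumes f: "f \<in> tree_Aut_set T" and p: "p \<in> pts" and q: "q \<in> pts" and v: "v \<in> verts T" "1/2 \<le> p v"
    and near: "d p q < 1/4" "d p (realize T f q) < 1/4"
  shows "f v \<in> insert v {w. {v, w} \<in> edges T}"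
proof -
  have "\<bar>p v - q v\<bar> \<le> d p q" "\<bar>p v - realize T f q v\<bar> \<le> d p (realize T f q)"
    by (intro value_le_d p q realize_pts[OF f q])+
  then have "0 < q v" "0 < realize T f q v" using v near by linarith+
  moreover have "realize T f q (f v) = q v" by (rule realize_apply[OF f v(1)])
  ultimately show ?thesis using positive_coords_adjacent[OF realize_pts[OF f q], of v "f v"] by simp
qed

lemma point_in_edge_cell:
  assumes "p \<in> pts" shows "\<exists>e\<in>edges T. p \<in> cell_points e"
proof -
  obtain e where e: "e \<in> cells T" "p \<in> cell_points e" using assms by (auto simp: tree_points_def)
  show ?thesis
    using e(1)
  proof (cases rule: cell_cases)
    case (vertex u)
    then obtain v where "{u, v} \<in> edges T" using ex_edge by blast
    then show ?thesis
      using e vertex vertex_point_in_cell[OF edge_in_cells] by (auto simp: cell_points_singleton)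
  qed (use e in auto)
qed

end

lemma regular_tree_metric_graph:
  assumes "regular_tree d T" "0 < d"
  shows "metric_graph T"
proof -
  interpret locally_finite_graph T by (rule regular_tree_locally_finite[OF assms(1)])
  show ?thesis
  proof
    show "\<exists>u v. u \<noteq> v \<and> e = {u, v} \<and> u \<in> verts T \<and> v \<in> verts T" if "e \<in> edges T" for e
      using assms(1) that unfolding regular_tree_def simple_ugraph_def by blast
    show "\<exists>v. {u, v} \<in> edges T" if "u \<in> verts T" for u
    proof -
      have "card {w. {u, w} \<in> edges T} = d" using assms(1) that by (simp add: regular_tree_def)
      then have "{w. {u, w} \<in> edges T} \<noteq> {}" using assms(2) by (metis card.empty less_irrefl)
      then show ?thesis by blast
    qed
    show "verts T \<noteq> {}" using assms(1) by (simp add: regular_tree_def)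
  qed
qed

subsection \<open>Lines\<close>

text \<open>\<open>gate\<close> is the index of the nearest vertex of the line. Axiom
  \<open>gate_edge\<close>, by which it changes only along edges of the line, stands in for
  uniqueness of geodesics.\<close>

locale tree_line = metric_graph T for T :: "'v ugraph" +
  fixes L :: "int \<Rightarrow> 'v" and gate :: "'v \<Rightarrow> int"
  assumes L_edge: "{L n, L (n + 1)} \<in> edges T"
    and gate_L [simp]: "gate (L n) = n"
    and gate_edge: "{u, v} \<in> edges T \<Longrightarrow>
      gate u = gate v \<or> (u = L (gate u) \<and> v = L (gate v) \<and> \<bar>gate u - gate v\<bar> = 1)"
begin

text \<open>Nearest-point projection onto the line, as a real parameter.\<close>

definition coord :: "('v \<Rightarrow> real) \<Rightarrow> real" where
  "coord = affine_ext (\<lambda>v. of_int (gate v))"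

text \<open>The hat functions centred at the integers, evaluated at \<open>t\<close>, are the
  barycentric coordinates of the point at parameter \<open>t\<close>.\<close>

definition line_point :: "real \<Rightarrow> 'v \<Rightarrow> real" where
  "line_point t = (\<lambda>v. if v \<in> range L then max 0 (1 - \<bar>t - of_int (gate v)\<bar>) else 0)"

lemma L_verts: "L n \<in> verts T"
  using edge_verts[OF L_edge] .

lemma L_eq_iff [simp]: "L m = L n \<longleftrightarrow> m = n"
  by (metis gate_L)

lemma lipschitz_gate: "lipschitz (\<lambda>v. of_int (gate v))"
  unfolding lipschitz_def
proof (intro allI impI)
  fix u v assume "{u, v} \<in> edges T"
  then have "\<bar>gate u - gate v\<bar> \<le> 1" using gate_edge by fastforce
  then show "\<bar>of_int (gate u) - of_int (gate v)\<bar> \<le> (1::real)" by linarith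
qed

lemma coord_le_d: "p \<in> pts \<Longrightarrow> q \<in> pts \<Longrightarrow> \<bar>coord p - coord q\<bar> \<le> d p q"
  unfolding coord_def by (rule affine_ext_le_d[OF lipschitz_gate])

lemma line_point_L: "line_point t (L n) = max 0 (1 - \<bar>t - of_int n\<bar>)"
  by (simp add: line_point_def)

lemma line_point_cell:
  assumes "of_int n \<le> t" "t \<le> of_int n + 1"
  shows "line_point t \<in> cell_points {L n, L (n + 1)}"
proof -
  have "L n \<noteq> L (n + 1)" by simp
  moreover have "line_point t v = 0" if v: "v \<noteq> L n" "v \<noteq> L (n + 1)" for v
  proof (cases "v \<in> range L")
    case True
    then obtain m where m: "v = L m" "m \<noteq> n" "m \<noteq> n + 1" using v by auto
    then have "m \<le> n - 1 \<or> n + 2 \<le> m" by linarith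
    then have "real_of_int m \<le> of_int n - 1 \<or> of_int n + 2 \<le> real_of_int m" by linarith
    then show ?thesis using assms m by (auto simp: line_point_L)
  qed (simp add: line_point_def)
  ultimately show ?thesis
    using assms by (simp add: cell_points_edge line_point_L)
qed

lemma line_point_pts: "line_point t \<in> pts"
  by (rule ptsI[OF line_point_cell[of "\<lfloor>t\<rfloor>"] edge_in_cells[OF L_edge]]) linarith+

lemma coord_line_point [simp]: "coord (line_point t) = t"
proof -
  have t: "of_int \<lfloor>t\<rfloor> \<le> t" "t \<le> of_int \<lfloor>t\<rfloor> + 1" by linarith+
  have "coord (line_point t) = of_int \<lfloor>t\<rfloor> + line_point t (L (\<lfloor>t\<rfloor> + 1)) * (of_int (\<lfloor>t\<rfloor> + 1) - of_int \<lfloor>t\<rfloor>)"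
    unfolding coord_def using affine_ext_edge[OF L_edge _ line_point_cell[OF t]] by simp
  then show ?thesis using t by (simp add: line_point_L)
qed

lemma line_point_int: "line_point (of_int n) = vertex_point (L n)"
proof
  fix v
  show "line_point (of_int n) v = vertex_point (L n) v"
  proof (cases "v \<in> range L")
    case True
    then obtain m where m: "v = L m" by auto
    have "m \<noteq> n \<Longrightarrow> 1 \<le> \<bar>real_of_int n - of_int m\<bar>" by linarith
    then show ?thesis using m by (auto simp: line_point_L vertex_point_def max_def)
  qed (auto simp: line_point_def vertex_point_def)
qed

lemma d_line_point_cell:
  assumes "of_int n \<le> s" "s \<le> of_int n + 1" "of_int n \<le> t" "t \<le> of_int n + 1"
  shows "d (line_point s) (line_point t) \<le> \<bar>s - t\<bar>"
proof -
  have "d (line_point s) (line_point t) \<le> cell_dist {L n, L (n + 1)} (line_point s) (line_point t)"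
    using assms by (intro d_le_cell_dist line_point_cell edge_in_cells L_edge)
  also have "\<dots> = \<bar>line_point s (L n) - line_point t (L n)\<bar>"
    using assms by (intro cell_dist_edge line_point_cell) auto
  also have "\<dots> = \<bar>s - t\<bar>" using assms by (simp add: line_point_L)
  finally show ?thesis .
qed

text \<open>Induction on the number of integers passed; the segment is cut at the first integer
  after \<open>s\<close>.\<close>

lemma d_line_point_le: "s \<le> t \<Longrightarrow> d (line_point s) (line_point t) \<le> t - s"
proof (induction "nat (\<lfloor>t\<rfloor> - \<lfloor>s\<rfloor>)" arbitrary: s)
  case 0
  then have "\<lfloor>t\<rfloor> = \<lfloor>s\<rfloor>" using floor_mono[of s t] by linarith
  then show ?case using d_line_point_cell[of "\<lfloor>s\<rfloor>" s t] 0 by linarith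
next
  case (Suc k)
  define r :: real where "r = of_int (\<lfloor>s\<rfloor> + 1)"
  have fl: "\<lfloor>s\<rfloor> + 1 \<le> \<lfloor>t\<rfloor>" "\<lfloor>r\<rfloor> = \<lfloor>s\<rfloor> + 1" using Suc(2) by (auto simp: r_def)
  then have r: "s \<le> r" "r \<le> t" unfolding r_def by linarith+
  have "d (line_point r) (line_point t) \<le> t - r"
    by (rule Suc(1)) (use Suc(2) fl r in linarith)+
  moreover have "d (line_point s) (line_point r) \<le> \<bar>s - r\<bar>"
    by (rule d_line_point_cell[of "\<lfloor>s\<rfloor>"]) (unfold r_def, linarith+)
  ultimately show ?case
    using d_triangle[OF line_point_pts line_point_pts line_point_pts, of s t r] r by linarith
qed

text \<open>The 1-Lipschitz projection \<open>coord\<close> shows that no string is shorter than the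
  one along the line.\<close>

lemma d_line_point: "d (line_point s) (line_point t) = \<bar>s - t\<bar>"
proof (rule antisym)
  show "d (line_point s) (line_point t) \<le> \<bar>s - t\<bar>"
    using d_line_point_le[of s t] d_line_point_le[of t s] d_commute[of "line_point s" "line_point t"]
    by (cases "s \<le> t") auto
  show "\<bar>s - t\<bar> \<le> d (line_point s) (line_point t)"
    using coord_le_d[OF line_point_pts line_point_pts] by simp
qed

lemma vertex_on_line: "vertex_point v \<in> range line_point \<longleftrightarrow> v \<in> range L"
proof
  assume "vertex_point v \<in> range line_point"
  then obtain t where "vertex_point v = line_point t" by auto
  then have "line_point t v \<noteq> 0" by (metis vertex_point_def zero_neq_one)
  then show "v \<in> range L" by (auto simp: line_point_def split: if_splits)
qed (auto simp: line_point_int[symmetric])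

lemma pts_on_line:
  assumes p: "p \<in> cell_points e" and e: "e \<in> cells T" "e \<subseteq> range L"
  shows "p = line_point (coord p)"
  using e(1)
proof (cases rule: cell_cases)
  case (vertex u)
  then obtain n where "u = L n" "p = line_point (of_int n)"
    using p e by (auto simp: cell_points_singleton line_point_int)
  then show ?thesis by simp
next
  case (edge u v)
  have key: "p = line_point (coord p)" if "{L n, L (n + 1)} = e" for n
  proof -
    have pc: "p \<in> cell_points {L n, L (n + 1)}" using p that by simp
    have pe: "0 \<le> p (L n)" "0 \<le> p (L (n + 1))" "p (L n) + p (L (n + 1)) = 1"
      "\<And>w. w \<noteq> L n \<Longrightarrow> w \<noteq> L (n + 1) \<Longrightarrow> p w = 0"
      using pc by (auto simp: cell_points_edge)
    define t where "t = of_int n + p (L (n + 1))"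
    have t: "of_int n \<le> t" "t \<le> of_int n + 1" using pe by (auto simp: t_def)
    have tc: "line_point t \<in> cell_points {L n, L (n + 1)}" by (rule line_point_cell[OF t])
    have "p w = line_point t w" for w
    proof -
      have "line_point t (L n) = 1 - p (L (n + 1))" "line_point t (L (n + 1)) = p (L (n + 1))"
        using t by (auto simp: line_point_L t_def)
      then show ?thesis
        using pe tc by (cases "w = L n"; cases "w = L (n + 1)") (auto simp: cell_points_edge)
    qed
    then have "p = line_point t" by blast
    then show ?thesis by simp
  qed
  obtain m n where mn: "u = L m" "v = L n" using edge e by auto
  then have "\<bar>m - n\<bar> = 1" using gate_edge[OF edge(5)] edge(3) by auto
  then have "n = m + 1 \<or> m = n + 1" by linarith
  then show ?thesis using key[of m] key[of n] edge mn by (auto simp: insert_commute)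
qed

text \<open>An edge not contained in the line has constant \<open>gate\<close>, and interpolating a
  constant returns it.\<close>

lemma coord_off_line:
  assumes p: "p \<in> cell_points e" and e: "e \<in> cells T" "\<not> e \<subseteq> range L"
  shows "\<exists>n. \<forall>v\<in>e. gate v = n" and "v \<in> e \<Longrightarrow> coord p = of_int (gate v)"
proof -
  show "\<exists>n. \<forall>v\<in>e. gate v = n"
    using e(1)
  proof (cases rule: cell_cases)
    case (edge u v)
    then have "gate u = gate v" using gate_edge[OF edge(5)] e(2) by auto
    then show ?thesis using edge by auto
  qed auto
  then obtain n where n: "\<And>v. v \<in> e \<Longrightarrow> gate v = n" by blast
  have "coord p = (\<Sum>v\<in>e. p v * of_int n)"
    unfolding coord_def affine_ext_cell[OF e(1) p] by (intro sum.cong) (auto simp: n)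
  then have "coord p = of_int n"
    using p by (simp add: sum_distrib_right[symmetric] cell_points_def)
  then show "v \<in> e \<Longrightarrow> coord p = of_int (gate v)" using n by simp
qed

text \<open>A string from a point off the line can enter the line only at the vertex with index \<open>coord x\<close>.\<close>

lemma string_enters_line:
  assumes "string_length T x r l" and "x \<notin> range line_point" "x \<in> pts"
  shows "(r \<notin> range line_point \<and> coord r = coord x) \<or>
     d x (line_point (coord x)) + d (line_point (coord x)) r \<le> l"
  using assms
proof (induction rule: string_length.induct)
  case (step p q l e r)
  have pts: "q \<in> pts" "r \<in> pts" using step.hyps ptsI by auto
  from step.IH[OF step.prems] show ?case
  proof (elim disjE)
    assume q: "q \<notin> range line_point \<and> coord q = coord p"
    have e: "\<not> e \<subseteq> range L" using pts_on_line[OF step.hyps(3,2)] q by blast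
    obtain v where v: "v \<in> e" using cell_nonempty[OF step.hyps(2)] by blast
    have c: "coord r = coord p"
      using coord_off_line(2)[OF step.hyps(3,2) e v] coord_off_line(2)[OF step.hyps(4,2) e v] q by simp
    show ?case
    proof (cases "r \<in> range line_point")
      case True
      then have r: "r = line_point (coord p)" using c by auto
      have "d p r \<le> l + cell_dist e q r"
        using d_le_string[OF string_length.step[OF step.hyps]] .
      then show ?thesis using r d_self[OF pts(2)] by simp
    qed (use c in simp)
  next
    assume "d p (line_point (coord p)) + d (line_point (coord p)) q \<le> l"
    moreover have "d (line_point (coord p)) r \<le> d (line_point (coord p)) q + d q r"
      using pts by (intro d_triangle line_point_pts)
    moreover have "d q r \<le> cell_dist e q r" by (rule d_le_cell_dist[OF step.hyps(2-4)])
    ultimately show ?case by linarith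
  qed
qed auto

text \<open>Every string from \<open>x\<close> to the line passes through the projection of
  \<open>x\<close>, so its length splits there.\<close>

lemma d_via_gate:
  assumes "x \<in> pts"
  shows "d x (line_point (coord x)) + \<bar>coord x - t\<bar> \<le> d x (line_point t)"
proof (cases "x \<in> range line_point")
  case True
  then obtain s where "x = line_point s" by auto
  then show ?thesis by (simp add: d_line_point)
next
  case False
  show ?thesis
  proof (rule le_dI[OF assms line_point_pts])
    fix l assume "string_length T x (line_point t) l"
    from string_enters_line[OF this False assms]
    show "d x (line_point (coord x)) + \<bar>coord x - t\<bar> \<le> l" by (simp add: d_line_point)
  qed
qed

text \<open>Along a path from \<open>L 0\<close>: at a vertex off the line \<open>gate\<close> is
  constant across the edge, and the same holds for the image because \<open>f\<close> maps no
  outside vertex into the line.\<close>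

lemma gate_shift:
  assumes f: "f \<in> tree_Aut_set T" and fL: "\<And>n. f (L n) = L (n + \<tau>)" and v: "v \<in> verts T"
  shows "gate (f v) = gate v + \<tau>"
  using connected[OF L_verts[of 0] v]
proof (induction rule: rtrancl_induct)
  case base
  show ?case by (simp add: fL)
next
  case (step y z)
  have e: "{y, z} \<in> edges T" using step by simp
  have yz: "y \<in> verts T" "z \<in> verts T" using e edge_verts by (metis insert_commute)+
  show ?case
  proof (cases "z \<in> range L")
    case True
    then show ?thesis by (auto simp: fL)
  next
    case False
    have "f z \<notin> range L"
    proof
      assume "f z \<in> range L"
      then obtain n where "f z = L n" by auto
      then have "f z = f (L (n - \<tau>))" by (simp add: fL)
      then have "z = L (n - \<tau>)" using tree_Aut_inj[OF f] yz L_verts by (auto dest: inj_onD)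
      then show False using False by auto
    qed
    moreover have "{f y, f z} \<in> edges T" using tree_Aut_edge[OF f yz] e by simp
    ultimately have "gate (f y) = gate (f z)" using gate_edge by blast
    moreover have "gate y = gate z" using gate_edge[OF e] False by blast
    ultimately show ?thesis using step.IH by simp
  qed
qed

lemma coord_shift:
  assumes f: "f \<in> tree_Aut_set T" and fL: "\<And>n. f (L n) = L (n + \<tau>)" and p: "p \<in> pts"
  shows "coord (realize T f p) = coord p + of_int \<tau>"
  unfolding coord_def by (rule affine_ext_realize[OF f p]) (simp add: gate_shift[OF f fL])

lemma realize_line_point:
  assumes f: "f \<in> tree_Aut_set T" and fL: "\<And>n. f (L n) = L (n + \<tau>)"
  shows "realize T f (line_point t) = line_point (t + of_int \<tau>)"
proof (rule realize_eqI[OF f])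
  fix v assume v: "v \<in> verts T"
  have "f v \<in> range L \<longleftrightarrow> v \<in> range L"
  proof
    assume "f v \<in> range L"
    then obtain n where "f v = L n" by auto
    then have "f v = f (L (n - \<tau>))" by (simp add: fL)
    then have "v = L (n - \<tau>)" using tree_Aut_inj[OF f] v L_verts by (auto dest: inj_onD)
    then show "v \<in> range L" by auto
  qed (auto simp: fL)
  then show "line_point (t + of_int \<tau>) (f v) = line_point t v"
    by (simp add: line_point_def gate_shift[OF f fL v])
qed (use L_verts in \<open>auto simp: line_point_def\<close>)

end

section \<open>Planes in a product of two trees\<close>

locale tree_plane = A: tree_line T1 L1 gate1 + B: tree_line T2 L2 gate2
  for T1 :: "'u ugraph" and L1 gate1 and T2 :: "'v ugraph" and L2 gate2
begin

abbreviation "X \<equiv> prod_points T1 T2"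
abbreviation "D \<equiv> prod_tree_dist T1 T2"

definition plane_point :: "real \<times> real \<Rightarrow> ('u \<Rightarrow> real) \<times> ('v \<Rightarrow> real)" where
  "plane_point = map_prod A.line_point B.line_point"

abbreviation "plane \<equiv> range plane_point"

lemma D_eq: "D p q = sqrt ((A.d (fst p) (fst q))\<^sup>2 + (B.d (snd p) (snd q))\<^sup>2)"
  by (simp add: prod_dist_def case_prod_unfold)

lemma D_ge1: "p \<in> X \<Longrightarrow> q \<in> X \<Longrightarrow> A.d (fst p) (fst q) \<le> D p q"
  and D_ge2: "p \<in> X \<Longrightarrow> q \<in> X \<Longrightarrow> B.d (snd p) (snd q) \<le> D p q"
  unfolding D_eq by (auto intro!: real_le_rsqrt)

lemma metric: "Metric_space X D"
proof
  show "0 \<le> D p q" for p q by (simp add: D_eq)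
  show "D p q = D q p" for p q
    using A.d_commute[of "fst p" "fst q"] B.d_commute[of "snd p" "snd q"] by (simp add: D_eq)
  show "D p q = 0 \<longleftrightarrow> p = q" if "p \<in> X" "q \<in> X" for p q
    using that A.d_eq_0_iff[of "fst p" "fst q"] B.d_eq_0_iff[of "snd p" "snd q"]
    by (auto simp: D_eq sum_power2_eq_zero_iff prod_eq_iff)
  fix p q r assume pqr: "p \<in> X" "q \<in> X" "r \<in> X"
  have "D p r \<le> sqrt ((A.d (fst p) (fst q) + A.d (fst q) (fst r))\<^sup>2 + (B.d (snd p) (snd q) + B.d (snd q) (snd r))\<^sup>2)"
    unfolding D_eq using pqr
    by (intro real_sqrt_le_mono add_mono power_mono A.d_triangle B.d_triangle A.d_nonneg B.d_nonneg) auto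
  also have "\<dots> \<le> D p q + D q r"
    unfolding D_eq by (rule real_sqrt_sum_squares_triangle_ineq)
  finally show "D p r \<le> D p q + D q r" .
qed

sublocale M: Metric_space X D
  by (rule metric)

lemma plane_point_X: "plane_point z \<in> X"
  using A.line_point_pts B.line_point_pts by (cases z) (simp add: plane_point_def)

lemma D_plane_point: "D (plane_point p) (plane_point q) = dist p q"
  by (cases p; cases q)
    (simp add: D_eq plane_point_def A.d_line_point B.d_line_point dist_Pair_Pair dist_real_def)

definition axis1 :: "real \<Rightarrow> ('u \<Rightarrow> real) \<times> ('v \<Rightarrow> real)" where
  "axis1 t = plane_point (t, 0)"

definition axis2 :: "real \<Rightarrow> ('u \<Rightarrow> real) \<times> ('v \<Rightarrow> real)" where
  "axis2 t = plane_point (0, t)"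

lemma geodesic_axes: "geodesic_line X D axis1" "geodesic_line X D axis2"
proof -
  have "range axis1 \<subseteq> X" "range axis2 \<subseteq> X"
    unfolding axis1_def axis2_def using plane_point_X by blast+
  then show "geodesic_line X D axis1" "geodesic_line X D axis2"
    by (auto simp: geodesic_line_def axis1_def axis2_def D_plane_point dist_Pair_Pair dist_real_def)
qed

text \<open>The first coordinate alone keeps \<open>axis1 t\<close> at distance at least
  \<open>t\<close> from the whole second axis.\<close>

lemma axes_not_parallel: "\<not> parallel_lines D axis1 axis2"
proof
  assume "parallel_lines D axis1 axis2"
  then obtain K where K: "(\<forall>t. D (axis1 t) (axis2 t) \<le> K) \<or> (\<forall>t. D (axis1 t) (axis2 (- t)) \<le> K)"
    by (auto simp: parallel_lines_def)
  have ge: "t \<le> D (axis1 t) (axis2 s)" for s t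
    unfolding axis1_def axis2_def D_plane_point dist_Pair_Pair
    by (rule real_le_rsqrt) (simp add: dist_real_def)
  have "K + 1 \<le> D (axis1 (K + 1)) (axis2 (K + 1))" "K + 1 \<le> D (axis1 (K + 1)) (axis2 (- (K + 1)))"
    by (rule ge)+
  moreover have "D (axis1 (K + 1)) (axis2 (K + 1)) \<le> K \<or> D (axis1 (K + 1)) (axis2 (- (K + 1))) \<le> K"
    using K by blast
  ultimately show False by linarith
qed

lemma flat_plane: "flat_plane X D plane"
  unfolding flat_plane_def using plane_point_X D_plane_point by blast

definition proj :: "('u \<Rightarrow> real) \<times> ('v \<Rightarrow> real) \<Rightarrow> real \<times> real" where
  "proj = map_prod A.coord B.coord"

text \<open>Off the plane, the projection moves the point in at least one factor, and
  \<open>d_via_gate\<close> adds this positive displacement to the distance in that factor.\<close>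

lemma dist_proj_less:
  assumes p: "p \<in> X" "p \<notin> plane"
  shows "dist (proj p) z < D p (plane_point z)"
proof -
  obtain x y a b where xy: "p = (x, y)" "z = (a, b)" "x \<in> A.pts" "y \<in> B.pts"
    using p by (cases p; cases z) auto
  define d1 d2 where "d1 = A.d x (A.line_point (A.coord x))" and "d2 = B.d y (B.line_point (B.coord y))"
  have nn: "0 \<le> d1" "0 \<le> d2"
    using xy A.d_nonneg A.line_point_pts B.d_nonneg B.line_point_pts by (auto simp: d1_def d2_def)
  have "d1 \<noteq> 0 \<or> d2 \<noteq> 0"
  proof (rule ccontr)
    assume "\<not> ?thesis"
    then have "x = A.line_point (A.coord x)" "y = B.line_point (B.coord y)"
      using xy A.d_eq_0_iff A.line_point_pts B.d_eq_0_iff B.line_point_pts by (auto simp: d1_def d2_def)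
    then have "p = plane_point (proj p)" using xy by (simp add: plane_point_def proj_def)
    then show False using p(2) by blast
  qed
  moreover define a' b' where "a' = \<bar>A.coord x - a\<bar>" and "b' = \<bar>B.coord y - b\<bar>"
  have nn': "0 \<le> a'" "0 \<le> b'" by (auto simp: a'_def b'_def)
  have "a'\<^sup>2 \<le> (d1 + a')\<^sup>2" "b'\<^sup>2 \<le> (d2 + b')\<^sup>2"
    using nn nn' by (auto intro!: power_mono)
  moreover have "d1 \<noteq> 0 \<Longrightarrow> a'\<^sup>2 < (d1 + a')\<^sup>2" "d2 \<noteq> 0 \<Longrightarrow> b'\<^sup>2 < (d2 + b')\<^sup>2"
    using nn nn' by (auto intro!: power_strict_mono)
  ultimately have "a'\<^sup>2 + b'\<^sup>2 < (d1 + a')\<^sup>2 + (d2 + b')\<^sup>2" by fastforce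
  also have "\<dots> \<le> (A.d x (A.line_point a))\<^sup>2 + (B.d y (B.line_point b))\<^sup>2"
    using A.d_via_gate[OF xy(3), of a] B.d_via_gate[OF xy(4), of b] nn nn'
    by (intro add_mono power_mono) (auto simp: d1_def d2_def a'_def b'_def)
  finally show ?thesis
    by (simp add: D_eq xy proj_def plane_point_def dist_Pair_Pair dist_real_def a'_def b'_def)
qed

text \<open>If a geodesic between plane points left the plane, projecting an outside point would
  strictly shorten the way through it.\<close>

lemma plane_convex: "geodesically_convex X D plane"
  unfolding geodesically_convex_def
proof (intro conjI allI impI)
  show "plane \<subseteq> X" using plane_point_X by blast
  fix l :: real and c
  assume l: "0 \<le> l" and c: "c ` {0..l} \<subseteq> X \<and> (\<forall>s\<in>{0..l}. \<forall>t\<in>{0..l}. D (c s) (c t) = \<bar>s - t\<bar>) \<and> c 0 \<in> plane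
      \<and> c l \<in> plane"
  obtain z w where zw: "c 0 = plane_point z" "c l = plane_point w" using c by blast
  show "c ` {0..l} \<subseteq> plane"
  proof (rule ccontr)
    assume "\<not> ?thesis"
    then obtain s where s: "s \<in> {0..l}" "c s \<notin> plane" by blast
    have sX: "c s \<in> X" using c s by blast
    have "dist (proj (c s)) z < D (c s) (c 0)" "dist (proj (c s)) w < D (c s) (c l)"
      using dist_proj_less[OF sX s(2)] zw by auto
    moreover have "D (c s) (c 0) = s" "D (c s) (c l) = l - s" "D (c 0) (c l) = l"
      using c s(1) l by auto
    moreover have "D (c 0) (c l) \<le> dist (proj (c s)) z + dist (proj (c s)) w"
      using zw D_plane_point dist_triangle3[of z w "proj (c s)"] by simp
    ultimately show False by linarith
  qed
qed

lemma plane_hull: "plane = geodesically_convex X D hull (range axis1 \<union> range axis2)"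
proof (rule hull_unique[symmetric])
  show "range axis1 \<union> range axis2 \<subseteq> plane" by (auto simp: axis1_def axis2_def)
  show "geodesically_convex X D plane" by (rule plane_convex)
  fix C assume C: "range axis1 \<union> range axis2 \<subseteq> C" "geodesically_convex X D C"
  show "plane \<subseteq> C"
  proof
    fix p assume "p \<in> plane"
    then obtain a b where p: "p = plane_point (a, b)" by auto
    \<comment> \<open>The point \<open>(a, b)\<close> is the midpoint of the segment from
      \<open>(2 * a, 0)\<close> to \<open>(0, 2 * b)\<close>, whose ends lie on the axes. Its length
      \<open>l\<close> vanishes only at the origin.\<close>
    define l where "l = sqrt ((2 * a)\<^sup>2 + (2 * b)\<^sup>2)"
    show "p \<in> C"
    proof (cases "l = 0")
      case True
      then have "(2 * a)\<^sup>2 + (2 * b)\<^sup>2 = 0" unfolding l_def by simp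
      then have "2 * a = 0" "2 * b = 0" unfolding sum_power2_eq_zero_iff by auto
      then have "a = 0" "b = 0" by auto
      then have "p = axis1 0" using p by (simp add: axis1_def)
      then show ?thesis using C by auto
    next
      case False
      then have l: "0 < l" by (simp add: l_def order_less_le)
      define c where "c s = plane_point (2 * a * (1 - s / l), 2 * b * (s / l))" for s
      have "D (c s) (c t) = \<bar>s - t\<bar>" for s t
      proof -
        have e: "2 * a * (1 - s / l) - 2 * a * (1 - t / l) = - (2 * a) * ((s - t) / l)"
          "2 * b * (s / l) - 2 * b * (t / l) = (2 * b) * ((s - t) / l)"
          by (simp_all add: algebra_simps diff_divide_distrib)
        have "D (c s) (c t) = sqrt (((2 * a)\<^sup>2 + (2 * b)\<^sup>2) * ((s - t) / l)\<^sup>2)"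
          unfolding c_def D_plane_point dist_Pair_Pair dist_real_def power2_abs e
          unfolding power_mult_distrib power2_minus distrib_right ..
        also have "\<dots> = l * \<bar>(s - t) / l\<bar>" by (simp add: l_def real_sqrt_mult)
        also have "\<dots> = \<bar>s - t\<bar>" using l by (simp add: abs_divide)
        finally show ?thesis .
      qed
      moreover have "c 0 \<in> C" "c l \<in> C" using C(1) l by (auto simp: c_def axis1_def axis2_def)
      moreover have "c ` {0..l} \<subseteq> X" unfolding c_def using plane_point_X by blast
      ultimately have "c ` {0..l} \<subseteq> C"
        using C(2) l unfolding geodesically_convex_def by (meson less_imp_le)
      moreover have "p = c (l / 2)" using l p by (simp add: c_def)
      ultimately show ?thesis using l by auto
    qed
  qed
qed

text \<open>Compact sets are bounded, and the isometric plane has finitely many integer points in a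
  bounded set.\<close>

lemma finite_plane_vertices:
  assumes "compactin M.mtopology K"
  shows "finite {(m, n). plane_point (of_int m, of_int n) \<in> K}"
proof -
  obtain c r where K: "K \<subseteq> M.mcball c r"
    using M.compactin_imp_mbounded[OF assms] unfolding M.mbounded_def by blast
  show ?thesis
  proof (cases "\<exists>z. plane_point z \<in> K")
    case True
    then obtain z0 where z0: "plane_point z0 \<in> K" by blast
    define R where "R = 2 * r"
    have bound: "dist z z0 \<le> R" if "plane_point z \<in> K" for z
    proof -
      have z: "D c (plane_point z) \<le> r" "D c (plane_point z0) \<le> r" "c \<in> X"
        using subsetD[OF K that] subsetD[OF K z0] unfolding M.in_mcball by blast+
      have "D (plane_point z) (plane_point z0) \<le> D (plane_point z) c + D c (plane_point z0)"
        by (intro M.triangle plane_point_X z)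
      then show ?thesis
        using z M.commute[of "plane_point z" c] by (simp add: D_plane_point R_def)
    qed
    have "{(m, n). plane_point (of_int m, of_int n) \<in> K} \<subseteq>
      {\<lfloor>fst z0 - R\<rfloor>..\<lceil>fst z0 + R\<rceil>} \<times> {\<lfloor>snd z0 - R\<rfloor>..\<lceil>snd z0 + R\<rceil>}"
    proof clarify
      fix m n assume "plane_point (real_of_int m, real_of_int n) \<in> K"
      then have "dist (real_of_int m, real_of_int n) z0 \<le> R" by (rule bound)
      then have "\<bar>real_of_int m - fst z0\<bar> \<le> R" "\<bar>real_of_int n - snd z0\<bar> \<le> R"
        using dist_fst_le[of "(real_of_int m, real_of_int n)" z0] dist_snd_le[of
            "(real_of_int m, real_of_int n)" z0]
        by (auto simp: dist_real_def)
      then show "m \<in> {\<lfloor>fst z0 - R\<rfloor>..\<lceil>fst z0 + R\<rceil>} \<and> n \<in> {\<lfloor>snd z0 - R\<rfloor>..\<lceil>snd z0 + R\<rceil>}"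
        by (auto simp: floor_le_iff le_ceiling_iff)
    qed
    then show ?thesis by (rule finite_subset) auto
  qed auto
qed

text \<open>Barycentric coordinates parametrize the product cell by the unit square through a
  1-Lipschitz map, so it is a continuous image of a compact set.\<close>

lemma compactin_cell_product:
  assumes e: "e \<in> edges T1" "e' \<in> edges T2"
  shows "compactin M.mtopology (cell_points e \<times> cell_points e')"
proof -
  obtain u v where uv: "e = {u, v}" "u \<noteq> v" using A.edgeE[OF e(1)] by blast
  obtain u' v' where uv': "e' = {u', v'}" "u' \<noteq> v'" using B.edgeE[OF e(2)] by blast
  define seg :: "'u \<Rightarrow> 'u \<Rightarrow> real \<Rightarrow> 'u \<Rightarrow> real" where "seg x y s = (\<lambda>w. if w = x then 1 - s else if w
      = y then s else 0)" for x y s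
  define seg' :: "'v \<Rightarrow> 'v \<Rightarrow> real \<Rightarrow> 'v \<Rightarrow> real" where "seg' x y s = (\<lambda>w. if w = x then 1 - s else if w
      = y then s else 0)" for x y s
  let ?f = "map_prod (seg u v) (seg' u' v')"
  let ?S = "{0..1::real} \<times> {0..1::real}"
  have sc: "seg u v s \<in> cell_points e" "seg' u' v' s \<in> cell_points e'" if "s \<in> {0..1}" for s
    using that uv uv' by (auto simp: A.cell_points_edge B.cell_points_edge seg_def seg'_def)
  have img: "?f ` ?S = cell_points e \<times> cell_points e'"
  proof (intro equalityI subsetI)
    fix p assume "p \<in> cell_points e \<times> cell_points e'"
    then obtain x y where xy: "p = (x, y)" "x \<in> cell_points e" "y \<in> cell_points e'" by auto
    have "x = seg u v (x v)" "y = seg' u' v' (y v')"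
      using xy uv uv' by (auto simp: A.cell_points_edge B.cell_points_edge seg_def seg'_def fun_eq_iff)
    moreover have "x v \<in> {0..1}" "y v' \<in> {0..1}"
      using xy uv uv' by (auto simp: A.cell_points_edge B.cell_points_edge)
    ultimately show "p \<in> ?f ` ?S" using xy(1) by (intro image_eqI[of _ _ "(x v, y v')"]) auto
  qed (use sc in auto)
  have X: "?f z \<in> X" if "z \<in> ?S" for z
    using that sc A.ptsI[OF _ A.edge_in_cells[OF e(1)]] B.ptsI[OF _ B.edge_in_cells[OF e(2)]] by auto
  have lip: "D (?f z) (?f w) \<le> dist z w" if "z \<in> ?S" "w \<in> ?S" for z w
  proof -
    obtain a b a' b' where z: "z = (a, b)" "w = (a', b')" by (cases z; cases w) auto
    have s: "a \<in> {0..1}" "b \<in> {0..1}" "a' \<in> {0..1}" "b' \<in> {0..1}" using that z by auto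
    have "A.d (seg u v a) (seg u v a') \<le> cell_dist e (seg u v a) (seg u v a')"
      using s by (intro A.d_le_cell_dist A.edge_in_cells e sc)
    also have "\<dots> = \<bar>a - a'\<bar>"
      using A.cell_dist_edge[OF uv(2), of "seg u v a" "seg u v a'"] sc s uv by (auto simp: seg_def)
    finally have 1: "A.d (seg u v a) (seg u v a') \<le> \<bar>a - a'\<bar>" .
    have "B.d (seg' u' v' b) (seg' u' v' b') \<le> cell_dist e' (seg' u' v' b) (seg' u' v' b')"
      using s by (intro B.d_le_cell_dist B.edge_in_cells e sc)
    also have "\<dots> = \<bar>b - b'\<bar>"
      using B.cell_dist_edge[OF uv'(2), of "seg' u' v' b" "seg' u' v' b'"] sc s uv' by (auto simp: seg'_def)
    finally have 2: "B.d (seg' u' v' b) (seg' u' v' b') \<le> \<bar>b - b'\<bar>" .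
    have "0 \<le> A.d (seg u v a) (seg u v a')" "0 \<le> B.d (seg' u' v' b) (seg' u' v' b')"
      using X[OF that(1)] X[OF that(2)] z by (auto intro: A.d_nonneg B.d_nonneg)
    then have "(A.d (seg u v a) (seg u v a'))\<^sup>2 \<le> \<bar>a - a'\<bar>\<^sup>2"
        "(B.d (seg' u' v' b) (seg' u' v' b'))\<^sup>2 \<le> \<bar>b - b'\<bar>\<^sup>2"
      using 1 2 by (intro power_mono; simp)+
    then show ?thesis unfolding z D_eq dist_Pair_Pair dist_real_def by simp
  qed
  have "continuous_map (top_of_set ?S) M.mtopology ?f"
    unfolding M.continuous_map_to_metric
  proof (intro ballI allI impI)
    fix z and \<epsilon> :: real assume z: "z \<in> topspace (top_of_set ?S)" and \<epsilon>: "0 < \<epsilon>"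
    show "\<exists>U. openin (top_of_set ?S) U \<and> z \<in> U \<and> (\<forall>w\<in>U. ?f w \<in> M.mball (?f z) \<epsilon>)"
    proof (intro exI[of _ "?S \<inter> ball z \<epsilon>"] conjI ballI)
      show "openin (top_of_set ?S) (?S \<inter> ball z \<epsilon>)" by (rule openin_open_Int) simp
      show "z \<in> ?S \<inter> ball z \<epsilon>" using z \<epsilon> by simp
      fix w assume w: "w \<in> ?S \<inter> ball z \<epsilon>"
      have zS: "z \<in> ?S" and wS: "w \<in> ?S" and "dist z w < \<epsilon>" using z w by auto
      then show "?f w \<in> M.mball (?f z) \<epsilon>"
        using lip[OF zS wS] X[OF zS] X[OF wS] unfolding M.in_mball by auto
    qed
  qed
  moreover have "compactin (top_of_set ?S) ?S"
    by (simp add: compactin_subtopology compact_Times)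
  ultimately show ?thesis using image_compactin img by metis
qed

end

text \<open>An injective map of the integers with unit steps cannot turn back; so \<sigma> is
  multiplication by its value at 1, which is 1 or -1.\<close>

lemma int_line_reflection:
  fixes \<sigma> :: "int \<Rightarrow> int"
  assumes "inj \<sigma>" "\<And>j. \<bar>\<sigma> (j + 1) - \<sigma> j\<bar> = 1" "\<sigma> 0 = 0"
  shows "\<sigma> (\<sigma> j) = j"
proof -
  have step: "\<sigma> (j + 2) - \<sigma> (j + 1) = \<sigma> (j + 1) - \<sigma> j" for j
  proof -
    have "\<sigma> (j + 2) \<noteq> \<sigma> j" using assms(1) by (simp add: inj_eq)
    then show ?thesis
      using assms(2)[of j] assms(2)[of "j + 1"] by (auto simp: add.assoc abs_if split: if_splits)
  qed
  have const: "\<sigma> (j + 1) - \<sigma> j = \<sigma> 1" for j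
  proof (induction j rule: int_induct[where k = 0])
    case (step1 i)
    then show ?case using step[of i] by (simp add: add.assoc)
  next
    case (step2 i)
    then show ?case using step[of "i - 1"] by (simp add: algebra_simps)
  qed (simp add: assms)
  have lin: "\<sigma> j = j * \<sigma> 1" for j
  proof (induction j rule: int_induct[where k = 0])
    case (step1 i)
    then show ?case using const[of i] by (simp add: distrib_right)
  next
    case (step2 i)
    then show ?case using const[of "i - 1"] by (simp add: left_diff_distrib)
  qed (simp add: assms)
  have "\<sigma> 1 * \<sigma> 1 = 1" using assms(2)[of 0] assms(3) by (auto simp: abs_if split: if_splits)
  then show ?thesis using lin[of j] lin[of "\<sigma> j"] by (simp add: mult.assoc)
qed

section \<open>Geometric action of a simply transitive group\<close>

locale plane_action = tree_plane T1 L1 gate1 T2 L2 gate2 + group G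
  for T1 :: "'u ugraph" and L1 gate1 and T2 :: "'v ugraph" and L2 gate2 and G (structure) +
  fixes \<rho>
  assumes \<rho>_hom: "\<rho> \<in> hom G (Aut_prod T1 T2)"
    and simply_transitive: "p \<in> verts T1 \<times> verts T2 \<Longrightarrow> q \<in> verts T1 \<times> verts T2 \<Longrightarrow>
      \<exists>!g. g \<in> carrier G \<and> map_prod (fst (\<rho> g)) (snd (\<rho> g)) p = q"
begin

abbreviation "act \<equiv> \<lambda>g. realize_prod T1 T2 (\<rho> g)"
abbreviation "\<rho>1 g \<equiv> fst (\<rho> g)"
abbreviation "\<rho>2 g \<equiv> snd (\<rho> g)"

lemma \<rho>_Aut: "g \<in> carrier G \<Longrightarrow> \<rho>1 g \<in> tree_Aut_set T1" "g \<in> carrier G \<Longrightarrow> \<rho>2 g \<in> tree_Aut_set T2"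
  using hom_in_carrier[OF \<rho>_hom, of g] by (auto simp: carrier_tree_Aut mem_Times_iff)

lemma \<rho>_mult:
  assumes "g \<in> carrier G" "h \<in> carrier G"
  shows "\<rho>1 (g \<otimes> h) = compose (verts T1) (\<rho>1 g) (\<rho>1 h)" "\<rho>2 (g \<otimes> h) = compose (verts T2) (\<rho>2 g) (\<rho>2 h)"
  using hom_mult[OF \<rho>_hom assms] \<rho>_Aut[OF assms(1)] \<rho>_Aut[OF assms(2)]
  by (auto simp: mult_tree_Aut mult_DirProd' split_beta)

lemma \<rho>_one: "\<rho>1 \<one> = (\<lambda>x\<in>verts T1. x)" "\<rho>2 \<one> = (\<lambda>x\<in>verts T2. x)"
  using hom_one[OF \<rho>_hom is_group group_Aut_prod] by (auto simp: one_tree_Aut)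

lemma act_apply: "p \<in> X \<Longrightarrow> act g p = (realize T1 (\<rho>1 g) (fst p), realize T2 (\<rho>2 g) (snd p))"
  by (auto simp: realize_prod_def map_prod_def split_beta)

lemma act_X: "g \<in> carrier G \<Longrightarrow> p \<in> X \<Longrightarrow> act g p \<in> X"
  using A.realize_pts B.realize_pts \<rho>_Aut by (auto simp: act_apply)

lemma act_mult: "g \<in> carrier G \<Longrightarrow> h \<in> carrier G \<Longrightarrow> p \<in> X \<Longrightarrow> act (g \<otimes> h) p = act g (act h p)"
  using act_X[of h p] \<rho>_Aut[of g] \<rho>_Aut[of h]
  by (simp add: act_apply \<rho>_mult A.realize_compose B.realize_compose)

lemma act_one: "p \<in> X \<Longrightarrow> act \<one> p = p"
  by (auto simp: act_apply \<rho>_one A.realize_id B.realize_id)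

lemma act_inv: "g \<in> carrier G \<Longrightarrow> p \<in> X \<Longrightarrow> act (inv g) (act g p) = p"
  using act_mult[of "inv g" g p] act_one by simp

lemma act_inv': "g \<in> carrier G \<Longrightarrow> p \<in> X \<Longrightarrow> act g (act (inv g) p) = p"
  using act_mult[of g "inv g" p] act_one by simp

lemma act_bij: "g \<in> carrier G \<Longrightarrow> bij_betw (act g) X X"
  by (rule bij_betwI[where g = "act (inv g)"]) (auto simp: act_inv act_inv' intro: act_X simp del:
      mem_Times_iff)

lemma act_isometry: "g \<in> carrier G \<Longrightarrow> p \<in> X \<Longrightarrow> q \<in> X \<Longrightarrow> D (act g p) (act g q) = D p q"
  using A.realize_isometry[OF \<rho>_Aut(1)] B.realize_isometry[OF \<rho>_Aut(2)]
  by (auto simp: D_eq act_apply)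

lemma act_Bij: "g \<in> carrier G \<Longrightarrow> act g \<in> Bij X"
  using act_bij by (simp add: Bij_def realize_prod_def)

lemma group_action: "group_action G X act"
  unfolding group_action_def group_hom_def group_hom_axioms_def
proof (intro conjI)
  show "group G" by (rule is_group)
  show "group (BijGroup X)" by (rule group_BijGroup)
  show "act \<in> hom G (BijGroup X)"
  proof (rule homI)
    show "act g \<in> carrier (BijGroup X)" if "g \<in> carrier G" for g
      using act_Bij[OF that] by (simp add: BijGroup_def)
    fix g h assume gh: "g \<in> carrier G" "h \<in> carrier G"
    have "act (g \<otimes> h) = compose X (act g) (act h)"
    proof (rule extensionalityI)
      show "act (g \<otimes> h) \<in> extensional X" by (simp add: realize_prod_def)
    qed (use gh in \<open>auto simp: act_mult compose_eq\<close>)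
    then show "act (g \<otimes> h) = act g \<otimes>\<^bsub>BijGroup X\<^esub> act h"
      using act_Bij gh by (simp add: BijGroup_def)
  qed
qed

lemma finite_maps_to:
  assumes "finite B" "B \<subseteq> verts T1 \<times> verts T2" "p \<in> verts T1 \<times> verts T2"
  shows "finite {g \<in> carrier G. map_prod (\<rho>1 g) (\<rho>2 g) p \<in> B}"
proof -
  have "inj_on (\<lambda>g. map_prod (\<rho>1 g) (\<rho>2 g) p) {g \<in> carrier G. map_prod (\<rho>1 g) (\<rho>2 g) p \<in> B}"
    using simply_transitive[OF assms(3)] assms(2) by (intro inj_onI) blast
  then show ?thesis by (rule inj_on_finite[OF _ _ assms(1)]) auto
qed

text \<open>If a translate of the ball meets the ball, then in each factor a vertex with large
  coordinate is moved by at most one edge; simple transitivity leaves finitely many such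
  elements.\<close>

lemma properly_discontinuous:
  assumes p: "p \<in> X"
  shows "\<exists>r>0. finite {g \<in> carrier G. act g ` M.mball p r \<inter> M.mball p r \<noteq> {}}"
proof -
  obtain u where u: "u \<in> verts T1" "1/2 \<le> fst p u" using A.ex_big_coord p by (auto simp: mem_Times_iff)
  obtain v where v: "v \<in> verts T2" "1/2 \<le> snd p v" using B.ex_big_coord p by (auto simp: mem_Times_iff)
  let ?B = "insert u {w. {u, w} \<in> edges T1} \<times> insert v {w. {v, w} \<in> edges T2}"
  have "finite {g \<in> carrier G. map_prod (\<rho>1 g) (\<rho>2 g) (u, v) \<in> ?B}"
  proof (rule finite_maps_to)
    show "finite ?B" using A.finite_neighbours[OF u(1)] B.finite_neighbours[OF v(1)] by simp
    have "w \<in> verts T1" if "{u, w} \<in> edges T1" for w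
      using that A.edge_verts[of w u] by (simp add: insert_commute)
    moreover have "w \<in> verts T2" if "{v, w} \<in> edges T2" for w
      using that B.edge_verts[of w v] by (simp add: insert_commute)
    ultimately show "?B \<subseteq> verts T1 \<times> verts T2" using u v by auto
  qed (use u v in auto)
  moreover have "{g \<in> carrier G. act g ` M.mball p (1/4) \<inter> M.mball p (1/4) \<noteq> {}} \<subseteq>
     {g \<in> carrier G. map_prod (\<rho>1 g) (\<rho>2 g) (u, v) \<in> ?B}"
  proof (intro subsetI)
    fix g assume "g \<in> {g \<in> carrier G. act g ` M.mball p (1/4) \<inter> M.mball p (1/4) \<noteq> {}}"
    then obtain q where g: "g \<in> carrier G" and q: "q \<in> M.mball p (1/4)" "act g q \<in> M.mball p (1/4)" by blast
    have qX: "q \<in> X" using q unfolding M.in_mball by blast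
    have near: "D p q < 1/4" "D p (act g q) < 1/4" using q unfolding M.in_mball by auto
    have pq: "fst p \<in> A.pts" "snd p \<in> B.pts" "fst q \<in> A.pts" "snd q \<in> B.pts"
      using p qX by (auto simp: mem_Times_iff)
    have "\<rho>1 g u \<in> insert u {w. {u, w} \<in> edges T1}"
      using D_ge1[OF p qX] D_ge1[OF p act_X[OF g qX]] near act_apply[OF qX]
      by (intro A.nearby_translates[OF \<rho>_Aut(1)[OF g] pq(1,3) u]) auto
    moreover have "\<rho>2 g v \<in> insert v {w. {v, w} \<in> edges T2}"
      using D_ge2[OF p qX] D_ge2[OF p act_X[OF g qX]] near act_apply[OF qX]
      by (intro B.nearby_translates[OF \<rho>_Aut(2)[OF g] pq(2,4) v]) auto
    ultimately have "map_prod (\<rho>1 g) (\<rho>2 g) (u, v) \<in> ?B"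
      by (simp only: map_prod_simp mem_Times_iff fst_conv snd_conv)
    then show "g \<in> {g \<in> carrier G. map_prod (\<rho>1 g) (\<rho>2 g) (u, v) \<in> ?B}" using g by blast
  qed
  ultimately show ?thesis by (intro exI[of _ "1/4"]) (auto intro: finite_subset)
qed

text \<open>The products of edges at one fixed pair of vertices suffice: any product of edges has a
  corner, which transitivity moves to that pair.\<close>

lemma cocompact: "cocompact_on X D act (carrier G) X"
proof -
  obtain u v where uv: "u \<in> verts T1" "v \<in> verts T2" using A.nonempty B.nonempty by blast
  define E1 where "E1 = {e \<in> edges T1. u \<in> e}"
  define E2 where "E2 = {e \<in> edges T2. v \<in> e}"
  have "E1 \<subseteq> (\<lambda>w. {u, w}) ` {w. {u, w} \<in> edges T1}"
    using A.edgeE by (fastforce simp: E1_def insert_commute)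
  then have fin1: "finite E1" using A.finite_neighbours[OF uv(1)] finite_surj by blast
  have "E2 \<subseteq> (\<lambda>w. {v, w}) ` {w. {v, w} \<in> edges T2}"
    using B.edgeE by (fastforce simp: E2_def insert_commute)
  then have fin2: "finite E2" using B.finite_neighbours[OF uv(2)] finite_surj by blast
  define K where "K = (\<Union>(e, e')\<in>E1 \<times> E2. cell_points e \<times> cell_points e')"
  have comp: "compactin M.mtopology K"
    unfolding K_def
  proof (rule compactin_Union)
    show "finite ((\<lambda>(e, e'). cell_points e \<times> cell_points e') ` (E1 \<times> E2))" using fin1 fin2 by simp
  qed (auto simp: E1_def E2_def intro!: compactin_cell_product)
  have KX: "K \<subseteq> X" using compactin_subset_topspace[OF comp] by simp
  have "(\<Union>g\<in>carrier G. act g ` K) = X"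
  proof (intro equalityI subsetI)
    fix p assume p: "p \<in> X"
    obtain e where e: "e \<in> edges T1" "fst p \<in> cell_points e"
      using A.point_in_edge_cell p by (auto simp: mem_Times_iff)
    obtain e' where e': "e' \<in> edges T2" "snd p \<in> cell_points e'"
      using B.point_in_edge_cell p by (auto simp: mem_Times_iff)
    obtain x where x: "x \<in> e" "x \<in> verts T1" using A.edgeE[OF e(1)] by blast
    obtain y where y: "y \<in> e'" "y \<in> verts T2" using B.edgeE[OF e'(1)] by blast
    obtain g where g: "g \<in> carrier G" "map_prod (\<rho>1 g) (\<rho>2 g) (x, y) = (u, v)"
      using simply_transitive[of "(x, y)" "(u, v)"] x y uv by auto
    have img: "\<rho>1 g ` e \<in> E1" "\<rho>2 g ` e' \<in> E2"
    proof -
      obtain a b where ab: "e = {a, b}" "a \<in> verts T1" "b \<in> verts T1" using A.edgeE[OF e(1)] by blast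
      then have "\<rho>1 g ` e \<in> edges T1" using tree_Aut_edge[OF \<rho>_Aut(1)[OF g(1)]] e by auto
      then show "\<rho>1 g ` e \<in> E1" using g x by (auto simp: E1_def)
      obtain a b where ab: "e' = {a, b}" "a \<in> verts T2" "b \<in> verts T2" using B.edgeE[OF e'(1)] by blast
      then have "\<rho>2 g ` e' \<in> edges T2" using tree_Aut_edge[OF \<rho>_Aut(2)[OF g(1)]] e' by auto
      then show "\<rho>2 g ` e' \<in> E2" using g y by (auto simp: E2_def)
    qed
    have "act g p \<in> cell_points (\<rho>1 g ` e) \<times> cell_points (\<rho>2 g ` e')"
      using A.realize_cell_points[OF \<rho>_Aut(1)[OF g(1)] A.edge_in_cells[OF e(1)] e(2)]
        B.realize_cell_points[OF \<rho>_Aut(2)[OF g(1)] B.edge_in_cells[OF e'(1)] e'(2)]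
      by (simp add: act_apply[OF p])
    then have "act g p \<in> K"
      unfolding K_def using img by (intro UN_I[of "(\<rho>1 g ` e, \<rho>2 g ` e')"]) auto
    then have "act (inv g) (act g p) \<in> act (inv g) ` K" by (rule imageI)
    then have "p \<in> act (inv g) ` K" unfolding act_inv[OF g(1) p] .
    then show "p \<in> (\<Union>g\<in>carrier G. act g ` K)" using inv_closed[OF g(1)] by (rule UN_I[rotated])
  next
    fix p assume "p \<in> (\<Union>g\<in>carrier G. act g ` K)"
    then show "p \<in> X" using KX act_X by blast
  qed
  then show ?thesis using comp KX unfolding cocompact_on_def by blast
qed

lemma geometric: "geometric_action X D G act"
  unfolding geometric_action_def
  using metric group_action act_isometry properly_discontinuous cocompact by blast

section \<open>Translation axes and the criterion for an anti-torus\<close>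

lemma hyperbolic1:
  assumes g: "g \<in> carrier G" and L: "\<And>n. \<rho>1 g (L1 n) = L1 (n + \<tau>)" and fix2: "\<rho>2 g (L2 0)
      = L2 0" and \<tau>: "0 < \<tau>"
  shows "hyperbolic_isometry X D (act g)" "translation_axis X D (act g) axis1"
proof -
  have ax: "act g (axis1 t) = axis1 (t + of_int \<tau>)" for t
    using A.realize_line_point[OF \<rho>_Aut(1)[OF g] L, of t]
      B.realize_vertex_point[OF \<rho>_Aut(2)[OF g] B.L_verts[of 0]] fix2 B.line_point_int[of 0]
    by (simp add: axis1_def act_apply[OF plane_point_X]) (simp add: plane_point_def)
  then show "translation_axis X D (act g) axis1"
    using geodesic_axes \<tau> unfolding translation_axis_def by (intro conjI exI[of _ "of_int \<tau>"]) auto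
  \<comment> \<open>The 1-Lipschitz function \<open>coord\<close> is shifted by \<tau> everywhere,
    so no point moves less than the points of the axis.\<close>
  have min: "of_int \<tau> \<le> D q (act g q)" if q: "q \<in> X" for q
  proof -
    have q1: "fst q \<in> A.pts" using q by (simp add: mem_Times_iff)
    have "\<bar>A.coord (fst q) - A.coord (realize T1 (\<rho>1 g) (fst q))\<bar> \<le> A.d (fst q) (realize T1 (\<rho>1 g) (fst q))"
      by (intro A.coord_le_d q1 A.realize_pts \<rho>_Aut g)
    then show ?thesis
      using D_ge1[OF q act_X[OF g q]] \<tau> A.coord_shift[OF \<rho>_Aut(1)[OF g] L q1] by (simp add: act_apply[OF q])
  qed
  have "D (axis1 0) (act g (axis1 0)) = of_int \<tau>"
    using ax[of 0] \<tau> by (simp add: axis1_def D_plane_point dist_Pair_Pair dist_real_def)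
  moreover have "axis1 0 \<in> X" unfolding axis1_def by (rule plane_point_X)
  ultimately show "hyperbolic_isometry X D (act g)"
    unfolding hyperbolic_isometry_def using act_bij[OF g] act_isometry[OF g] min \<tau>
    by (intro conjI ballI bexI[of _ "axis1 0"]) auto
qed

lemma hyperbolic2:
  assumes g: "g \<in> carrier G" and L: "\<And>n. \<rho>2 g (L2 n) = L2 (n + \<tau>)" and fix1: "\<rho>1 g (L1 0)
      = L1 0" and \<tau>: "0 < \<tau>"
  shows "hyperbolic_isometry X D (act g)" "translation_axis X D (act g) axis2"
proof -
  have ax: "act g (axis2 t) = axis2 (t + of_int \<tau>)" for t
    using B.realize_line_point[OF \<rho>_Aut(2)[OF g] L, of t]
      A.realize_vertex_point[OF \<rho>_Aut(1)[OF g] A.L_verts[of 0]] fix1 A.line_point_int[of 0]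
    by (simp add: axis2_def act_apply[OF plane_point_X]) (simp add: plane_point_def)
  then show "translation_axis X D (act g) axis2"
    using geodesic_axes \<tau> unfolding translation_axis_def by (intro conjI exI[of _ "of_int \<tau>"]) auto
  have min: "of_int \<tau> \<le> D q (act g q)" if q: "q \<in> X" for q
  proof -
    have q2: "snd q \<in> B.pts" using q by (simp add: mem_Times_iff)
    have "\<bar>B.coord (snd q) - B.coord (realize T2 (\<rho>2 g) (snd q))\<bar> \<le> B.d (snd q) (realize T2 (\<rho>2 g) (snd q))"
      by (intro B.coord_le_d q2 B.realize_pts \<rho>_Aut g)
    then show ?thesis
      using D_ge2[OF q act_X[OF g q]] \<tau> B.coord_shift[OF \<rho>_Aut(2)[OF g] L q2] by (simp add: act_apply[OF q])
  qed
  have "D (axis2 0) (act g (axis2 0)) = of_int \<tau>"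
    using ax[of 0] \<tau> by (simp add: axis2_def D_plane_point dist_Pair_Pair dist_real_def)
  moreover have "axis2 0 \<in> X" unfolding axis2_def by (rule plane_point_X)
  ultimately show "hyperbolic_isometry X D (act g)"
    unfolding hyperbolic_isometry_def using act_bij[OF g] act_isometry[OF g] min \<tau>
    by (intro conjI ballI bexI[of _ "axis2 0"]) auto
qed

definition plane_vertex :: "int \<Rightarrow> int \<Rightarrow> ('u \<Rightarrow> real) \<times> ('v \<Rightarrow> real)" where
  "plane_vertex m n = plane_point (of_int m, of_int n)"

lemma plane_vertex_eq: "plane_vertex m n = (vertex_point (L1 m), vertex_point (L2 n))"
  by (simp add: plane_vertex_def plane_point_def A.line_point_int B.line_point_int)

lemma plane_vertex_in_plane: "plane_vertex m n \<in> plane"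
  unfolding plane_vertex_def by blast

lemma plane_vertex_X: "plane_vertex m n \<in> X"
  unfolding plane_vertex_def by (rule plane_point_X)

lemma act_vertex:
  assumes "g \<in> carrier G"
  shows "act g (plane_vertex m n) = (vertex_point (\<rho>1 g (L1 m)), vertex_point (\<rho>2 g (L2 n)))"
  using A.realize_vertex_point[OF \<rho>_Aut(1)[OF assms] A.L_verts] B.realize_vertex_point[OF \<rho>_Aut(2)[OF assms]
      B.L_verts]
  by (simp add: act_apply[OF plane_vertex_X]) (simp add: plane_vertex_eq)

lemma vertex_points_in_plane:
  "(vertex_point u, vertex_point v) \<in> plane \<longleftrightarrow> u \<in> range L1 \<and> v \<in> range L2"
  using A.vertex_on_line[of u] B.vertex_on_line[of v]
  by (auto simp: plane_point_def image_iff split_paired_Ex)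

text \<open>A cocompact stabilizer of the plane would contain an \<open>h\<close> moving one vertex
  of the first line to a later one while fixing the origin of the second. The square of
  \<open>h\<close> is then a positive power of \<open>g1\<close> fixing the second line pointwise,
  which \<open>aperiodic\<close> forbids. The height \<epsilon> rules out that \<open>h\<close>
  reflects the first line.\<close>

theorem span_anti_torus:
  fixes \<epsilon> :: "'u \<Rightarrow> int"
  assumes g1: "g1 \<in> carrier G" "\<And>n. \<rho>1 g1 (L1 n) = L1 (n + 1)" "\<rho>2 g1 (L2 0) = L2 0"
    and g2: "g2 \<in> carrier G" "\<And>n. \<rho>2 g2 (L2 n) = L2 (n + \<tau>)" "\<rho>1 g2 (L1 0) = L1 0" "0 < \<tau>"
    and height: "\<And>g. g \<in> carrier G \<Longrightarrow> \<exists>c. \<forall>v\<in>verts T1. \<epsilon> (\<rho>1 g v) = \<epsilon> v + c" "\<And>n. \<epsilon> (L1 n) = n"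
    and aperiodic: "\<And>N :: nat. 0 < N \<Longrightarrow> \<exists>n. \<rho>2 (g1 [^] N) (L2 n) \<noteq> L2 n"
  shows "span_anti_torus X D G act g1 g2"
proof -
  have "\<not> cocompact_on X D act {g \<in> carrier G. act g ` plane = plane} plane"
  proof
    let ?S = "{g \<in> carrier G. act g ` plane = plane}"
    assume "cocompact_on X D act ?S plane"
    then obtain K where K: "compactin M.mtopology K" "K \<subseteq> plane" "(\<Union>g\<in>?S. act g ` K) = plane"
      by (auto simp: cocompact_on_def)
    have pX: "z \<in> X" if "z \<in> plane" for z using that plane_point_X by blast
    have inv_S: "inv g \<in> ?S" if g: "g \<in> ?S" for g
    proof -
      have "act (inv g) ` plane = act (inv g) ` act g ` plane" using g by simp
      also have "\<dots> = (\<lambda>z. z) ` plane"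
        unfolding image_image using g act_inv[OF _ plane_point_X] by (intro image_cong) auto
      finally show ?thesis using g by simp
    qed
    \<comment> \<open>Vertices pull back to vertices of the plane, so the sources in
      \<open>K\<close> are indexed by integer pairs, of which the compact \<open>K\<close> contains
      finitely many.\<close>
    define Q where "Q g i j n \<longleftrightarrow> g \<in> ?S \<and> plane_vertex i j \<in> K \<and>
       act g (plane_vertex i j) = plane_vertex n 0" for g i j n
    have "\<exists>g i j. Q g i j n" for n
    proof -
      have "plane_vertex n 0 \<in> (\<Union>g\<in>?S. act g ` K)" unfolding K(3) by (rule plane_vertex_in_plane)
      then obtain g k where gk: "g \<in> ?S" "k \<in> K" "act g k = plane_vertex n 0" by (elim UN_E imageE) metis
      have kp: "k \<in> plane" using gk K(2) by blast
      then have "k = act (inv g) (plane_vertex n 0)"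
        using gk(1) gk(3)[symmetric] act_inv[OF _ pX[OF kp]] by simp
      then have k: "k = (vertex_point (\<rho>1 (inv g) (L1 n)), vertex_point (\<rho>2 (inv g) (L2 0)))"
        using act_vertex[of "inv g" n 0] inv_S[OF gk(1)] by simp
      then obtain i j where "\<rho>1 (inv g) (L1 n) = L1 i" "\<rho>2 (inv g) (L2 0) = L2 j"
        using kp vertex_points_in_plane by auto
      then have "k = plane_vertex i j" using k plane_vertex_eq by simp
      then show ?thesis using gk unfolding Q_def by blast
    qed
    then obtain g i j where "\<And>n. Q (g n) (i n) (j n) n" by metis
    then have gij: "\<And>n. g n \<in> ?S" "\<And>n. plane_vertex (i n) (j n) \<in> K"
      "\<And>n. act (g n) (plane_vertex (i n) (j n)) = plane_vertex n 0"
      unfolding Q_def by blast+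
    have "\<not> inj (\<lambda>n::nat. (i (int n), j (int n)))"
    proof
      assume inj: "inj (\<lambda>n::nat. (i (int n), j (int n)))"
      have "finite (range (\<lambda>n::nat. (i (int n), j (int n))))"
        by (rule finite_subset[OF _ finite_plane_vertices[OF K(1)]]) (use gij(2) in
            \<open>auto simp: plane_vertex_def\<close>)
      then show False using inj finite_imageD infinite_UNIV_nat by blast
    qed
    then obtain m n :: nat where "m \<noteq> n" "i (int m) = i (int n)" "j (int m) = j (int n)"
      by (auto simp: inj_def)
    then obtain m n :: nat where mn: "m < n" "i (int m) = i (int n)" "j (int m) = j (int n)"
      by (metis nat_neq_iff)
    \<comment> \<open>By the pigeonhole principle the targets \<open>m < n\<close> come from one
      source in \<open>K\<close>; \<open>h\<close> leads from the first target through that source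
      to the second.\<close>
    define h where "h = g (int n) \<otimes> inv (g (int m))"
    have h: "h \<in> carrier G" using gij(1) by (simp add: h_def)
    have hp: "act h z \<in> plane" if z: "z \<in> plane" for z
    proof -
      have "act (inv (g (int m))) z \<in> plane" using inv_S[OF gij(1)] z by blast
      then have "act (g (int n)) (act (inv (g (int m))) z) \<in> plane" using gij(1) by blast
      then show ?thesis using act_mult gij(1) pX[OF z] by (simp add: h_def)
    qed
    have "act h (plane_vertex (int m) 0) = plane_vertex (int n) 0"
    proof -
      have "act (inv (g (int m))) (plane_vertex (int m) 0) = plane_vertex (i (int m)) (j (int m))"
        using act_inv[OF _ plane_vertex_X] gij(1) gij(3)[symmetric] by simp
      then show ?thesis
        using act_mult[OF _ _ plane_vertex_X] gij(1) gij(3)[of "int n"] mn by (simp add: h_def)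
    qed
    then have h0: "\<rho>1 h (L1 (int m)) = L1 (int n)" "\<rho>2 h (L2 0) = L2 0"
      by (simp_all add: act_vertex[OF h] plane_vertex_eq[of "int n"] vertex_point_inj)
    have on_line: "\<rho>1 h (L1 a) \<in> range L1" "\<rho>2 h (L2 b) \<in> range L2" for a b
      using hp[OF plane_vertex_in_plane[of a b]] by (simp_all add: act_vertex[OF h] vertex_points_in_plane)
    define k where "k = int n - int m"
    \<comment> \<open>On the first line \<epsilon> is the index itself, so a constant shift of
      \<epsilon> makes \<open>h\<close> a translation there.\<close>
    obtain c where c: "\<And>v. v \<in> verts T1 \<Longrightarrow> \<epsilon> (\<rho>1 h v) = \<epsilon> v + c" using height(1)[OF h] by blast
    have "c = k" using c[OF A.L_verts[of "int m"]] h0(1) height(2) by (simp add: k_def)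
    have h1: "\<rho>1 h (L1 a) = L1 (a + k)" for a
    proof -
      obtain b where b: "\<rho>1 h (L1 a) = L1 b" using on_line(1)[of a] by auto
      then show ?thesis using c[OF A.L_verts[of a]] height(2) \<open>c = k\<close> by simp
    qed
    \<comment> \<open>On the second line \<open>h\<close> fixes the origin but may still reflect;
      hence the passage to its square.\<close>
    define \<sigma> where "\<sigma> b = gate2 (\<rho>2 h (L2 b))" for b
    have \<sigma>: "\<rho>2 h (L2 b) = L2 (\<sigma> b)" for b using on_line(2)[of b] by (auto simp: \<sigma>_def)
    have "\<sigma> (\<sigma> b) = b" for b
    proof (rule int_line_reflection)
      show "inj \<sigma>"
      proof (rule injI)
        fix a b assume "\<sigma> a = \<sigma> b"
        then have "\<rho>2 h (L2 a) = \<rho>2 h (L2 b)" by (simp add: \<sigma>)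
        then have "L2 a = L2 b" using tree_Aut_inj[OF \<rho>_Aut(2)[OF h]] B.L_verts by (auto dest: inj_onD)
        then show "a = b" by simp
      qed
      show "\<bar>\<sigma> (a + 1) - \<sigma> a\<bar> = 1" for a
      proof -
        have "{\<rho>2 h (L2 a), \<rho>2 h (L2 (a + 1))} \<in> edges T2"
          using tree_Aut_edge[OF \<rho>_Aut(2)[OF h] B.L_verts B.L_verts] B.L_edge by simp
        moreover have "\<sigma> a \<noteq> \<sigma> (a + 1)" using \<open>inj \<sigma>\<close> by (simp add: inj_eq)
        ultimately show ?thesis using B.gate_edge[of "L2 (\<sigma> a)" "L2 (\<sigma> (a + 1))"] by (simp add: \<sigma>)
      qed
      show "\<sigma> 0 = 0" using h0(2) \<sigma>[of 0] by simp
    qed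
    then have hh2: "\<rho>2 (h \<otimes> h) (L2 b) = L2 b" for b
      using h \<sigma> B.L_verts by (simp add: \<rho>_mult compose_eq)
    have hh1: "\<rho>1 (h \<otimes> h) (L1 0) = L1 (2 * k)"
      using h h1 A.L_verts by (simp add: \<rho>_mult compose_eq)
    have pow: "\<rho>1 (g1 [^] N) (L1 0) = L1 (int N) \<and> \<rho>2 (g1 [^] N) (L2 0) = L2 0" for N :: nat
    proof (induction N)
      case 0
      show ?case using A.L_verts B.L_verts by (simp add: \<rho>_one)
    next
      case (Suc N)
      have "g1 [^] Suc N = g1 \<otimes> g1 [^] N" using g1(1) by (rule nat_pow_Suc2)
      then show ?case using Suc g1 A.L_verts B.L_verts by (simp add: \<rho>_mult compose_eq add.commute)
    qed
    define N where "N = nat (2 * k)"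
    have N: "0 < N" "int N = 2 * k" using mn by (auto simp: N_def k_def)
    \<comment> \<open>Both sides agree on one pair of vertices, which determines a group
      element.\<close>
    have "h \<otimes> h = g1 [^] N"
      using simply_transitive[of "(L1 0, L2 0)" "(L1 (2 * k), L2 0)"] A.L_verts B.L_verts h g1(1) hh1 hh2
          pow[of N] N(2)
      by auto
    then show False using aperiodic[OF N(1)] hh2 by simp
  qed
  then show ?thesis
    unfolding span_anti_torus_def
    using geometric g1(1) g2(1) hyperbolic1[OF g1 zero_less_one] hyperbolic2[OF g2]
      axes_not_parallel flat_plane plane_hull by blast
qed



end

section \<open>Trees of reduced words\<close>

text \<open>Letters with \<open>bar l = l\<close> stand for factors of order two, pairs
  \<open>l\<close>, \<open>bar l\<close> for infinite cyclic factors; reduced words are the elements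
  of the free product. The injection \<open>emb\<close> allows a prescribed vertex type.\<close>

locale alphabet =
  fixes bar :: "'l::finite \<Rightarrow> 'l" and emb :: "'l list \<Rightarrow> 'v"
  assumes bar_bar [simp]: "bar (bar l) = l" and inj_emb: "inj emb"
begin

definition reduced :: "'l list \<Rightarrow> bool" where
  "reduced = successively (\<lambda>l m. m \<noteq> bar l)"

text \<open>Multiplication by a letter in the free product. Tree edges use \<open>rmul\<close>, so
  that left multiplication preserves them (\<open>lmul_rmul\<close>).\<close>

definition lmul :: "'l \<Rightarrow> 'l list \<Rightarrow> 'l list" where
  "lmul l w = (if w \<noteq> [] \<and> hd w = bar l then tl w else l # w)"

definition rmul :: "'l list \<Rightarrow> 'l \<Rightarrow> 'l list" where
  "rmul w l = (if w \<noteq> [] \<and> last w = bar l then butlast w else w @ [l])"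

definition word_tree :: "'v ugraph" where
  "word_tree = \<lparr>verts = emb ` Collect reduced, edges = {{emb w, emb (rmul w l)} | w l. reduced w}\<rparr>"

lemma bar_eq_iff: "bar l = bar m \<longleftrightarrow> l = m"
  by (metis bar_bar)

lemma emb_eq_iff [simp]: "emb u = emb v \<longleftrightarrow> u = v"
  using inj_emb by (simp add: inj_eq)

lemma reduced_Nil [simp]: "reduced []"
  and reduced_single [simp]: "reduced [l]"
  by (simp_all add: reduced_def)

lemma reduced_Cons: "reduced (l # w) \<longleftrightarrow> reduced w \<and> (w = [] \<or> hd w \<noteq> bar l)"
  by (cases w) (auto simp: reduced_def)

lemma reduced_snoc: "reduced (w @ [l]) \<longleftrightarrow> reduced w \<and> (w = [] \<or> last w \<noteq> bar l)"
  by (auto simp: reduced_def successively_append_iff)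

lemma reduced_butlast: "reduced w \<Longrightarrow> reduced (butlast w)"
  by (cases w rule: rev_cases) (auto simp: reduced_snoc)

lemma reduced_tl: "reduced w \<Longrightarrow> reduced (tl w)"
  by (cases w) (auto simp: reduced_Cons)

lemma reduced_lmul: "reduced w \<Longrightarrow> reduced (lmul l w)"
  by (auto simp: lmul_def reduced_Cons reduced_tl)

lemma reduced_rmul: "reduced w \<Longrightarrow> reduced (rmul w l)"
  by (auto simp: rmul_def reduced_snoc reduced_butlast)

lemma lmul_bar: "reduced w \<Longrightarrow> lmul (bar l) (lmul l w) = w"
  by (cases w) (auto simp: lmul_def reduced_Cons)

lemma rmul_bar: "reduced w \<Longrightarrow> rmul (rmul w l) (bar l) = w"
  by (cases w rule: rev_cases) (auto simp: rmul_def reduced_snoc butlast_append)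

lemma rmul_inj: "rmul w l = rmul w m \<Longrightarrow> l = m"
  by (cases w rule: rev_cases) (auto simp: rmul_def bar_eq_iff split: if_splits dest: arg_cong[of _ _
      length])

lemma lmul_rmul: "reduced w \<Longrightarrow> lmul l (rmul w m) = rmul (lmul l w) m"
proof (cases w)
  case (Cons k v)
  assume "reduced w"
  then show ?thesis using Cons
    by (cases v rule: rev_cases) (auto simp: lmul_def rmul_def reduced_Cons reduced_snoc bar_eq_iff)
qed (auto simp: lmul_def rmul_def)

lemma lmul_append: "reduced (l # w) \<Longrightarrow> lmul l w = l # w"
  by (auto simp: lmul_def reduced_Cons)

lemma rmul_append: "reduced (w @ [l]) \<Longrightarrow> rmul w l = w @ [l]"
  by (auto simp: rmul_def reduced_snoc)

lemma verts_word_tree: "verts word_tree = emb ` Collect reduced"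
  and edges_word_tree: "edges word_tree = {{emb w, emb (rmul w l)} | w l. reduced w}"
  by (simp_all add: word_tree_def)

lemma edge_iff: "{emb u, emb v} \<in> edges word_tree \<longleftrightarrow> reduced u \<and> (\<exists>l. v = rmul u l)"
  unfolding edges_word_tree
  by (auto simp: doubleton_eq_iff intro: reduced_rmul) (metis rmul_bar)

lemma neighbours_word_tree:
  "reduced w \<Longrightarrow> {v. {emb w, v} \<in> edges word_tree} = (\<lambda>l. emb (rmul w l)) ` UNIV"
  using edge_iff[of w] by (fastforce simp: edges_word_tree doubleton_eq_iff)

lemma length_rmul: "length (rmul w l) = Suc (length w) \<or> (rmul w l = butlast w \<and> w \<noteq> [])"
  by (auto simp: rmul_def)

lemma rmul_neq: "rmul w l \<noteq> w"
  using length_rmul[of w l] by (metis append_butlast_last_id n_not_Suc_n not_Cons_self2 self_append_conv)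

lemma connected_to_Nil:
  assumes "reduced w"
  shows "(emb w, emb []) \<in> {(p, q). {p, q} \<in> edges word_tree}\<^sup>*"
  using assms
proof (induction w rule: rev_induct)
  case (snoc l w)
  then have "{emb (w @ [l]), emb w} \<in> edges word_tree"
    using edge_iff[of w "w @ [l]"] rmul_append by (metis insert_commute reduced_snoc)
  with snoc show ?case by (auto simp: reduced_snoc intro: converse_rtrancl_into_rtrancl)
qed simp

lemma ugraph_connected_word_tree: "ugraph_connected word_tree"
proof -
  have sym: "sym ({(p, q). {p, q} \<in> edges word_tree}\<^sup>*)"
    by (intro sym_rtrancl) (auto simp: sym_def insert_commute)
  have "(emb u, emb v) \<in> {(p, q). {p, q} \<in> edges word_tree}\<^sup>*" if "reduced u" "reduced v" for u v
    using connected_to_Nil[OF that(1)] symD[OF sym connected_to_Nil[OF that(2)]] by (rule rtrancl_trans)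
  then show ?thesis
    by (auto simp: ugraph_connected_def verts_word_tree)
qed

text \<open>At a longest word of a cycle both neighbours must equal its \<open>butlast\<close>, its
  only shorter neighbour; but the two neighbours on a cycle of length at least three are
  distinct.\<close>

lemma acyclic_word_tree: "\<not> ugraph_cycle word_tree c"
proof
  assume c: "ugraph_cycle word_tree c"
  define n where "n = length c"
  have n: "3 \<le> n" and dc: "distinct c"
    and ed: "\<And>i. i < n \<Longrightarrow> {c ! i, c ! (Suc i mod n)} \<in> edges word_tree"
    using c by (auto simp: ugraph_cycle_def n_def)
  have "\<exists>u. c ! i = emb u \<and> reduced u" if "i < n" for i
    using ed[OF that] by (auto simp: edges_word_tree doubleton_eq_iff intro: reduced_rmul)
  then obtain u where u: "\<And>i. i < n \<Longrightarrow> c ! i = emb (u i)" "\<And>i. i < n \<Longrightarrow> reduced (u i)"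
    by metis
  define m where "m = Max ((\<lambda>i. length (u i)) ` {..<n})"
  have "m \<in> (\<lambda>i. length (u i)) ` {..<n}"
    unfolding m_def by (rule Max_in) (use n in \<open>auto simp: lessThan_empty_iff intro!: exI[of _ 0]\<close>)
  then obtain i where i: "i < n" "m = length (u i)" by auto
  have le: "length (u j) \<le> length (u i)" if "j < n" for j
    using that unfolding i(2)[symmetric] m_def by (intro Max_ge) auto
  have nb: "u j = butlast (u i)" if "j < n" "{c ! i, c ! j} \<in> edges word_tree" for j
  proof -
    have "{emb (u i), emb (u j)} \<in> edges word_tree" using that u i by simp
    then obtain l where "u j = rmul (u i) l" unfolding edge_iff by blast
    then show ?thesis using length_rmul[of "u i" l] le[OF that(1)] by auto
  qed
  define j k where "j = Suc i mod n" and "k = (if i = 0 then n - 1 else i - 1)"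
  have jk: "j < n" "k < n" "j \<noteq> k" "Suc k mod n = i"
    using n i by (auto simp: j_def k_def mod_Suc)
  have "u j = butlast (u i)" using nb[OF jk(1)] ed[OF i(1)] by (simp add: j_def)
  moreover have "u k = butlast (u i)" 
  proof (rule nb[OF jk(2)])
    show "{c ! i, c ! k} \<in> edges word_tree"
      using ed[OF jk(2)] unfolding jk(4) by (subst insert_commute)
  qed
  ultimately have "c ! j = c ! k" using u jk by simp
  then show False using dc jk by (simp add: nth_eq_iff_index_eq n_def)
qed

lemma regular_word_tree: "regular_tree CARD('l) word_tree"
proof -
  have "simple_ugraph word_tree"
    unfolding simple_ugraph_def
  proof
    fix e assume "e \<in> edges word_tree"
    then obtain w l where "e = {emb w, emb (rmul w l)}" "reduced w"
      by (auto simp: edges_word_tree)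
    then show "\<exists>u\<in>verts word_tree. \<exists>v\<in>verts word_tree. u \<noteq> v \<and> e = {u, v}"
      using rmul_neq[of w l] by (intro bexI[of _ "emb w"] bexI[of _ "emb (rmul w l)"])
        (auto simp: verts_word_tree reduced_rmul)
  qed
  moreover have "card {v. {emb w, v} \<in> edges word_tree} = CARD('l)" if "reduced w" for w
    unfolding neighbours_word_tree[OF that]
    by (rule card_image) (auto intro!: injI dest: rmul_inj)
  moreover have "finite {v. {emb w, v} \<in> edges word_tree}" if "reduced w" for w
    unfolding neighbours_word_tree[OF that] by simp
  ultimately show ?thesis
    unfolding regular_tree_def
    using ugraph_connected_word_tree acyclic_word_tree
    by (auto simp: verts_word_tree intro: reduced_Nil)
qed

text \<open>The graph endomorphisms of \<open>word_tree\<close>, expressed on words without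
  \<open>emb\<close>.\<close>

definition word_map :: "('l list \<Rightarrow> 'l list) \<Rightarrow> bool" where
  "word_map f \<longleftrightarrow> (\<forall>w. reduced w \<longrightarrow> reduced (f w)) \<and>
     (\<forall>w l. reduced w \<longrightarrow> (\<exists>m. f (rmul w l) = rmul (f w) m))"

text \<open>Restricted to the vertices because elements of \<open>tree_Aut_set\<close> are
  extensional.\<close>

definition lift :: "('l list \<Rightarrow> 'l list) \<Rightarrow> 'v \<Rightarrow> 'v" where
  "lift f = (\<lambda>v\<in>verts word_tree. emb (f (the_inv emb v)))"

lemma lift_emb [simp]: "reduced w \<Longrightarrow> lift f (emb w) = emb (f w)"
  by (simp add: lift_def verts_word_tree the_inv_f_f[OF inj_emb])

lemma lift_cong: "(\<And>w. reduced w \<Longrightarrow> f w = g w) \<Longrightarrow> lift f = lift g"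
  by (auto simp: lift_def verts_word_tree the_inv_f_f[OF inj_emb] intro!: restrict_ext)

lemma word_map_reduced: "word_map f \<Longrightarrow> reduced w \<Longrightarrow> reduced (f w)"
  by (simp add: word_map_def)

lemma word_map_edge: "word_map f \<Longrightarrow> reduced w \<Longrightarrow> \<exists>m. f (rmul w l) = rmul (f w) m"
  by (simp add: word_map_def)

lemma word_map_comp: "word_map f \<Longrightarrow> word_map g \<Longrightarrow> word_map (f \<circ> g)"
  unfolding word_map_def comp_def by metis

lemma word_map_lmul: "word_map (lmul l)"
  by (auto simp: word_map_def reduced_lmul lmul_rmul)

lemma lift_in_tree_Aut_set:
  assumes "word_map f" "word_map g" and fg: "\<And>w. reduced w \<Longrightarrow> f (g w) = w" "\<And>w. reduced w \<Longrightarrow> g (f w) = w"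
  shows "lift f \<in> tree_Aut_set word_tree"
proof -
  have "bij_betw (lift f) (verts word_tree) (verts word_tree)"
    by (rule bij_betwI[where g = "lift g"])
      (use assms in \<open>auto simp: verts_word_tree word_map_reduced\<close>)
  moreover have "{lift f u, lift f v} \<in> edges word_tree \<longleftrightarrow> {u, v} \<in> edges word_tree"
    if uv: "u \<in> verts word_tree" "v \<in> verts word_tree" for u v
  proof -
    obtain x y where xy: "u = emb x" "v = emb y" "reduced x" "reduced y"
      using uv by (auto simp: verts_word_tree)
    have "(\<exists>l. f y = rmul (f x) l) \<longleftrightarrow> (\<exists>l. y = rmul x l)"
      using xy fg word_map_edge[OF assms(1), of x] word_map_edge[OF assms(2), of "f x"] assms(1)
      by (metis word_map_reduced)
    then show ?thesis using xy assms by (simp add: edge_iff word_map_reduced)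
  qed
  ultimately show ?thesis by (auto simp: tree_Aut_set_def Bij_def lift_def)
qed

end

text \<open>A letter \<open>m\<close> of the second alphabet passes through a letter of the first one by the rule
  \<open>m l = (act m l) (sect m l)\<close>; the four axioms say that the rule is compatible with inversion on
  either side.\<close>

locale automaton = alphabet bar emb for bar :: "'l::finite \<Rightarrow> 'l" and emb :: "'l list \<Rightarrow> 'v" +
  fixes mbar :: "'m \<Rightarrow> 'm" and act :: "'m \<Rightarrow> 'l \<Rightarrow> 'l" and sect :: "'m \<Rightarrow> 'l \<Rightarrow> 'm"
  assumes act_sect: "act (sect m l) (bar l) = bar (act m l)"
    and sect_sect: "sect (sect m l) (bar l) = m"
    and act_mbar: "act (mbar m) (act m l) = l"
    and sect_mbar: "sect (mbar m) (act m l) = mbar (sect m l)"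
    and mbar_mbar: "mbar (mbar m) = m"
begin

text \<open>Output of the transducer started in state \<open>m\<close>; \<open>sects\<close> is the
  state in which it stops.\<close>

primrec run :: "'m \<Rightarrow> 'l list \<Rightarrow> 'l list" where
  "run m [] = []"
| "run m (l # w) = act m l # run (sect m l) w"

primrec sects :: "'m \<Rightarrow> 'l list \<Rightarrow> 'm" where
  "sects m [] = m"
| "sects m (l # w) = sects (sect m l) w"

lemma run_append: "run m (u @ v) = run m u @ run (sects m u) v"
  by (induction u arbitrary: m) auto

lemma length_run [simp]: "length (run m w) = length w"
  by (induction w arbitrary: m) auto

lemma run_Nil_iff [simp]: "run m w = [] \<longleftrightarrow> w = []"
  by (metis length_0_conv length_run)

lemma hd_run: "w \<noteq> [] \<Longrightarrow> hd (run m w) = act m (hd w)"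
  by (cases w) auto

lemma act_inj: "act m l = act m k \<longleftrightarrow> l = k"
  by (metis act_mbar)

text \<open>By \<open>act_sect\<close> and injectivity of \<open>act\<close>, adjacent output
  letters cancel only if the input letters do.\<close>

lemma reduced_run: "reduced w \<Longrightarrow> reduced (run m w)"
proof (induction w arbitrary: m)
  case (Cons l w)
  then show ?case
    by (auto simp: reduced_Cons hd_run) (metis act_inj act_sect)
qed simp

lemma run_mbar: "run (mbar m) (run m w) = w"
  by (induction w arbitrary: m) (auto simp: act_mbar sect_mbar)

text \<open>When \<open>l\<close> cancels against the head of \<open>w\<close>,
  \<open>act_sect\<close> makes the outputs cancel and \<open>sect_sect\<close> restores the state
  \<open>m\<close>.\<close>

lemma run_lmul: "run m (lmul l w) = lmul (act m l) (run (sect m l) w)"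
proof (cases "w \<noteq> [] \<and> hd w = bar l")
  case True
  then obtain v where w: "w = bar l # v" by (cases w) auto
  then show ?thesis by (simp add: lmul_def act_sect sect_sect)
next
  case False
  moreover have "hd (run (sect m l) w) \<noteq> bar (act m l)" if "w \<noteq> []"
    using that False by (simp add: hd_run act_inj act_sect[symmetric])
  ultimately show ?thesis by (auto simp: lmul_def)
qed

lemma sects_append: "sects m (u @ v) = sects (sects m u) v"
  by (induction u arbitrary: m) auto

lemma run_rmul: "run m (rmul w l) = rmul (run m w) (act (sects m w) l)"
proof (cases "w = []")
  case True then show ?thesis by (simp add: rmul_def)
next
  case False
  then obtain v k where w: "w = v @ [k]" by (metis rev_exhaust)
  have "act (sects m v) k = bar (act (sects m w) l) \<longleftrightarrow> k = bar l"
    by (metis act_inj act_sect sect_sect w sects_append sects.simps bar_bar)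
  then show ?thesis using w by (auto simp: rmul_def run_append sects_append)
qed

lemma word_map_run: "word_map (run m)"
  unfolding word_map_def using reduced_run run_rmul by blast

end

subsection \<open>Lines through the root of a tree of words\<close>

primrec common_prefix :: "(nat \<Rightarrow> 'l) \<Rightarrow> 'l list \<Rightarrow> nat" where
  "common_prefix p [] = 0"
| "common_prefix p (l # w) = (if l = p 0 then Suc (common_prefix (\<lambda>i. p (Suc i)) w) else 0)"

lemma common_prefix_le: "common_prefix p w \<le> length w"
  by (induction w arbitrary: p) auto

lemma common_prefix_snoc:
  "common_prefix p (w @ [l]) =
    (if common_prefix p w = length w \<and> l = p (length w) then Suc (length w) else common_prefix p w)"
  by (induction w arbitrary: p) auto

lemma common_prefix_eq_length: "common_prefix p w = length w \<longleftrightarrow> w = map p [0..<length w]"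
proof (induction w rule: rev_induct)
  case (snoc l w)
  then show ?case
    using common_prefix_le[of p w] by (auto simp: common_prefix_snoc)
qed simp

definition ray_line :: "(nat \<Rightarrow> 'l) \<Rightarrow> (nat \<Rightarrow> 'l) \<Rightarrow> int \<Rightarrow> 'l list" where
  "ray_line p q n = (if 0 \<le> n then map p [0..<nat n] else map q [0..<nat (- n)])"

text \<open>The path from the root to \<open>w\<close> leaves the line at the end of the common
  prefix with one of the two rays, so the signed prefix length is the projection index.\<close>

definition ray_gate :: "(nat \<Rightarrow> 'l) \<Rightarrow> (nat \<Rightarrow> 'l) \<Rightarrow> 'l list \<Rightarrow> int" where
  "ray_gate p q w = (if w \<noteq> [] \<and> hd w = q 0 then - int (common_prefix q w) else int (common_prefix p w))"

lemma hd_map_upt: "0 < n \<Longrightarrow> hd (map p [0..<n]) = p 0"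
  by (cases n) (simp_all del: upt_Suc add: upt_rec)

lemma ray_gate_line:
  assumes "p 0 \<noteq> q 0"
  shows "ray_gate p q (ray_line p q n) = n"
  using assms common_prefix_eq_length[of p "map p [0..<nat n]"] common_prefix_eq_length[of q
      "map q [0..<nat (- n)]"]
  by (auto simp: ray_gate_def ray_line_def hd_map_upt)

text \<open>A further letter lengthens the common prefix only if the whole word follows the ray
  already, that is, if both words are on the line.\<close>

lemma ray_gate_snoc:
  "ray_gate p q (w @ [l]) = ray_gate p q w \<or>
    (w = ray_line p q (ray_gate p q w) \<and> w @ [l] = ray_line p q (ray_gate p q (w @ [l])) \<and>
     \<bar>ray_gate p q w - ray_gate p q (w @ [l])\<bar> = 1)"
proof (cases "w = []")
  case True
  then show ?thesis by (auto simp: ray_gate_def ray_line_def)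
next
  case False
  define r where "r = (if hd w = q 0 then q else p)"
  have g: "ray_gate p q w = (if hd w = q 0 then - int (common_prefix r w) else int (common_prefix r w))"
    "ray_gate p q (w @ [l]) = (if hd w = q 0 then - int (common_prefix r (w @ [l])) else int (common_prefix r (w @ [l])))"
    using False by (auto simp: ray_gate_def r_def)
  show ?thesis
  proof (cases "common_prefix r w = length w \<and> l = r (length w)")
    case True
    then have w: "w = map r [0..<length w]" by (simp add: common_prefix_eq_length)
    have len: "common_prefix r (w @ [l]) = Suc (length w)" using True by (simp add: common_prefix_snoc)
    have wl: "w @ [l] = map r [0..<Suc (length w)]" using w True by simp
    show ?thesis
    proof (cases "hd w = q 0")
      case hd: True
      have "ray_line p q (- int (length w)) = w" "ray_line p q (- int (Suc (length w))) = w @ [l]"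
        using False w wl hd by (simp_all add: ray_line_def r_def nat_add_distrib del: upt_Suc)
      then show ?thesis using g True len hd by auto
    next
      case hd: False
      have "ray_line p q (int (length w)) = w" "ray_line p q (int (Suc (length w))) = w @ [l]"
        using False w wl hd by (simp_all add: ray_line_def r_def nat_add_distrib del: upt_Suc)
      then show ?thesis using g True len hd by auto
    qed
  next
    case False
    then have "common_prefix r (w @ [l]) = common_prefix r w" by (auto simp: common_prefix_snoc)
    then show ?thesis using g by simp
  qed
qed

context alphabet
begin

lemma reduced_ray:
  assumes "\<And>i. p (Suc i) \<noteq> bar (p i)"
  shows "reduced (map p [0..<n])"
proof (induction n)
  case (Suc n)
  have "last (map p [0..<n]) \<noteq> bar (p n)" if "n \<noteq> 0"
    using that assms[of "n - 1"] by (cases n) (auto simp: bar_eq_iff dest: arg_cong[of _ _ bar])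
  then show ?case using Suc by (auto simp: reduced_snoc)
qed simp

text \<open>An edge appends or deletes one letter, so \<open>ray_gate_snoc\<close>, read in both
  directions, is the axiom on \<open>gate\<close>.\<close>

lemma word_tree_line:
  assumes pq: "p 0 \<noteq> q 0" and p: "\<And>i. p (Suc i) \<noteq> bar (p i)" and q: "\<And>i. q (Suc i) \<noteq> bar (q i)"
  shows "tree_line word_tree (\<lambda>n. emb (ray_line p q n)) (\<lambda>v. ray_gate p q (the_inv emb v))"
proof -
  interpret metric_graph word_tree
    by (rule regular_tree_metric_graph[OF regular_word_tree]) (simp add: card_gt_0_iff)
  have red: "reduced (ray_line p q n)" for n
    by (simp add: ray_line_def reduced_ray p q)
  have edge: "{emb w, emb (w @ [l])} \<in> edges word_tree" if "reduced (w @ [l])" for w l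
    using that rmul_append[OF that] unfolding edge_iff reduced_snoc by metis
  have snoc: "ray_gate p q u = ray_gate p q v \<or> (u = ray_line p q (ray_gate p q u) \<and>
     v = ray_line p q (ray_gate p q v) \<and> \<bar>ray_gate p q u - ray_gate p q v\<bar> = 1)"
    if "{emb u, emb v} \<in> edges word_tree" for u v
  proof -
    obtain l where l: "reduced u" "v = rmul u l"
      using \<open>{emb u, emb v} \<in> edges word_tree\<close> unfolding edge_iff by blast
    show ?thesis
    proof (cases "u \<noteq> [] \<and> last u = bar l")
      case True
      then have "u = v @ [bar l]" using l by (simp add: rmul_def) (metis append_butlast_last_id)
      then show ?thesis using ray_gate_snoc[of p q v "bar l"] by (auto simp: abs_minus_commute)
    next
      case False
      then have "v = u @ [l]" using l by (auto simp: rmul_def)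
      then show ?thesis using ray_gate_snoc[of p q u l] by auto
    qed
  qed
  show ?thesis
  proof
    show "{emb (ray_line p q n), emb (ray_line p q (n + 1))} \<in> edges word_tree" for n
    proof (cases "0 \<le> n")
      case True
      then have "ray_line p q (n + 1) = ray_line p q n @ [p (nat n)]"
        by (simp add: ray_line_def nat_add_distrib)
      then show ?thesis using edge[of "ray_line p q n"] red[of "n + 1"] by simp
    next
      case False
      then have "nat (- n) = Suc (nat (- (n + 1)))" by linarith
      then have "ray_line p q n = ray_line p q (n + 1) @ [q (nat (- (n + 1)))]"
        using False by (auto simp: ray_line_def)
      then show ?thesis using edge[of "ray_line p q (n + 1)"] red[of n] by (simp add: insert_commute)
    qed
    show "ray_gate p q (the_inv emb (emb (ray_line p q n))) = n" for n
      using ray_gate_line[of p q n] pq by (simp add: the_inv_f_f[OF inj_emb])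
    fix u v assume uv: "{u, v} \<in> edges word_tree"
    then obtain x y where "u = emb x" "v = emb y" by (auto simp: edges_word_tree doubleton_eq_iff)
    then show "ray_gate p q (the_inv emb u) = ray_gate p q (the_inv emb v) \<or>
      (u = emb (ray_line p q (ray_gate p q (the_inv emb u))) \<and> v
      = emb (ray_line p q (ray_gate p q (the_inv emb v))) \<and>
       \<bar>ray_gate p q (the_inv emb u) - ray_gate p q (the_inv emb v)\<bar> = 1)"
      using snoc[of x y] uv by (simp add: the_inv_f_f[OF inj_emb])
  qed
qed

end

section \<open>The two automata of \<open>\<Gamma>\<^sub>0\<close>\<close>

datatype vlet = VA | VA' | VB | VB'
datatype hlet = HX | HY | HZ | HT

lemma UNIV_vlet: "UNIV = {VA, VA', VB, VB'}"
  using vlet.exhaust by auto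

lemma UNIV_hlet: "UNIV = {HX, HY, HZ, HT}"
  using hlet.exhaust by auto

instance vlet :: finite
  by standard (simp add: UNIV_vlet)

instance hlet :: finite
  by standard (simp add: UNIV_hlet)

lemma CARD_vlet: "CARD(vlet) = 4" and CARD_hlet: "CARD(hlet) = 4"
  by (simp_all add: UNIV_vlet UNIV_hlet)

fun vbar :: "vlet \<Rightarrow> vlet" where
  "vbar VA = VA'" | "vbar VA' = VA" | "vbar VB = VB'" | "vbar VB' = VB"

fun vletter :: "vlet \<Rightarrow> gen \<times> bool" where
  "vletter VA = pos gA" | "vletter VA' = neg gA" | "vletter VB = pos gB" | "vletter VB' = neg gB"

fun hletter :: "hlet \<Rightarrow> gen \<times> bool" where
  "hletter HX = pos gX" | "hletter HY = pos gY" | "hletter HZ = pos gZ" | "hletter HT = pos gT"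

text \<open>Each relator \<open>a x b\<inverse> z\<close> is read as the rule \<open>a x = z b\<close>: the vertical letter \<open>a\<close> turns \<open>x\<close> into
  \<open>z\<close> and becomes \<open>b\<close>.\<close>

fun vh_act :: "vlet \<Rightarrow> hlet \<Rightarrow> hlet" where
  "vh_act VA HX = HZ" | "vh_act VA HY = HT" | "vh_act VA HZ = HX" | "vh_act VA HT = HY"
| "vh_act VB HX = HZ" | "vh_act VB HY = HX" | "vh_act VB HZ = HT" | "vh_act VB HT = HY"
| "vh_act VA' HX = HZ" | "vh_act VA' HY = HT" | "vh_act VA' HZ = HX" | "vh_act VA' HT = HY"
| "vh_act VB' HX = HY" | "vh_act VB' HY = HT" | "vh_act VB' HZ = HX" | "vh_act VB' HT = HZ"

fun vh_sect :: "vlet \<Rightarrow> hlet \<Rightarrow> vlet" where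
  "vh_sect VA HX = VB" | "vh_sect VA h = VA"
| "vh_sect VB HX = VA" | "vh_sect VB h = VB"
| "vh_sect VA' HZ = VB'" | "vh_sect VA' h = VA'"
| "vh_sect VB' HZ = VA'" | "vh_sect VB' h = VB'"

text \<open>The same squares read the other way: by \<open>z b = a x\<close> the horizontal letter
  \<open>z\<close> turns \<open>b\<close> into \<open>a\<close> and becomes
  \<open>x\<close>.\<close>

fun hv_act :: "hlet \<Rightarrow> vlet \<Rightarrow> vlet" where
  "hv_act HZ VA = VB" | "hv_act HZ VB = VA" | "hv_act HX VA' = VB'" | "hv_act HX VB' = VA'"
| "hv_act h v = v"

fun hv_sect :: "hlet \<Rightarrow> vlet \<Rightarrow> hlet" where
  "hv_sect HX VA = HZ" | "hv_sect HY VA = HT" | "hv_sect HZ VA = HX" | "hv_sect HT VA = HY"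
| "hv_sect HX VB = HY" | "hv_sect HY VB = HT" | "hv_sect HZ VB = HX" | "hv_sect HT VB = HZ"
| "hv_sect HX VA' = HZ" | "hv_sect HY VA' = HT" | "hv_sect HZ VA' = HX" | "hv_sect HT VA' = HY"
| "hv_sect HX VB' = HZ" | "hv_sect HY VB' = HX" | "hv_sect HZ VB' = HT" | "hv_sect HT VB' = HY"

text \<open>Nested singletons are just an injection of words into \<open>gen word set set\<close>,
  the vertex type common to both trees.\<close>

definition vemb :: "vlet list \<Rightarrow> gen word set set" where
  "vemb w = {{map vletter w}}"

definition hemb :: "hlet list \<Rightarrow> gen word set set" where
  "hemb w = {{map hletter w}}"

lemma inj_vletter: "inj vletter"
proof (rule injI)
  fix u v assume "vletter u = vletter v"
  then show "u = v" by (cases u; cases v; simp)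
qed

lemma inj_hletter: "inj hletter"
proof (rule injI)
  fix u v assume "hletter u = hletter v"
  then show "u = v" by (cases u; cases v; simp)
qed

text \<open>The states are involutions, so their inversion is the identity. The axioms are checked
  on all sixteen pairs of letters.\<close>

interpretation V: automaton vbar vemb "\<lambda>h. h" hv_act hv_sect
proof
  show "inj vemb"
    using inj_vletter by (auto simp: inj_def vemb_def map_inj_on dest!: map_injective intro: injI)
  show "vbar (vbar l) = l" for l by (cases l) auto
  fix m l
  show "hv_act (hv_sect m l) (vbar l) = vbar (hv_act m l)"
    "hv_sect (hv_sect m l) (vbar l) = m" "hv_act m (hv_act m l) = l" "hv_sect m (hv_act m l) = hv_sect m l"
    by (cases m; cases l; simp)+
qed simp

interpretation H: automaton "\<lambda>h. h" hemb vbar vh_act vh_sect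
proof
  show "inj hemb"
    using inj_hletter by (auto simp: inj_def hemb_def map_inj_on dest!: map_injective intro: injI)
  fix m l
  show "vbar (vbar m) = m" by (cases m) auto
  show "vh_act (vh_sect m l) l = vh_act m l"
    "vh_sect (vh_sect m l) l = m" "vh_act (vbar m) (vh_act m l) = l" "vh_sect (vbar m) (vh_act m l)
        = vbar (vh_sect m l)"
    by (cases m; cases l; simp)+
qed simp

section \<open>The orbit of \<open>xyxy...\<close> under \<open>a\<close>\<close>

text \<open>A tile is a rectangle of squares: the word \<open>v\<close> turns the word \<open>h\<close> into \<open>h'\<close> and becomes \<open>v'\<close>.\<close>

definition tile :: "vlet list \<Rightarrow> hlet list \<Rightarrow> hlet list \<Rightarrow> vlet list \<Rightarrow> bool" where
  "tile v h h' v' \<longleftrightarrow> (\<forall>w. foldr H.run v (h @ w) = h' @ foldr H.run v' w)"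

text \<open>Four tiles glued to a two by two block, in the order lower left, lower right, upper
  left, upper right; \<open>v\<close> acts before \<open>u\<close>.\<close>

lemma tile_compose:
  assumes "tile v h k m" "tile m h' k' v'" "tile u k t n" "tile n k' t' u'"
  shows "tile (u @ v) (h @ h') (t @ t') (u' @ v')"
  using assms by (simp add: tile_def)

text \<open>The quarter plane with boundary \<open>aaa...\<close> and \<open>xyxy...\<close> is generated by a substitution: 14 tiles
  of size \<open>2\<^sup>k \<times> 2\<^sup>k\<close> whose sides are among six words in each direction, and each tile of the next
  size is composed of four of them. The side words below are those of size \<open>4 \<cdot> 2\<^sup>k\<close>.\<close>

primrec hword :: "nat \<Rightarrow> nat \<Rightarrow> hlet list" where
  "hword 0 i = [[HX, HY, HX, HY], [HX, HY, HT, HZ], [HX, HY, HT, HY],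
     [HT, HY, HX, HZ], [HT, HY, HX, HY], [HT, HY, HT, HY]] ! i"
| "hword (Suc k) i = hword k ([0, 0, 4, 5, 2, 5] ! i) @ hword k ([0, 3, 5, 1, 0, 5] ! i)"

primrec vword :: "nat \<Rightarrow> nat \<Rightarrow> vlet list" where
  "vword 0 i = [[VA, VA, VA, VA], [VB, VB, VB, VA], [VB, VA, VA, VA],
     [VA, VB, VB, VA], [VA, VA, VB, VB], [VB, VA, VB, VB]] ! i"
| "vword (Suc k) i = vword k ([0, 1, 2, 3, 0, 2] ! i) @ vword k ([0, 2, 0, 2, 5, 5] ! i)"

text \<open>Indices of the left, bottom, top and right side. The list is closed under division into
  four, which makes the induction possible.\<close>

definition tiles :: "(nat \<times> nat \<times> nat \<times> nat) set" where
  "tiles = {(0, 0, 1, 1), (0, 1, 0, 4), (0, 5, 5, 0), (1, 0, 2, 2), (1, 3, 4, 5), (2, 0, 3, 3), (2, 1, 5, 5),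
    (2, 5, 0, 2), (3, 0, 4, 0), (3, 3, 2, 4), (4, 2, 3, 1), (4, 4, 0, 0), (5, 2, 1, 3), (5, 4, 5, 2)}"

text \<open>The blocks of side four are checked by running the automaton; every larger tile is glued
  from four listed tiles of half its side.\<close>

lemma tiles: "(i, j, j', i') \<in> tiles \<Longrightarrow> tile (vword k i) (hword k j) (hword k j') (vword k i')"
proof (induction k arbitrary: i j j' i')
  case 0
  then show ?case unfolding tiles_def by (elim insertE emptyE) (simp_all add: tile_def)
next
  case (Suc k)
  note t = Suc.IH
  have "tile (vword (Suc k) 0) (hword (Suc k) 0) (hword (Suc k) 1) (vword (Suc k) 1)"
    using tile_compose[OF t[of 0 0 1 1] t[of 1 0 2 2] t[of 0 1 0 4] t[of 4 2 3 1]] by (simp add: tiles_def)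
  moreover have "tile (vword (Suc k) 0) (hword (Suc k) 1) (hword (Suc k) 0) (vword (Suc k) 4)"
    using tile_compose[OF t[of 0 0 1 1] t[of 1 3 4 5] t[of 0 1 0 4] t[of 4 4 0 0]] by (simp add: tiles_def)
  moreover have "tile (vword (Suc k) 0) (hword (Suc k) 5) (hword (Suc k) 5) (vword (Suc k) 0)"
    using tile_compose[OF t[of 0 5 5 0] t[of 0 5 5 0] t[of 0 5 5 0] t[of 0 5 5 0]] by (simp add: tiles_def)
  moreover have "tile (vword (Suc k) 1) (hword (Suc k) 0) (hword (Suc k) 2) (vword (Suc k) 2)"
    using tile_compose[OF t[of 2 0 3 3] t[of 3 0 4 0] t[of 1 3 4 5] t[of 5 4 5 2]] by (simp add: tiles_def)
  moreover have "tile (vword (Suc k) 1) (hword (Suc k) 3) (hword (Suc k) 4) (vword (Suc k) 5)"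
    using tile_compose[OF t[of 2 5 0 2] t[of 2 1 5 5] t[of 1 0 2 2] t[of 2 5 0 2]] by (simp add: tiles_def)
  moreover have "tile (vword (Suc k) 2) (hword (Suc k) 0) (hword (Suc k) 3) (vword (Suc k) 3)"
    using tile_compose[OF t[of 0 0 1 1] t[of 1 0 2 2] t[of 2 1 5 5] t[of 5 2 1 3]] by (simp add: tiles_def)
  moreover have "tile (vword (Suc k) 2) (hword (Suc k) 1) (hword (Suc k) 5) (vword (Suc k) 5)"
    using tile_compose[OF t[of 0 0 1 1] t[of 1 3 4 5] t[of 2 1 5 5] t[of 5 4 5 2]] by (simp add: tiles_def)
  moreover have "tile (vword (Suc k) 2) (hword (Suc k) 5) (hword (Suc k) 0) (vword (Suc k) 2)"
    using tile_compose[OF t[of 0 5 5 0] t[of 0 5 5 0] t[of 2 5 0 2] t[of 2 5 0 2]] by (simp add: tiles_def)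
  moreover have "tile (vword (Suc k) 3) (hword (Suc k) 0) (hword (Suc k) 4) (vword (Suc k) 0)"
    using tile_compose[OF t[of 2 0 3 3] t[of 3 0 4 0] t[of 3 3 2 4] t[of 4 4 0 0]] by (simp add: tiles_def)
  moreover have "tile (vword (Suc k) 3) (hword (Suc k) 3) (hword (Suc k) 2) (vword (Suc k) 4)"
    using tile_compose[OF t[of 2 5 0 2] t[of 2 1 5 5] t[of 3 0 4 0] t[of 0 5 5 0]] by (simp add: tiles_def)
  moreover have "tile (vword (Suc k) 4) (hword (Suc k) 2) (hword (Suc k) 3) (vword (Suc k) 1)"
    using tile_compose[OF t[of 5 4 5 2] t[of 2 5 0 2] t[of 0 5 5 0] t[of 0 0 1 1]] by (simp add: tiles_def)
  moreover have "tile (vword (Suc k) 4) (hword (Suc k) 4) (hword (Suc k) 0) (vword (Suc k) 0)"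
    using tile_compose[OF t[of 5 2 1 3] t[of 3 0 4 0] t[of 0 1 0 4] t[of 4 4 0 0]] by (simp add: tiles_def)
  moreover have "tile (vword (Suc k) 5) (hword (Suc k) 2) (hword (Suc k) 1) (vword (Suc k) 3)"
    using tile_compose[OF t[of 5 4 5 2] t[of 2 5 0 2] t[of 2 5 0 2] t[of 2 0 3 3]] by (simp add: tiles_def)
  moreover have "tile (vword (Suc k) 5) (hword (Suc k) 4) (hword (Suc k) 5) (vword (Suc k) 2)"
    using tile_compose[OF t[of 5 2 1 3] t[of 3 0 4 0] t[of 2 1 5 5] t[of 5 4 5 2]] by (simp add: tiles_def)
  ultimately show ?case
    using Suc.prems unfolding tiles_def by (elim insertE emptyE) (simp_all only: prod.inject)
qed

lemma vword_0: "vword k 0 = replicate (4 * 2 ^ k) VA"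
  by (induction k) (simp_all add: replicate_add[symmetric] numeral_eq_Suc)

abbreviation xy_ray :: "nat \<Rightarrow> hlet" where "xy_ray i \<equiv> if even i then HX else HY"
abbreviation yx_ray :: "nat \<Rightarrow> hlet" where "yx_ray i \<equiv> if even i then HY else HX"

lemma xy_ray_append: "even m \<Longrightarrow> map xy_ray [0..<m] @ map xy_ray [0..<n] = map xy_ray [0..<m + n]"
  by (rule nth_equalityI) (auto simp: nth_append)

lemma hword_0: "hword k 0 = map xy_ray [0..<4 * 2 ^ k]"
proof (induction k)
  case (Suc k)
  then show ?case using xy_ray_append[of "4 * 2 ^ k" "4 * 2 ^ k"] by simp
qed (simp add: upt_rec)

text \<open>The substitution exchanges 1 and 3 in the second half, so the final \<open>z\<close> of
  both initial words persists.\<close>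

lemma last_hword: "last (hword k 1) = HZ \<and> last (hword k 3) = HZ \<and> hword k 1 \<noteq> [] \<and> hword k 3 \<noteq> []"
  by (induction k) auto

lemma foldr_run_append: "\<exists>v'. foldr H.run v (h @ w) = foldr H.run v h @ foldr H.run v' w"
proof (induction v)
  case (Cons g v)
  then obtain v' where "foldr H.run v (h @ w) = foldr H.run v h @ foldr H.run v' w" by blast
  then have "foldr H.run (g # v) (h @ w) =
      foldr H.run (g # v) h @ foldr H.run (H.sects g (foldr H.run v h) # v') w"
    by (simp add: H.run_append)
  then show ?case by blast
qed (auto intro: exI[of _ "[]"])

lemma length_foldr_run [simp]: "length (foldr H.run v h) = length h"
  by (induction v) auto

lemma foldr_run_replicate: "foldr H.run (replicate n g) = H.run g ^^ n"
  by (induction n) auto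

lemma foldr_run_prefix:
  assumes "foldr H.run v (h @ w) = h' @ w'" "length h = length h'"
  shows "foldr H.run v h = h'"
  using foldr_run_append[of v h w] assms by auto

text \<open>By the tile \<open>(0, 0, 1, 1)\<close> the image is \<open>hword k 1\<close>, which
  ends in \<open>z\<close>; the alternating word contains no \<open>z\<close>.\<close>

lemma a_pow_moves: "(H.run VA ^^ (4 * 2 ^ k)) (map xy_ray [0..<4 * 2 ^ k]) \<noteq> map xy_ray [0..<4 * 2 ^ k]"
proof -
  have "tile (vword k 0) (hword k 0) (hword k 1) (vword k 1)" by (rule tiles) (simp add: tiles_def)
  then have "foldr H.run (vword k 0) (hword k 0 @ []) = hword k 1 @ foldr H.run (vword k 1) []"
    unfolding tile_def by blast
  moreover have "foldr H.run v [] = []" for v by (induction v) auto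
  ultimately have "(H.run VA ^^ (4 * 2 ^ k)) (map xy_ray [0..<4 * 2 ^ k]) = hword k 1"
    by (simp add: vword_0 hword_0 foldr_run_replicate)
  moreover have "last (map xy_ray [0..<4 * 2 ^ k]) \<noteq> HZ"
    by (subst last_map) auto
  ultimately show ?thesis using last_hword[of k] by metis
qed

text \<open>The same tile of size \<open>l = Suc m\<close> sends \<open>hword l 0\<close> to
  \<open>hword l 1\<close>. Both have first half \<open>hword m 0\<close>, so this half and all its
  prefixes come back unchanged.\<close>

lemma a_pow_fixes:
  assumes "k < l"
  shows "(H.run VA ^^ (4 * 2 ^ l)) (map xy_ray [0..<4 * 2 ^ k]) = map xy_ray [0..<4 * 2 ^ k]"
proof -
  obtain m where m: "l = Suc m" "k \<le> m" using assms by (cases l) auto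
  have "tile (vword l 0) (hword l 0) (hword l 1) (vword l 1)" by (rule tiles) (simp add: tiles_def)
  then have "foldr H.run (vword l 0) (hword l 0 @ []) = hword l 1 @ foldr H.run (vword l 1) []"
    unfolding tile_def by blast
  then have "foldr H.run (vword l 0) (hword m 0 @ hword m 0)
      = hword m 0 @ (hword m 3 @ foldr H.run (vword l 1) [])"
    by (simp add: m(1) del: vword.simps)
  then have m0: "foldr H.run (vword l 0) (hword m 0) = hword m 0" by (rule foldr_run_prefix) simp
  have "(2::nat) ^ k \<le> 2 ^ m" using m by (intro power_increasing) auto
  then obtain n where n: "4 * 2 ^ m = 4 * 2 ^ k + (n::nat)" by (metis le_iff_add mult_le_mono2)
  have "hword m 0 = map xy_ray [0..<4 * 2 ^ k] @ map xy_ray [0..<n]"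
    unfolding hword_0 n by (rule xy_ray_append[symmetric]) simp
  with m0 have "foldr H.run (vword l 0) (map xy_ray [0..<4 * 2 ^ k] @ map xy_ray [0..<n]) =
     map xy_ray [0..<4 * 2 ^ k] @ map xy_ray [0..<n]" by simp
  then have "foldr H.run (vword l 0) (map xy_ray [0..<4 * 2 ^ k]) = map xy_ray [0..<4 * 2 ^ k]"
    by (rule foldr_run_prefix) simp
  then show ?thesis by (simp add: vword_0 foldr_run_replicate)
qed

lemma a_orbit_infinite:
  assumes "0 < N"
  shows "\<exists>n. (H.run VA ^^ N) (map xy_ray [0..<n]) \<noteq> map xy_ray [0..<n]"
proof (rule ccontr)
  assume "\<not> ?thesis"
  then have fixN: "(H.run VA ^^ N) (map xy_ray [0..<n]) = map xy_ray [0..<n]" for n by blast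
  \<comment> \<open>Two exponents congruent modulo \<open>N\<close> would give the same map on the
    ray; for \<open>k < l\<close>, however, the larger power fixes the prefix of length
    \<open>4 * 2 ^ k\<close> and the smaller one moves it.\<close>
  have "\<not> inj (\<lambda>k. 4 * 2 ^ k mod N)"
  proof
    assume "inj (\<lambda>k. 4 * 2 ^ k mod N)"
    moreover have "finite (range (\<lambda>k. 4 * 2 ^ k mod N))"
      by (rule finite_subset[of _ "{..<N}"]) (use assms in auto)
    ultimately show False using finite_imageD infinite_UNIV_nat by blast
  qed
  then obtain k l where "k \<noteq> l" "4 * 2 ^ k mod N = 4 * 2 ^ l mod N" by (auto simp: inj_def)
  then obtain k l where kl: "k < l" "4 * 2 ^ k mod N = 4 * 2 ^ l mod N" by (metis nat_neq_iff)
  have "(4::nat) * 2 ^ k \<le> 4 * 2 ^ l" using kl by simp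
  then obtain q where q: "4 * 2 ^ l = 4 * 2 ^ k + N * q" using kl(2) by (metis mod_eq_nat1E)
  have "(H.run VA ^^ (N * q)) (map xy_ray [0..<n]) = map xy_ray [0..<n]" for n
    unfolding funpow_mult[symmetric] by (induction q) (auto simp: fixN)
  then have "(H.run VA ^^ (4 * 2 ^ l)) (map xy_ray [0..<4 * 2 ^ k])
      = (H.run VA ^^ (4 * 2 ^ k)) (map xy_ray [0..<4 * 2 ^ k])"
    unfolding q funpow_add by simp
  then show False using a_pow_fixes[OF kl(1)] a_pow_moves[of k] by simp
qed

section \<open>Presented groups\<close>

lemma pres_eq_context: "pres_eq R u v \<Longrightarrow> pres_eq R (p @ u @ q) (p @ v @ q)"
proof (induction rule: pres_eq.induct)
  case (cancel u g s v)
  then show ?case using pres_eq.cancel[of R "p @ u" g s "v @ q"] by simp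
next
  case (relator r u v)
  then show ?case using pres_eq.relator[of r R "p @ u" "v @ q"] by simp
qed (auto intro: pres_eq.intros)

lemma pres_eq_append: "pres_eq R u u' \<Longrightarrow> pres_eq R v v' \<Longrightarrow> pres_eq R (u @ v) (u' @ v')"
  using pres_eq_context[of R u u' "[]" v] pres_eq_context[of R v v' u' "[]"] by (auto intro: pres_eq.trans)

lemma pres_class_eq_iff: "pres_class R u = pres_class R v \<longleftrightarrow> pres_eq R u v"
proof
  assume "pres_class R u = pres_class R v"
  moreover have "v \<in> pres_class R v" by (simp add: pres_class_def pres_eq.refl)
  ultimately have "v \<in> pres_class R u" by simp
  then show "pres_eq R u v" by (simp add: pres_class_def)
next
  assume "pres_eq R u v"
  then show "pres_class R u = pres_class R v"
    by (auto simp: pres_class_def intro: pres_eq.trans pres_eq.sym)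
qed

lemma carrier_presented_group: "carrier (presented_group R) = range (pres_class R)"
  by (simp add: presented_group_def)

lemma one_presented_group: "\<one>\<^bsub>presented_group R\<^esub> = pres_class R []"
  by (simp add: presented_group_def)

lemma mult_presented_group:
  "pres_class R u \<otimes>\<^bsub>presented_group R\<^esub> pres_class R v = pres_class R (u @ v)"
proof -
  have "pres_eq R (u @ v) w \<longleftrightarrow> (\<exists>p q. pres_eq R u p \<and> pres_eq R v q \<and> pres_eq R (p @ q) w)" for w
    by (auto intro: pres_eq.refl pres_eq.trans pres_eq_append)
  then show ?thesis by (auto simp: presented_group_def pres_class_def)
qed

definition inv_word :: "'g word \<Rightarrow> 'g word" where
  "inv_word w = rev (map (\<lambda>(g, s). (g, \<not> s)) w)"

lemma inv_word_Cons: "inv_word ((g, s) # w) = inv_word w @ [(g, \<not> s)]"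
  by (simp add: inv_word_def)

lemma inv_word_inv_word [simp]: "inv_word (inv_word w) = w"
  by (simp add: inv_word_def rev_map[symmetric] o_def split_def)

lemma pres_eq_inv_word: "pres_eq R (inv_word w @ w) []"
proof (induction w)
  case Nil
  then show ?case by (simp add: inv_word_def pres_eq.refl)
next
  case (Cons l w)
  obtain g s where l: "l = (g, s)" by (cases l)
  have "pres_eq R (inv_word w @ [(g, \<not> s), (g, \<not> \<not> s)] @ w) (inv_word w @ w)" by (rule pres_eq.cancel)
  then show ?case using Cons l pres_eq.trans by (auto simp: inv_word_Cons)
qed

lemma group_presented_group: "group (presented_group R)"
proof (rule groupI)
  fix P assume "P \<in> carrier (presented_group R)"
  then obtain w where w: "P = pres_class R w" by (auto simp: carrier_presented_group)
  then show "\<one>\<^bsub>presented_group R\<^esub> \<otimes>\<^bsub>presented_group R\<^esub> P = P"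
    by (simp add: one_presented_group mult_presented_group)
  have "pres_class R (inv_word w) \<otimes>\<^bsub>presented_group R\<^esub> P = \<one>\<^bsub>presented_group R\<^esub>"
    using pres_eq_inv_word[of R w]
    by (simp add: w one_presented_group mult_presented_group pres_class_eq_iff)
  then show "\<exists>Q\<in>carrier (presented_group R). Q \<otimes>\<^bsub>presented_group R\<^esub> P = \<one>\<^bsub>presented_group R\<^esub>"
    by (auto simp: carrier_presented_group)
qed (auto simp: carrier_presented_group one_presented_group mult_presented_group)

text \<open>A square with two involutive sides can be read from each of its four corners, which
  gives one rule for passing letters per corner.\<close>

lemma (in group) square_rules:
  assumes c: "a \<in> carrier G" "s \<in> carrier G" "b \<in> carrier G" "t \<in> carrier G"
    and sq: "s \<otimes> s = \<one>" "t \<otimes> t = \<one>" and r: "a \<otimes> (s \<otimes> (inv b \<otimes> t)) = \<one>"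
  shows "t \<otimes> b = a \<otimes> s" "s \<otimes> inv a = inv b \<otimes> t" "t \<otimes> a = b \<otimes> s" "s \<otimes> inv b = inv a \<otimes> t"
proof -
  have ist: "inv s = s" "inv t = t" using sq c by (auto intro: inv_equality)
  have "a \<otimes> s = inv (inv b \<otimes> t)"
    using r c by (intro inv_equality[symmetric]) (auto simp: m_assoc)
  then show 1: "t \<otimes> b = a \<otimes> s" using c ist by (simp add: inv_mult_group)
  have "inv (t \<otimes> b) = inv (a \<otimes> s)" using 1 by simp
  then show "s \<otimes> inv a = inv b \<otimes> t" using c ist by (simp add: inv_mult_group)
  have "t \<otimes> (t \<otimes> b) \<otimes> s = t \<otimes> (a \<otimes> s) \<otimes> s" using 1 by simp
  moreover have "t \<otimes> (t \<otimes> b) = b" using sq c by (simp add: m_assoc[symmetric])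
  moreover have "t \<otimes> (a \<otimes> s) \<otimes> s = t \<otimes> a" using sq c by (simp add: m_assoc)
  ultimately show 2: "t \<otimes> a = b \<otimes> s" by simp
  have "inv (t \<otimes> a) = inv (b \<otimes> s)" using 2 by simp
  then show "s \<otimes> inv b = inv a \<otimes> t" using c ist by (simp add: inv_mult_group)
qed

section \<open>The action of \<open>\<Gamma>\<^sub>0\<close> on the two trees\<close>

text \<open>The sign of \<open>x, y, z, t\<close> is dropped: the formal inverse of an involution
  acts as the involution.\<close>

fun letter_type :: "gen \<times> bool \<Rightarrow> vlet + hlet" where
  "letter_type (gA, s) = Inl (if s then VA else VA')"
| "letter_type (gB, s) = Inl (if s then VB else VB')"
| "letter_type (gX, s) = Inr HX"
| "letter_type (gY, s) = Inr HY"
| "letter_type (gZ, s) = Inr HZ"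
| "letter_type (gT, s) = Inr HT"

definition lact1 :: "gen \<times> bool \<Rightarrow> vlet list \<Rightarrow> vlet list" where
  "lact1 l = case_sum V.lmul V.run (letter_type l)"

definition lact2 :: "gen \<times> bool \<Rightarrow> hlet list \<Rightarrow> hlet list" where
  "lact2 l = case_sum H.run H.lmul (letter_type l)"

definition wact1 :: "gen word \<Rightarrow> vlet list \<Rightarrow> vlet list" where
  "wact1 w = foldr lact1 w"

definition wact2 :: "gen word \<Rightarrow> hlet list \<Rightarrow> hlet list" where
  "wact2 w = foldr lact2 w"

lemma letter_type_vletter [simp]: "letter_type (vletter g) = Inl g"
  by (cases g) auto

lemma letter_type_hletter [simp]: "letter_type (hletter s) = Inr s"
  by (cases s) auto

lemma lact_simps [simp]:
  "lact1 (vletter g) = V.lmul g" "lact1 (hletter s) = V.run s"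
  "lact2 (vletter g) = H.run g" "lact2 (hletter s) = H.lmul s"
  by (simp_all add: lact1_def lact2_def)

lemma wact_simps [simp]:
  "wact1 [] u = u" "wact1 (l # w) u = lact1 l (wact1 w u)" "wact1 (w @ w') u = wact1 w (wact1 w' u)"
  "wact2 [] t = t" "wact2 (l # w) t = lact2 l (wact2 w t)" "wact2 (w @ w') t = wact2 w (wact2 w' t)"
  by (simp_all add: wact1_def wact2_def)

lemma word_map_lact: "V.word_map (lact1 l)" "H.word_map (lact2 l)"
  using V.word_map_lmul V.word_map_run H.word_map_lmul H.word_map_run
  by (auto simp: lact1_def lact2_def split: sum.split)

lemma word_map_wact1: "V.word_map (wact1 w)"
proof (induction w)
  case Nil
  then show ?case by (auto simp: V.word_map_def)
next
  case (Cons l w)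
  then show ?case using V.word_map_comp[OF word_map_lact(1)[of l] Cons] by (simp add: comp_def)
qed

lemma word_map_wact2: "H.word_map (wact2 w)"
proof (induction w)
  case Nil
  then show ?case by (auto simp: H.word_map_def)
next
  case (Cons l w)
  then show ?case using H.word_map_comp[OF word_map_lact(2)[of l] Cons] by (simp add: comp_def)
qed

lemmas reduced_wact1 = V.word_map_reduced[OF word_map_wact1]
lemmas reduced_wact2 = H.word_map_reduced[OF word_map_wact2]

lemma lact1_cancel: "V.reduced u \<Longrightarrow> lact1 (g, s) (lact1 (g, \<not> s) u) = u"
  using V.lmul_bar[of u VA] V.lmul_bar[of u VA'] V.lmul_bar[of u VB] V.lmul_bar[of u VB']
  by (cases g; cases s) (simp_all add: lact1_def V.run_mbar)

lemma lact2_cancel: "H.reduced t \<Longrightarrow> lact2 (g, s) (lact2 (g, \<not> s) t) = t"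
  using H.run_mbar[of VA t] H.run_mbar[of VA' t] H.run_mbar[of VB t] H.run_mbar[of VB' t]
  by (cases g; cases s) (simp_all add: lact2_def H.lmul_bar)

text \<open>In a relator of length four, \<open>run_lmul\<close> brings the second vertical letter
  next to the first, where it cancels; the two remaining horizontal states undo each other.\<close>

lemma wact1_relator: "r \<in> relators0 \<Longrightarrow> V.reduced u \<Longrightarrow> wact1 r u = u"
  using V.lmul_bar[of u VA'] V.lmul_bar[of u VB']
  unfolding relators0_def
  by (elim insertE emptyE) (simp_all add: lact1_def V.run_lmul V.run_mbar)

lemma wact2_relator: "r \<in> relators0 \<Longrightarrow> H.reduced t \<Longrightarrow> wact2 r t = t"
  using H.run_mbar[of VA' t] H.run_mbar[of VB' t] H.reduced_run[of t]
  unfolding relators0_def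
  by (elim insertE emptyE) (simp_all add: lact2_def H.run_lmul H.lmul_bar)

lemma wact1_pres_eq: "pres_eq relators0 w w' \<Longrightarrow> V.reduced u \<Longrightarrow> wact1 w u = wact1 w' u"
proof (induction arbitrary: u rule: pres_eq.induct)
  case (cancel p g s v)
  then show ?case by (simp add: lact1_cancel reduced_wact1)
next
  case (relator r p v)
  then show ?case by (simp add: wact1_relator reduced_wact1)
qed auto

lemma wact2_pres_eq: "pres_eq relators0 w w' \<Longrightarrow> H.reduced t \<Longrightarrow> wact2 w t = wact2 w' t"
proof (induction arbitrary: t rule: pres_eq.induct)
  case (cancel p g s v)
  then show ?case by (simp add: lact2_cancel reduced_wact2)
next
  case (relator r p v)
  then show ?case by (simp add: wact2_relator reduced_wact2)
qed auto

lemma wact1_inv_word: "V.reduced u \<Longrightarrow> wact1 (inv_word w) (wact1 w u) = u" "V.reduced u \<Longrightarrow>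
    wact1 w (wact1 (inv_word w) u) = u"
  using wact1_pres_eq[OF pres_eq_inv_word, of u w] wact1_pres_eq[OF pres_eq_inv_word, of u "inv_word w"]
  by auto

lemma wact2_inv_word: "H.reduced t \<Longrightarrow> wact2 (inv_word w) (wact2 w t) = t" "H.reduced t \<Longrightarrow>
    wact2 w (wact2 (inv_word w) t) = t"
  using wact2_pres_eq[OF pres_eq_inv_word, of t w] wact2_pres_eq[OF pres_eq_inv_word, of t "inv_word w"]
  by auto

lemma wact_vletters: "V.reduced u \<Longrightarrow> wact1 (map vletter u) [] = u" "wact2 (map vletter u) [] = []"
  by (induction u) (auto simp: V.reduced_Cons V.lmul_append)

lemma wact_hletters: "H.reduced t \<Longrightarrow> wact2 (map hletter t) [] = t" "wact1 (map hletter t) [] = []"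
  by (induction t) (auto simp: H.reduced_Cons H.lmul_append)

abbreviation "tree1 \<equiv> V.word_tree"
abbreviation "tree2 \<equiv> H.word_tree"

definition rep :: "gen word set \<Rightarrow> gen word" where
  "rep P = (SOME w. w \<in> P)"

text \<open>The orbit map of the pair of roots; by \<open>\<phi>0_elt\<close> the chosen word may be
  replaced by any word of the class.\<close>

definition \<phi>0 :: "gen word set \<Rightarrow> gen word set set \<times> gen word set set" where
  "\<phi>0 P = (vemb (wact1 (rep P) []), hemb (wact2 (rep P) []))"

definition \<rho>0 :: "gen word set \<Rightarrow> (gen word set set \<Rightarrow> gen word set set)
    \<times> (gen word set set \<Rightarrow> gen word set set)" where
  "\<rho>0 P = (V.lift (wact1 (rep P)), H.lift (wact2 (rep P)))"

lemma pres_eq_rep: "pres_eq relators0 w (rep (elt w))"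
proof -
  have "rep (elt w) \<in> elt w"
    unfolding rep_def by (rule someI[of _ w]) (simp add: pres_class_def pres_eq.refl)
  then show ?thesis by (simp add: pres_class_def)
qed

lemma \<phi>0_elt: "\<phi>0 (elt w) = (vemb (wact1 w []), hemb (wact2 w []))"
  using wact1_pres_eq[OF pres_eq_rep[of w] V.reduced_Nil] wact2_pres_eq[OF pres_eq_rep[of w] H.reduced_Nil]
  by (simp add: \<phi>0_def)

lemma \<rho>0_elt: "\<rho>0 (elt w) = (V.lift (wact1 w), H.lift (wact2 w))"
proof -
  have "V.lift (wact1 (rep (elt w))) = V.lift (wact1 w)"
    using wact1_pres_eq[OF pres_eq_rep[of w]] by (intro V.lift_cong) simp
  moreover have "H.lift (wact2 (rep (elt w))) = H.lift (wact2 w)"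
    using wact2_pres_eq[OF pres_eq_rep[of w]] by (intro H.lift_cong) simp
  ultimately show ?thesis by (simp add: \<rho>0_def)
qed

lemma carrier_Gamma0: "carrier Gamma0 = range elt"
  by (simp add: Gamma0_def carrier_presented_group)

lemma elt_carrier [simp]: "elt w \<in> carrier Gamma0"
  by (simp add: carrier_Gamma0)

lemma mult_Gamma0: "elt u \<otimes>\<^bsub>Gamma0\<^esub> elt v = elt (u @ v)"
  by (simp add: Gamma0_def mult_presented_group)

lemma one_Gamma0: "\<one>\<^bsub>Gamma0\<^esub> = elt []"
  by (simp add: Gamma0_def one_presented_group)

interpretation G0: group Gamma0
  unfolding Gamma0_def by (rule group_presented_group)

lemma lift_wact: "V.lift (wact1 w) \<in> tree_Aut_set tree1" "H.lift (wact2 w) \<in> tree_Aut_set tree2"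
  using V.lift_in_tree_Aut_set[OF word_map_wact1 word_map_wact1 wact1_inv_word(2,1)]
    H.lift_in_tree_Aut_set[OF word_map_wact2 word_map_wact2 wact2_inv_word(2,1)] by auto

lemma \<rho>0_hom: "\<rho>0 \<in> hom Gamma0 (Aut_prod tree1 tree2)"
proof (rule homI)
  fix P assume "P \<in> carrier Gamma0"
  then show "\<rho>0 P \<in> carrier (Aut_prod tree1 tree2)"
    using lift_wact by (auto simp: carrier_Gamma0 \<rho>0_elt carrier_tree_Aut)
next
  fix P Q assume "P \<in> carrier Gamma0" "Q \<in> carrier Gamma0"
  then obtain u v where uv: "P = elt u" "Q = elt v" by (auto simp: carrier_Gamma0)
  have "V.lift (wact1 (u @ v)) = compose (verts tree1) (V.lift (wact1 u)) (V.lift (wact1 v))"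
    by (rule extensionalityI[of _ "verts tree1"])
      (auto simp: V.lift_def compose_def V.verts_word_tree the_inv_f_f[OF V.inj_emb] reduced_wact1)
  moreover have "H.lift (wact2 (u @ v)) = compose (verts tree2) (H.lift (wact2 u)) (H.lift (wact2 v))"
    by (rule extensionalityI[of _ "verts tree2"])
      (auto simp: H.lift_def compose_def H.verts_word_tree the_inv_f_f[OF H.inj_emb] reduced_wact2)
  ultimately show "\<rho>0 (P \<otimes>\<^bsub>Gamma0\<^esub> Q) = \<rho>0 P \<otimes>\<^bsub>Aut_prod tree1 tree2\<^esub> \<rho>0 Q"
    using lift_wact by (simp add: uv mult_Gamma0 \<rho>0_elt mult_tree_Aut)
qed

lemma \<phi>0_equivariant:
  assumes "P \<in> carrier Gamma0" "Q \<in> carrier Gamma0"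
  shows "\<phi>0 (P \<otimes>\<^bsub>Gamma0\<^esub> Q) = map_prod (fst (\<rho>0 P)) (snd (\<rho>0 P)) (\<phi>0 Q)"
  using assms by (auto simp: carrier_Gamma0 mult_Gamma0 \<phi>0_elt \<rho>0_elt reduced_wact1 reduced_wact2)

subsection \<open>Normal forms\<close>

lemma elt_relator: "r \<in> relators0 \<Longrightarrow> elt r = elt []"
  using pres_eq.relator[of r relators0 "[]" "[]"] by (simp add: pres_class_eq_iff)

lemma elt_Cons: "elt (l # w) = elt [l] \<otimes>\<^bsub>Gamma0\<^esub> elt w"
  by (simp add: mult_Gamma0)

lemma elt_neg: "elt [neg g] = inv\<^bsub>Gamma0\<^esub> elt [pos g]"
proof (rule G0.inv_equality[symmetric])
  show "elt [neg g] \<otimes>\<^bsub>Gamma0\<^esub> elt [pos g] = \<one>\<^bsub>Gamma0\<^esub>"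
    using pres_eq.cancel[of relators0 "[]" g False "[]"]
    by (simp add: mult_Gamma0 one_Gamma0 pres_class_eq_iff)
qed auto

lemma elt_involution: "elt [hletter s] \<otimes>\<^bsub>Gamma0\<^esub> elt [hletter s] = \<one>\<^bsub>Gamma0\<^esub>"
proof -
  have "[hletter s, hletter s] \<in> relators0" by (cases s) (simp_all add: relators0_def)
  then show ?thesis using elt_relator by (simp add: mult_Gamma0 one_Gamma0)
qed

lemma elt_relator_rules:
  assumes "[pos a, hletter s, neg b, hletter t] \<in> relators0"
  shows "elt [hletter t] \<otimes>\<^bsub>Gamma0\<^esub> elt [pos b] = elt [pos a] \<otimes>\<^bsub>Gamma0\<^esub> elt [hletter s]"
    "elt [hletter s] \<otimes>\<^bsub>Gamma0\<^esub> elt [neg a] = elt [neg b] \<otimes>\<^bsub>Gamma0\<^esub> elt [hletter t]"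
    "elt [hletter t] \<otimes>\<^bsub>Gamma0\<^esub> elt [pos a] = elt [pos b] \<otimes>\<^bsub>Gamma0\<^esub> elt [hletter s]"
    "elt [hletter s] \<otimes>\<^bsub>Gamma0\<^esub> elt [neg b] = elt [neg a] \<otimes>\<^bsub>Gamma0\<^esub> elt [hletter t]"
proof -
  have "elt [pos a] \<otimes>\<^bsub>Gamma0\<^esub> (elt [hletter s] \<otimes>\<^bsub>Gamma0\<^esub> (inv\<^bsub>Gamma0\<^esub> elt [pos b] \<otimes>\<^bsub>Gamma0\<^esub> elt [hletter t])) = \<one>\<^bsub>Gamma0\<^esub>"
    using elt_relator[OF assms] by (simp add: elt_neg[symmetric] mult_Gamma0 one_Gamma0)
  from G0.square_rules[OF _ _ _ _ elt_involution elt_involution this]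
  show "elt [hletter t] \<otimes>\<^bsub>Gamma0\<^esub> elt [pos b] = elt [pos a] \<otimes>\<^bsub>Gamma0\<^esub> elt [hletter s]"
    "elt [hletter s] \<otimes>\<^bsub>Gamma0\<^esub> elt [neg a] = elt [neg b] \<otimes>\<^bsub>Gamma0\<^esub> elt [hletter t]"
    "elt [hletter t] \<otimes>\<^bsub>Gamma0\<^esub> elt [pos a] = elt [pos b] \<otimes>\<^bsub>Gamma0\<^esub> elt [hletter s]"
    "elt [hletter s] \<otimes>\<^bsub>Gamma0\<^esub> elt [neg b] = elt [neg a] \<otimes>\<^bsub>Gamma0\<^esub> elt [hletter t]"
    by (simp_all add: elt_neg)
qed

text \<open>The seven squares, each read from its four corners, account for all sixteen transitions
  of the automaton.\<close>

lemma elt_commute: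
  "elt [hletter s] \<otimes>\<^bsub>Gamma0\<^esub> elt [vletter g] = elt [vletter (hv_act s g)] \<otimes>\<^bsub>Gamma0\<^esub> elt [hletter (hv_sect s g)]"
proof -
  have r: "[pos gA, hletter HX, neg gB, hletter HZ] \<in> relators0"
      "[pos gA, hletter HY, neg gA, hletter HT] \<in> relators0"
    "[pos gA, hletter HZ, neg gA, hletter HX] \<in> relators0" "[pos gA, hletter HT, neg gA, hletter HY] \<in> relators0"
    "[pos gB, hletter HY, neg gB, hletter HX] \<in> relators0" "[pos gB, hletter HZ, neg gB, hletter HT] \<in> relators0"
    "[pos gB, hletter HT, neg gB, hletter HY] \<in> relators0"
    by (simp_all add: relators0_def)
  note rules = r[THEN elt_relator_rules(1)] r[THEN elt_relator_rules(2)] r[THEN elt_relator_rules(3)] r[THEN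
      elt_relator_rules(4)]
  show ?thesis using rules by (cases s; cases g) simp_all
qed

lemma elt_push: "\<exists>t. elt (hletter s # map vletter u) = elt (map vletter (V.run s u) @ [hletter t])"
proof (induction u arbitrary: s)
  case (Cons g u)
  obtain t where t: "elt (hletter (hv_sect s g) # map vletter u)
      = elt (map vletter (V.run (hv_sect s g) u) @ [hletter t])"
    using Cons by blast
  have "elt (hletter s # map vletter (g # u)) = (elt [hletter s] \<otimes>\<^bsub>Gamma0\<^esub> elt [vletter g]) \<otimes>\<^bsub>Gamma0\<^esub> elt (map vletter u)"
    by (simp add: mult_Gamma0)
  also have "\<dots> = elt [vletter (hv_act s g)] \<otimes>\<^bsub>Gamma0\<^esub> elt (hletter (hv_sect s g) # map vletter u)"
    by (simp add: elt_commute) (simp add: mult_Gamma0)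
  also have "\<dots> = elt (map vletter (V.run s (g # u)) @ [hletter t])"
    by (simp add: t mult_Gamma0)
  finally show ?case by blast
qed auto

lemma vletter_vbar: "vletter (vbar g) = (fst (vletter g), \<not> snd (vletter g))"
  by (cases g) auto

lemma elt_lmul_v: "elt (vletter g # map vletter u) = elt (map vletter (V.lmul g u))"
proof (cases "u \<noteq> [] \<and> hd u = vbar g")
  case True
  then obtain w where u: "u = vbar g # w" by (cases u) auto
  have "elt ([] @ [(fst (vletter g), snd (vletter g)), (fst (vletter g), \<not> snd (vletter g))] @ map vletter w) = elt ([] @ map vletter w)"
    unfolding pres_class_eq_iff by (rule pres_eq.cancel)
  then show ?thesis by (simp add: u V.lmul_def vletter_vbar)
qed (auto simp: V.lmul_def)

lemma elt_lmul_h: "elt (hletter s # map hletter t) = elt (map hletter (H.lmul s t))"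
proof (cases "t \<noteq> [] \<and> hd t = s")
  case True
  then obtain w where t: "t = s # w" by (cases t) auto
  have "elt (hletter s # map hletter t) = (elt [hletter s] \<otimes>\<^bsub>Gamma0\<^esub> elt [hletter s]) \<otimes>\<^bsub>Gamma0\<^esub> elt (map hletter w)"
    by (simp add: t mult_Gamma0)
  then show ?thesis by (simp add: t H.lmul_def elt_involution)
qed (auto simp: H.lmul_def)

text \<open>Formal inverses of involutions belong to neither alphabet but equal their generators in
  the group.\<close>

lemma elt_letter: "(\<exists>g. elt [l] = elt [vletter g]) \<or> (\<exists>s. elt [l] = elt [hletter s])"
proof (cases l)
  case (Pair g s)
  have involution: "elt [neg g] = elt [hletter h]" if "pos g = hletter h" for h
    unfolding elt_neg using elt_involution[of h] that by (intro G0.inv_equality) auto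
  show ?thesis
  proof (cases s)
    case True
    have "(\<exists>v. pos g = vletter v) \<or> (\<exists>h. pos g = hletter h)"
      by (cases g) (metis vletter.simps hletter.simps)+
    then show ?thesis using Pair True by auto
  next
    case False
    have "(\<exists>v. neg g = vletter v) \<or> (\<exists>h. pos g = hletter h)"
      by (cases g) (metis vletter.simps hletter.simps)+
    then show ?thesis using Pair False involution by auto
  qed
qed

text \<open>A new first letter, if vertical, is absorbed by \<open>V.lmul\<close>; if horizontal, it
  is pushed through the vertical part and absorbed by \<open>H.lmul\<close>.\<close>

lemma normal_form: "\<exists>u t. V.reduced u \<and> H.reduced t \<and> elt w = elt (map vletter u @ map hletter t)"
proof (induction w)
  case Nil
  show ?case by (rule exI[of _ "[]"], rule exI[of _ "[]"]) simp
next
  case (Cons l w)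
  then obtain u t where ut: "V.reduced u" "H.reduced t" "elt w = elt (map vletter u @ map hletter t)"
    by blast
  have e: "elt (l # w) = elt [l] \<otimes>\<^bsub>Gamma0\<^esub> elt (map vletter u @ map hletter t)"
    using elt_Cons[of l w] ut by simp
  from elt_letter[of l] show ?case
  proof (elim disjE exE)
    fix g assume "elt [l] = elt [vletter g]"
    then have "elt (l # w) = elt (vletter g # map vletter u) \<otimes>\<^bsub>Gamma0\<^esub> elt (map hletter t)"
      using e by (simp add: mult_Gamma0)
    then have "elt (l # w) = elt (map vletter (V.lmul g u) @ map hletter t)"
      by (simp add: elt_lmul_v mult_Gamma0)
    then show ?thesis using ut V.reduced_lmul by blast
  next
    fix s assume s: "elt [l] = elt [hletter s]"
    obtain s' where s': "elt (hletter s # map vletter u) = elt (map vletter (V.run s u) @ [hletter s'])"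
      using elt_push by blast
    have "elt (l # w) = elt (hletter s # map vletter u) \<otimes>\<^bsub>Gamma0\<^esub> elt (map hletter t)"
      using e s by (simp add: mult_Gamma0)
    also have "\<dots> = elt (map vletter (V.run s u)) \<otimes>\<^bsub>Gamma0\<^esub> elt (hletter s' # map hletter t)"
      by (simp add: s' mult_Gamma0)
    also have "\<dots> = elt (map vletter (V.run s u) @ map hletter (H.lmul s' t))"
      by (simp add: elt_lmul_h mult_Gamma0)
    finally show ?thesis using ut V.reduced_run H.reduced_lmul by blast
  qed
qed

lemma \<phi>0_normal_form:
  "V.reduced u \<Longrightarrow> H.reduced t \<Longrightarrow>
    \<phi>0 (elt (map vletter u @ map hletter t)) = (vemb u, hemb (wact2 (map vletter u) t))"
  by (simp add: \<phi>0_elt wact_vletters wact_hletters)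

text \<open>The first coordinate of a normal form displays its vertical part. That part acts
  invertibly on \<open>tree2\<close>, so the second coordinate determines the horizontal
  part.\<close>

lemma \<phi>0_bij: "bij_betw \<phi>0 (carrier Gamma0) (verts tree1 \<times> verts tree2)"
  unfolding bij_betw_def
proof (intro conjI equalityI subsetI)
  show "inj_on \<phi>0 (carrier Gamma0)"
  proof (rule inj_onI)
    fix P Q assume PQ: "P \<in> carrier Gamma0" "Q \<in> carrier Gamma0" "\<phi>0 P = \<phi>0 Q"
    obtain u t where P: "V.reduced u" "H.reduced t" "P = elt (map vletter u @ map hletter t)"
      using PQ(1) normal_form unfolding carrier_Gamma0 by (metis imageE)
    obtain u' t' where Q: "V.reduced u'" "H.reduced t'" "Q = elt (map vletter u' @ map hletter t')"
      using PQ(2) normal_form unfolding carrier_Gamma0 by (metis imageE)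
    have "u = u'" "wact2 (map vletter u) t = wact2 (map vletter u) t'"
      using PQ(3) P Q by (auto simp: \<phi>0_normal_form)
    then have "t = t'" using P(2) Q(2) wact2_inv_word(1) by metis
    then show "P = Q" using P Q \<open>u = u'\<close> by simp
  qed
  show "x \<in> verts tree1 \<times> verts tree2" if "x \<in> \<phi>0 ` carrier Gamma0" for x
    using that
    by (auto simp: carrier_Gamma0 \<phi>0_elt V.verts_word_tree H.verts_word_tree reduced_wact1 reduced_wact2)
  fix x assume "x \<in> verts tree1 \<times> verts tree2"
  then obtain u t where x: "x = (vemb u, hemb t)" "V.reduced u" "H.reduced t"
    by (auto simp: V.verts_word_tree H.verts_word_tree)
  have "x = \<phi>0 (elt (map vletter u @ map hletter (wact2 (inv_word (map vletter u)) t)))"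
    using x by (simp add: \<phi>0_normal_form reduced_wact2 wact2_inv_word)
  then show "x \<in> \<phi>0 ` carrier Gamma0" by simp
qed

lemma obtain_word:
  assumes "V.reduced u" "H.reduced t"
  obtains w where "wact1 w [] = u" "wact2 w [] = t"
proof -
  have "(vemb u, hemb t) \<in> \<phi>0 ` carrier Gamma0"
    using \<phi>0_bij assms by (auto simp: bij_betw_def V.verts_word_tree H.verts_word_tree)
  then show ?thesis using that by (auto simp: carrier_Gamma0 \<phi>0_elt)
qed

text \<open>Through \<open>\<phi>0\<close> the action becomes left multiplication of the group on
  itself.\<close>

lemma simply_transitive_Gamma0:
  assumes "p \<in> verts tree1 \<times> verts tree2" "q \<in> verts tree1 \<times> verts tree2"
  shows "\<exists>!P. P \<in> carrier Gamma0 \<and> map_prod (fst (\<rho>0 P)) (snd (\<rho>0 P)) p = q"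
proof -
  have "p \<in> \<phi>0 ` carrier Gamma0" "q \<in> \<phi>0 ` carrier Gamma0"
    using assms bij_betw_imp_surj_on[OF \<phi>0_bij] by auto
  then obtain P Q where PQ: "P \<in> carrier Gamma0" "Q \<in> carrier Gamma0" "p = \<phi>0 P" "q = \<phi>0 Q"
    by blast
  have "map_prod (fst (\<rho>0 S)) (snd (\<rho>0 S)) p = q \<longleftrightarrow> S \<otimes>\<^bsub>Gamma0\<^esub> P = Q" if "S \<in> carrier Gamma0" for S
    using \<phi>0_equivariant[OF that PQ(1)] PQ
      inj_on_eq_iff[OF bij_betw_imp_inj_on[OF \<phi>0_bij] G0.m_closed[OF that PQ(1)] PQ(2)] by simp
  moreover have "\<exists>!S. S \<in> carrier Gamma0 \<and> S \<otimes>\<^bsub>Gamma0\<^esub> P = Q"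
  proof (rule ex1I[of _ "Q \<otimes>\<^bsub>Gamma0\<^esub> inv\<^bsub>Gamma0\<^esub> P"])
    show "Q \<otimes>\<^bsub>Gamma0\<^esub> inv\<^bsub>Gamma0\<^esub> P \<in> carrier Gamma0 \<and> Q \<otimes>\<^bsub>Gamma0\<^esub> inv\<^bsub>Gamma0\<^esub> P \<otimes>\<^bsub>Gamma0\<^esub> P = Q"
      using PQ by (simp add: G0.m_assoc)
    show "S = Q \<otimes>\<^bsub>Gamma0\<^esub> inv\<^bsub>Gamma0\<^esub> P" if "S \<in> carrier Gamma0 \<and> S \<otimes>\<^bsub>Gamma0\<^esub> P = Q" for S
      using that PQ by (auto simp: G0.m_assoc)
  qed
  ultimately show ?thesis by (simp cong: conj_cong)
qed

subsection \<open>The square complex\<close>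

text \<open>Pulled back by the inverse word, a neighbour of the image of the root becomes a
  neighbour of the root, that is, a single letter.\<close>

lemma wact1_neighbour:
  assumes "V.reduced (wact1 w [])"
  shows "\<exists>g. V.rmul (wact1 w []) m = wact1 w [g]"
proof -
  obtain g where "wact1 (inv_word w) (V.rmul (wact1 w []) m) = V.rmul (wact1 (inv_word w) (wact1 w [])) g"
    using V.word_map_edge[OF word_map_wact1 assms] by blast
  then have "wact1 (inv_word w) (V.rmul (wact1 w []) m) = [g]"
    by (simp add: wact1_inv_word V.rmul_def)
  then show ?thesis using wact1_inv_word(2)[OF V.reduced_rmul[OF assms, of m], of w] by metis
qed

lemma wact2_neighbour:
  assumes "H.reduced (wact2 w [])"
  shows "\<exists>s. H.rmul (wact2 w []) m = wact2 w [s]"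
proof -
  obtain s where "wact2 (inv_word w) (H.rmul (wact2 w []) m) = H.rmul (wact2 (inv_word w) (wact2 w [])) s"
    using H.word_map_edge[OF word_map_wact2 assms] by blast
  then have "wact2 (inv_word w) (H.rmul (wact2 w []) m) = [s]"
    by (simp add: wact2_inv_word H.rmul_def)
  then show ?thesis using wact2_inv_word(2)[OF H.reduced_rmul[OF assms, of m], of w] by metis
qed

lemma wact1_edge: "{vemb (wact1 w []), vemb (wact1 w [g])} \<in> edges tree1"
proof -
  have "\<exists>m. wact1 w (V.rmul [] g) = V.rmul (wact1 w []) m"
    by (rule V.word_map_edge[OF word_map_wact1]) simp
  then show ?thesis using reduced_wact1[OF V.reduced_Nil] by (auto simp: V.edge_iff V.rmul_def)
qed

lemma wact2_edge: "{hemb (wact2 w []), hemb (wact2 w [s])} \<in> edges tree2"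
proof -
  have "\<exists>m. wact2 w (H.rmul [] s) = H.rmul (wact2 w []) m"
    by (rule H.word_map_edge[OF word_map_wact2]) simp
  then show ?thesis using reduced_wact2[OF H.reduced_Nil] by (auto simp: H.edge_iff H.rmul_def)
qed

lemma wact1_vertex: "vemb (wact1 w []) \<in> verts tree1"
  using reduced_wact1[OF V.reduced_Nil] by (simp add: V.verts_word_tree)

lemma wact2_vertex: "hemb (wact2 w []) \<in> verts tree2"
  using reduced_wact2[OF H.reduced_Nil] by (simp add: H.verts_word_tree)

lemma edges_T1_at:
  assumes "e \<in> edges tree1" "t \<in> verts tree2"
  obtains w g where "e = {vemb (wact1 w []), vemb (wact1 w [g])}" "t = hemb (wact2 w [])"
proof -
  obtain u m where u: "V.reduced u" "e = {vemb u, vemb (V.rmul u m)}"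
    using assms(1) by (auto simp: V.edges_word_tree)
  obtain r where r: "H.reduced r" "t = hemb r" using assms(2) by (auto simp: H.verts_word_tree)
  obtain w where "wact1 w [] = u" "wact2 w [] = r" using u r obtain_word by blast
  then show ?thesis using that u r wact1_neighbour[of w m] by metis
qed

lemma edges_T2_at:
  assumes "u \<in> verts tree1" "e \<in> edges tree2"
  obtains w s where "u = vemb (wact1 w [])" "e = {hemb (wact2 w []), hemb (wact2 w [s])}"
proof -
  obtain t m where t: "H.reduced t" "e = {hemb t, hemb (H.rmul t m)}"
    using assms(2) by (auto simp: H.edges_word_tree)
  obtain r where r: "V.reduced r" "u = vemb r" using assms(1) by (auto simp: V.verts_word_tree)
  obtain w where "wact1 w [] = r" "wact2 w [] = t" using t r obtain_word by blast
  then show ?thesis using that t r wact2_neighbour[of w m] by metis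
qed

lemma squares_at:
  assumes "e \<in> edges tree1" "e' \<in> edges tree2"
  obtains w g s where "e = {vemb (wact1 w []), vemb (wact1 w [g])}" "e'
      = {hemb (wact2 w []), hemb (wact2 w [s])}"
proof -
  obtain t m where t: "H.reduced t" "e' = {hemb t, hemb (H.rmul t m)}"
    using assms(2) by (auto simp: H.edges_word_tree)
  have "hemb t \<in> verts tree2" using t by (simp add: H.verts_word_tree)
  then obtain w g where w: "e = {vemb (wact1 w []), vemb (wact1 w [g])}" "hemb t = hemb (wact2 w [])"
    using edges_T1_at[OF assms(1)] by metis
  then obtain s where "H.rmul t m = wact2 w [s]" using wact2_neighbour[of w m] t(1) by auto
  then show ?thesis using that w t by simp
qed

lemma wact_letter:
  "wact1 (w @ [vletter g]) [] = wact1 w [g]" "wact2 (w @ [vletter g]) [] = wact2 w []"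
  "wact1 (w @ [hletter s]) [] = wact1 w []" "wact2 (w @ [hletter s]) [] = wact2 w [s]"
  by (simp_all add: V.lmul_def H.lmul_def)

lemma cayley_edge_image:
  "\<phi>0 ` {elt w, elt (w @ [l])} = {(vemb (wact1 w []), hemb (wact2 w [])), (vemb (wact1 (w @ [l]) []), hemb (wact2 (w @ [l]) []))}"
  by (simp only: image_insert image_empty \<phi>0_elt)

lemma cayley_edges_v:
  "(\<lambda>e. \<phi>0 ` e) ` cayley_edges relators0 {gA, gB} = {e \<times> {v} | e v. e \<in> edges tree1 \<and> v \<in> verts tree2}"
proof (intro equalityI subsetI)
  fix E assume "E \<in> (\<lambda>e. \<phi>0 ` e) ` cayley_edges relators0 {gA, gB}"
  then obtain w s where ws: "s \<in> {gA, gB}" "E = \<phi>0 ` {elt w, elt (w @ [pos s])}"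
    by (auto simp: cayley_edges_def)
  obtain g where "pos s = vletter g" using ws(1) by (metis insertE singletonD vletter.simps(1,3))
  then have "E = {vemb (wact1 w []), vemb (wact1 w [g])} \<times> {hemb (wact2 w [])}"
    unfolding ws(2) cayley_edge_image by (auto simp only: wact_letter)
  then show "E \<in> {e \<times> {v} | e v. e \<in> edges tree1 \<and> v \<in> verts tree2}"
    using wact1_edge[of w g] wact2_vertex[of w] by blast
next
  fix E assume "E \<in> {e \<times> {v} | e v. e \<in> edges tree1 \<and> v \<in> verts tree2}"
  then obtain e v where ev: "E = e \<times> {v}" "e \<in> edges tree1" "v \<in> verts tree2" by blast
  obtain w g where w: "e = {vemb (wact1 w []), vemb (wact1 w [g])}" "v = hemb (wact2 w [])"
    using edges_T1_at[OF ev(2,3)] .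
  have "\<exists>w' s. s \<in> {gA, gB} \<and> E = \<phi>0 ` {elt w', elt (w' @ [pos s])}"
  proof (cases "g \<in> {VA, VB}")
    case True
    then obtain s where s: "s \<in> {gA, gB}" "pos s = vletter g" by auto
    have "E = \<phi>0 ` {elt w, elt (w @ [pos s])}"
      unfolding cayley_edge_image s(2) ev(1) w by (auto simp only: wact_letter)
    then show ?thesis using s by blast
  next
    case False
    \<comment> \<open>Cayley edges carry positive labels only, so an edge in an inverse direction is
      described from its other end.\<close>
    then obtain s where s: "s \<in> {gA, gB}" "neg s = vletter g" "pos s = vletter (vbar g)" by (cases g) auto
    have c: "elt ((w @ [neg s]) @ [pos s]) = elt w"
      using pres_eq.cancel[of relators0 w s False "[]"] by (simp add: pres_class_eq_iff)
    have "E = \<phi>0 ` {elt (w @ [vletter g]), elt w}"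
      unfolding image_insert image_empty \<phi>0_elt ev(1) w by (auto simp only: wact_letter)
    then have "E = \<phi>0 ` {elt (w @ [neg s]), elt ((w @ [neg s]) @ [pos s])}"
      unfolding c unfolding s(2) .
    then show ?thesis using s by blast
  qed
  then show "E \<in> (\<lambda>e. \<phi>0 ` e) ` cayley_edges relators0 {gA, gB}"
    unfolding cayley_edges_def by blast
qed

lemma cayley_edges_h:
  "(\<lambda>e. \<phi>0 ` e) ` cayley_edges relators0 {gX, gY, gZ, gT} = {{u} \<times> e | u e. u \<in> verts tree1
      \<and> e \<in> edges tree2}"
proof (intro equalityI subsetI)
  fix E assume "E \<in> (\<lambda>e. \<phi>0 ` e) ` cayley_edges relators0 {gX, gY, gZ, gT}"
  then obtain w h where ws: "h \<in> {gX, gY, gZ, gT}" "E = \<phi>0 ` {elt w, elt (w @ [pos h])}"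
    by (auto simp: cayley_edges_def)
  obtain s where "pos h = hletter s" using ws(1) by (metis insertE singletonD hletter.simps)
  then have "E = {vemb (wact1 w [])} \<times> {hemb (wact2 w []), hemb (wact2 w [s])}"
    unfolding ws(2) cayley_edge_image by (auto simp only: wact_letter)
  then show "E \<in> {{u} \<times> e | u e. u \<in> verts tree1 \<and> e \<in> edges tree2}"
    using wact2_edge[of w s] wact1_vertex[of w] by blast
next
  fix E assume "E \<in> {{u} \<times> e | u e. u \<in> verts tree1 \<and> e \<in> edges tree2}"
  then obtain u e where ue: "E = {u} \<times> e" "u \<in> verts tree1" "e \<in> edges tree2" by blast
  obtain w s where w: "u = vemb (wact1 w [])" "e = {hemb (wact2 w []), hemb (wact2 w [s])}"
    using edges_T2_at[OF ue(2,3)] .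
  obtain h where h: "h \<in> {gX, gY, gZ, gT}" "pos h = hletter s" by (cases s) auto
  have "E = \<phi>0 ` {elt w, elt (w @ [pos h])}"
    unfolding cayley_edge_image h(2) ue(1) w by (auto simp only: wact_letter)
  then show "E \<in> (\<lambda>e. \<phi>0 ` e) ` cayley_edges relators0 {gX, gY, gZ, gT}"
    using h(1) unfolding cayley_edges_def by blast
qed

text \<open>A square given by one corner and the two edges issuing from it, hence with four
  descriptions.\<close>

definition corner_square :: "gen word \<Rightarrow> vlet \<Rightarrow> hlet \<Rightarrow> (gen word set set \<times> gen word set set) set" where
  "corner_square w g s = {vemb (wact1 w []), vemb (wact1 w [g])} \<times> {hemb (wact2 w []), hemb (wact2 w [s])}"

lemma doubleton_Times: "{a, b} \<times> {c, d} = {(a, c), (b, c), (b, d), (a, d)}"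
  by auto

lemma lessThan_4: "{..<4::nat} = {0, 1, 2, 3}"
  by auto

text \<open>The closed path spelled by the relator leaves along \<open>g\<close> and comes back
  along \<open>vh_act g s\<close>, which are therefore the two edges at its starting corner.\<close>

lemma relator_square:
  assumes "r = [vletter g, hletter s, vletter (vbar (vh_sect g s)), hletter (vh_act g s)]"
  shows "\<phi>0 ` (\<lambda>i. elt (w @ take i r)) ` {..<4} = corner_square w g (vh_act g s)"
proof -
  have "hv_act s (vbar (vh_sect g s)) = vbar g" by (cases g; cases s; simp)
  then have 3: "wact1 (take 3 r) [] = []" "wact2 (take 3 r) [] = [vh_act g s]"
    by (simp_all add: assms V.lmul_def H.lmul_def numeral_eq_Suc)
  have 2: "wact1 (take 2 r) [] = [g]" "wact2 (take 2 r) [] = [vh_act g s]"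
    and 1: "wact1 (take 1 r) [] = [g]" "wact2 (take 1 r) [] = []"
    by (simp_all add: assms V.lmul_def H.lmul_def numeral_eq_Suc)
  have "\<phi>0 ` (\<lambda>i. elt (w @ take i r)) ` {..<4} = (\<lambda>i. (vemb (wact1 w (wact1 (take i r) [])), hemb (wact2 w (wact2 (take i r) [])))) ` {0, 1, 2, 3}"
    by (simp only: image_image \<phi>0_elt wact_simps lessThan_4)
  also have "\<dots> = corner_square w g (vh_act g s)"
    by (simp only: image_insert image_empty 1 2 3 take_0 wact_simps corner_square_def doubleton_Times)
  finally show ?thesis .
qed

definition square_word :: "vlet \<Rightarrow> hlet \<Rightarrow> gen word" where
  "square_word g s = [vletter g, hletter s, vletter (vbar (vh_sect g s)), hletter (vh_act g s)]"

lemma relators0_length_4: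
  "{r \<in> relators0. length r = 4} =
    {square_word VA HX, square_word VA HY, square_word VA HZ, square_word VA HT,
     square_word VB HY, square_word VB HZ, square_word VB HT}"
proof -
  have *: "{r \<in> insert x A. P r} = (if P x then insert x {r \<in> A. P r} else {r \<in> A. P r})"
    for x :: "gen word" and A P by auto
  show ?thesis unfolding relators0_def square_word_def * by simp
qed

lemma corner_square_swap:
  "corner_square w g s = corner_square (w @ [vletter g]) (vbar g) (vh_act (vbar g) s)"
  "corner_square w g s = corner_square (w @ [hletter s]) (hv_act s g) s"
proof -
  have "vh_act g (vh_act (vbar g) s) = s" by (cases g; cases s; simp)
  moreover have "hv_act s (hv_act s g) = g" by (cases g; cases s; simp)
  ultimately show "corner_square w g s = corner_square (w @ [vletter g]) (vbar g) (vh_act (vbar g) s)"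
    "corner_square w g s = corner_square (w @ [hletter s]) (hv_act s g) s"
    by (auto simp: corner_square_def V.lmul_def H.lmul_def)
qed

lemma cayley_squares_image:
  "(\<lambda>q. \<phi>0 ` q) ` cayley_squares relators0 = {e \<times> e' | e e'. e \<in> edges tree1 \<and> e' \<in> edges tree2}"
proof (intro equalityI subsetI)
  fix E assume "E \<in> (\<lambda>q. \<phi>0 ` q) ` cayley_squares relators0"
  then obtain w r where r: "r \<in> {r \<in> relators0. length r = 4}" "E = \<phi>0 ` (\<lambda>i. elt (w @ take i r)) ` {..<4}"
    unfolding cayley_squares_def by blast
  obtain g s where "r = square_word g s"
    using r(1) unfolding relators0_length_4 by blast
  then obtain s' where "E = corner_square w g s'"
    using r(2) relator_square[of r g s w] unfolding square_word_def by blast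
  then show "E \<in> {e \<times> e' | e e'. e \<in> edges tree1 \<and> e' \<in> edges tree2}"
    using wact1_edge[of w g] wact2_edge[of w s'] unfolding corner_square_def by blast
next
  let ?S = "(\<lambda>q. \<phi>0 ` q) ` cayley_squares relators0"
  have rel: "corner_square w g (vh_act g s) \<in> ?S" if gs: "square_word g s \<in> {r \<in> relators0. length r
      = 4}" for w g s
  proof -
    have "(\<lambda>i. elt (w @ take i (square_word g s))) ` {..<4} \<in> cayley_squares relators0"
      using gs unfolding cayley_squares_def by blast
    then have "\<phi>0 ` (\<lambda>i. elt (w @ take i (square_word g s))) ` {..<4} \<in> ?S" by (rule imageI)
    then show ?thesis unfolding relator_square[OF square_word_def] .
  qed
  have VA: "corner_square w VA s \<in> ?S" for w s
    using rel[of VA "vh_act VA s" w] unfolding relators0_length_4 by (cases s) auto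
  have VB: "corner_square w VB s \<in> ?S" for w s
  proof (cases s)
    \<comment> \<open>The corner with edges \<open>b\<close> and \<open>z\<close> starts no relator.
      Seen from the other end of its edge \<open>z\<close> it has edges \<open>a\<close> and
      \<open>z\<close>, which is the corner of the relator \<open>a x b^{-1} z\<close>.\<close>
    case HZ
    then show ?thesis using corner_square_swap(2)[of w VB HZ] VA by simp
  qed (use rel[of VB "vh_act VB' s" w] in \<open>auto simp: relators0_length_4\<close>)
  have all: "corner_square w g s \<in> ?S" for w g s
  proof (cases g)
    case VA'
    then show ?thesis using VA corner_square_swap(1)[of w VA' s] by simp
  next
    case VB'
    then show ?thesis using VB corner_square_swap(1)[of w VB' s] by simp
  qed (use VA VB in simp_all)
  fix E assume "E \<in> {e \<times> e' | e e'. e \<in> edges tree1 \<and> e' \<in> edges tree2}"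
  then obtain e e' where e: "E = e \<times> e'" "e \<in> edges tree1" "e' \<in> edges tree2" by blast
  obtain w g s where "e = {vemb (wact1 w []), vemb (wact1 w [g])}" "e'
      = {hemb (wact2 w []), hemb (wact2 w [s])}"
    using squares_at[OF e(2,3)] .
  then have "E = corner_square w g s" using e(1) by (simp add: corner_square_def)
  then show "E \<in> ?S" using all by simp
qed

lemma natural_action_Gamma0: "natural_action tree1 tree2 \<phi>0 \<rho>0"
  unfolding natural_action_def
  by (intro conjI ballI \<phi>0_bij cayley_edges_v cayley_edges_h cayley_squares_image \<rho>0_hom \<phi>0_equivariant)

section \<open>Irreducibility and the anti-torus\<close>

abbreviation line1 :: "int \<Rightarrow> vlet list" where "line1 \<equiv> ray_line (\<lambda>_. VA) (\<lambda>_. VA')"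
abbreviation line2 :: "int \<Rightarrow> hlet list" where "line2 \<equiv> ray_line xy_ray yx_ray"

interpretation L1: tree_line tree1 "\<lambda>n. vemb (line1 n)" "\<lambda>v. ray_gate (\<lambda>_. VA) (\<lambda>_. VA') (the_inv vemb v)"
  by (rule V.word_tree_line) auto

interpretation L2: tree_line tree2 "\<lambda>n. hemb (line2 n)" "\<lambda>v. ray_gate xy_ray yx_ray (the_inv hemb v)"
  by (rule H.word_tree_line) auto

interpretation P0: plane_action tree1 "\<lambda>n. vemb (line1 n)" "\<lambda>v. ray_gate (\<lambda>_. VA) (\<lambda>_. VA') (the_inv vemb v)"
  tree2 "\<lambda>n. hemb (line2 n)" "\<lambda>v. ray_gate xy_ray yx_ray (the_inv hemb v)" Gamma0 \<rho>0
  by unfold_locales (rule \<rho>0_hom, rule simply_transitive_Gamma0)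

lemma reduced_line1: "V.reduced (line1 n)"
  using L1.L_verts[of n] by (auto simp: V.verts_word_tree)

lemma reduced_line2: "H.reduced (line2 n)"
  using L2.L_verts[of n] by (auto simp: H.verts_word_tree)

lemma a_line1: "V.lmul VA (line1 n) = line1 (n + 1)"
proof (cases "0 \<le> n")
  case True
  then show ?thesis
    by (auto simp: ray_line_def V.lmul_def nat_add_distrib map_replicate_const hd_replicate)
next
  case False
  then have "nat (- n) = Suc (nat (- (n + 1)))" by linarith
  then show ?thesis using False
    by (auto simp: ray_line_def V.lmul_def map_replicate_const simp del: upt_Suc)
qed

lemma map_ray_Suc:
  "map xy_ray [0..<Suc n] = HX # map yx_ray [0..<n]" "map yx_ray [0..<Suc n] = HY # map xy_ray [0..<n]"
  unfolding map_upt_Suc by auto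

lemma xy_line2: "H.lmul HX (H.lmul HY (line2 n)) = line2 (n + 2)"
proof -
  consider "0 \<le> n" | "n = -1" | "n \<le> -2" by linarith
  then show ?thesis
  proof cases
    case 1
    then have n2: "nat (n + 2) = Suc (Suc (nat n))" by linarith
    have "H.lmul HY (map xy_ray [0..<nat n]) = HY # map xy_ray [0..<nat n]"
      by (cases "nat n") (auto simp: H.lmul_def map_ray_Suc simp del: upt_Suc)
    then show ?thesis using 1 n2
      by (simp add: ray_line_def map_ray_Suc H.lmul_def del: upt_Suc)
  next
    \<comment> \<open>The move crosses the root: \<open>y\<close> cancels the only letter and
      \<open>x\<close> begins the positive ray.\<close>
    case 2
    then show ?thesis by (simp add: ray_line_def H.lmul_def)
  next
    case 3
    define k where "k = nat (- (n + 2))"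
    have k: "nat (- n) = Suc (Suc k)" "n < 0" using 3 by (auto simp: k_def)
    have "line2 (n + 2) = map yx_ray [0..<k]" using 3 by (auto simp: ray_line_def k_def)
    then show ?thesis using k by (simp add: ray_line_def map_ray_Suc H.lmul_def del: upt_Suc)
  qed
qed

section \<open>A height function on the first tree\<close>

fun vsign :: "vlet \<Rightarrow> int" where
  "vsign VA = 1" | "vsign VB = 1" | "vsign VA' = -1" | "vsign VB' = -1"

text \<open>All relators are balanced in \<open>a\<close> and \<open>b\<close>, so this total
  exponent is shifted by a constant under each group element.\<close>

definition exponent_sum :: "vlet list \<Rightarrow> int" where
  "exponent_sum u = sum_list (map vsign u)"

lemma exponent_sum_lmul: "exponent_sum (V.lmul g u) = exponent_sum u + vsign g"
  by (cases u; cases g) (auto simp: exponent_sum_def V.lmul_def)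

lemma exponent_sum_run: "exponent_sum (V.run s u) = exponent_sum u"
proof (induction u arbitrary: s)
  case (Cons g u)
  moreover have "vsign (hv_act s g) = vsign g" by (cases s; cases g; simp)
  ultimately show ?case by (simp add: exponent_sum_def)
qed (simp add: exponent_sum_def)

lemma exponent_sum_wact1: "\<exists>c. \<forall>u. exponent_sum (wact1 w u) = exponent_sum u + c"
proof (induction w)
  case (Cons l w)
  then obtain c where c: "\<And>u. exponent_sum (wact1 w u) = exponent_sum u + c" by blast
  have "\<exists>c'. \<forall>u. exponent_sum (lact1 l u) = exponent_sum u + c'"
    by (cases "letter_type l") (auto simp: lact1_def exponent_sum_lmul exponent_sum_run)
  then obtain c' where "\<And>u. exponent_sum (lact1 l u) = exponent_sum u + c'" by blast
  then show ?case using c by (intro exI[of _ "c + c'"]) simp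
qed auto

lemma exponent_sum_line1: "exponent_sum (line1 n) = n"
  by (simp add: exponent_sum_def ray_line_def map_replicate_const sum_list_replicate)

lemma elt_pow: "elt [pos gA] [^]\<^bsub>Gamma0\<^esub> (n::nat) = elt (replicate n (pos gA))"
proof (induction n)
  case (Suc n)
  have "elt [pos gA] [^]\<^bsub>Gamma0\<^esub> Suc n = elt (replicate n (pos gA) @ [pos gA])"
    by (simp add: Suc mult_Gamma0)
  then show ?case by (simp add: replicate_append_same)
qed (simp add: one_Gamma0)

lemma a_pow_T2: "H.reduced t \<Longrightarrow> snd (\<rho>0 (elt [pos gA] [^]\<^bsub>Gamma0\<^esub> (n::nat))) (hemb t)
    = hemb ((H.run VA ^^ n) t)"
proof -
  have "lact2 (pos gA) = H.run VA" by (simp add: lact2_def)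
  then have "wact2 (replicate n (pos gA)) t = (H.run VA ^^ n) t"
    by (induction n) auto
  then show "H.reduced t \<Longrightarrow> snd (\<rho>0 (elt [pos gA] [^]\<^bsub>Gamma0\<^esub> n)) (hemb t) = hemb ((H.run VA ^^ n) t)"
    by (simp add: elt_pow \<rho>0_elt)
qed

lemma a_pow_aperiodic:
  assumes "0 < (N::nat)"
  shows "\<exists>n. snd (\<rho>0 (elt [pos gA] [^]\<^bsub>Gamma0\<^esub> N)) (hemb (line2 n)) \<noteq> hemb (line2 n)"
proof -
  obtain n where "(H.run VA ^^ N) (map xy_ray [0..<n]) \<noteq> map xy_ray [0..<n]"
    using a_orbit_infinite[OF assms] by blast
  moreover have "line2 (int n) = map xy_ray [0..<n]" by (simp add: ray_line_def)
  ultimately show ?thesis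
    using a_pow_T2[OF reduced_line2[of "int n"], of N] by (intro exI[of _ "int n"]) simp
qed

lemma root_verts: "vemb [] \<in> verts tree1" "hemb [] \<in> verts tree2"
  by (auto simp: V.verts_word_tree H.verts_word_tree)

lemma \<rho>0_inj: "inj_on \<rho>0 (carrier Gamma0)"
proof (rule inj_onI)
  fix P Q assume "P \<in> carrier Gamma0" "Q \<in> carrier Gamma0" "\<rho>0 P = \<rho>0 Q"
  moreover have "map_prod (fst (\<rho>0 Q)) (snd (\<rho>0 Q)) (vemb [], hemb []) \<in> verts tree1 \<times> verts tree2"
    using P0.\<rho>_Aut[OF calculation(2)] root_verts tree_Aut_verts by auto
  ultimately show "P = Q"
    using simply_transitive_Gamma0[of "(vemb [], hemb [])"] root_verts by (metis SigmaI)
qed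

lemma subgroup_Gamma0: "subgroup (\<rho>0 ` carrier Gamma0) (Aut_prod tree1 tree2)"
proof -
  interpret group_hom Gamma0 "Aut_prod tree1 tree2" \<rho>0
    by (intro group_hom.intro group_hom_axioms.intro G0.is_group group_Aut_prod \<rho>0_hom)
  show ?thesis by (rule img_is_subgroup)
qed

lemma simply_transitive_image:
  assumes "p \<in> verts tree1 \<times> verts tree2" "q \<in> verts tree1 \<times> verts tree2"
  shows "\<exists>!\<gamma>. \<gamma> \<in> \<rho>0 ` carrier Gamma0 \<and> map_prod (fst \<gamma>) (snd \<gamma>) p = q"
  using simply_transitive_Gamma0[OF assms] by blast

lemma BMW_Gamma0: "BMW_group 4 4 tree1 tree2 (\<rho>0 ` carrier Gamma0)"
  using V.regular_word_tree H.regular_word_tree subgroup_Gamma0 simply_transitive_image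
  unfolding CARD_vlet CARD_hlet by (rule BMW_groupI)

text \<open>The criterion is applied to \<open>a\<close>: as an automaton it fixes the root of
  \<open>tree2\<close>, and no positive power is trivial there.\<close>

lemma irreducible_Gamma0: "irreducible_lattice tree1 tree2 (\<rho>0 ` carrier Gamma0)"
proof (rule irreducible_latticeI[OF subgroup_Gamma0, of "vemb []" "hemb []"])
  let ?G = "Aut_prod tree1 tree2"
  interpret hom: group_hom Gamma0 ?G \<rho>0
    by (intro group_hom.intro group_hom_axioms.intro G0.is_group group_Aut_prod \<rho>0_hom)
  show "\<gamma> = \<one>\<^bsub>?G\<^esub>"
    if "\<gamma> \<in> \<rho>0 ` carrier Gamma0" "fst \<gamma> (vemb []) = vemb []" "snd \<gamma> (hemb []) = hemb []" for \<gamma>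
  proof -
    have "\<one>\<^bsub>?G\<^esub> \<in> \<rho>0 ` carrier Gamma0" by (rule subgroup.one_closed[OF subgroup_Gamma0])
    moreover have "map_prod (fst \<one>\<^bsub>?G\<^esub>) (snd \<one>\<^bsub>?G\<^esub>) (vemb [], hemb []) = (vemb [], hemb [])"
      using root_verts by (simp add: one_tree_Aut)
    moreover have "map_prod (fst \<gamma>) (snd \<gamma>) (vemb [], hemb []) = (vemb [], hemb [])"
      using that by simp
    moreover have "\<exists>!\<gamma>. \<gamma> \<in> \<rho>0 ` carrier Gamma0 \<and> map_prod (fst \<gamma>) (snd \<gamma>) (vemb [], hemb [])
        = (vemb [], hemb [])"
      by (rule simply_transitive_image) (use root_verts in auto)
    ultimately show ?thesis using that(1) by (elim ex1E) (metis (no_types, lifting))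
  qed
  show "vemb [] \<in> verts tree1" by (rule root_verts)
  show "\<rho>0 (elt [pos gA]) \<in> \<rho>0 ` carrier Gamma0" by simp
  have pow: "\<rho>0 (elt [pos gA]) [^]\<^bsub>?G\<^esub> n = \<rho>0 (elt [pos gA] [^]\<^bsub>Gamma0\<^esub> n)" for n :: nat
    by (simp add: hom.hom_nat_pow)
  have "(H.run VA ^^ n) [] = []" for n by (induction n) auto
  then show "snd (\<rho>0 (elt [pos gA]) [^]\<^bsub>?G\<^esub> n) (hemb []) = hemb []" for n :: nat
    unfolding pow by (simp add: a_pow_T2)
  show "snd (\<rho>0 (elt [pos gA]) [^]\<^bsub>?G\<^esub> n) \<noteq> \<one>\<^bsub>tree_Aut tree2\<^esub>" if "0 < n" for n :: nat
  proof
    assume "snd (\<rho>0 (elt [pos gA]) [^]\<^bsub>?G\<^esub> n) = \<one>\<^bsub>tree_Aut tree2\<^esub>"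
    then have "snd (\<rho>0 (elt [pos gA] [^]\<^bsub>Gamma0\<^esub> n)) (hemb (line2 m)) = hemb (line2 m)" for m
      unfolding pow using L2.L_verts[of m] by (simp add: one_tree_Aut)
    then show False using a_pow_aperiodic[OF that] by blast
  qed
qed

lemma anti_torus_Gamma0:
  "span_anti_torus (prod_points tree1 tree2) (prod_tree_dist tree1 tree2) Gamma0
     (\<lambda>g. realize_prod tree1 tree2 (\<rho>0 g)) (elt [pos gA]) (elt [pos gX, pos gY])"
\<comment> \<open>The height is the exponent sum; the shift is 2 because \<open>xy\<close> consists
  of two letters of its own axis.\<close>
proof (rule P0.span_anti_torus[where \<epsilon> = "\<lambda>v. exponent_sum (the_inv vemb v)" and \<tau> = 2])
  have inv1: "the_inv vemb (vemb u) = u" for u by (rule the_inv_f_f[OF V.inj_emb])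
  show "fst (\<rho>0 (elt [pos gA])) (vemb (line1 n)) = vemb (line1 (n + 1))" for n
    by (simp add: \<rho>0_elt reduced_line1 lact1_def a_line1)
  show "snd (\<rho>0 (elt [pos gA])) (hemb (line2 0)) = hemb (line2 0)"
    by (simp add: \<rho>0_elt reduced_line2 lact2_def ray_line_def)
  show "snd (\<rho>0 (elt [pos gX, pos gY])) (hemb (line2 n)) = hemb (line2 (n + 2))" for n
    by (simp add: \<rho>0_elt reduced_line2 lact2_def xy_line2)
  show "fst (\<rho>0 (elt [pos gX, pos gY])) (vemb (line1 0)) = vemb (line1 0)"
    by (simp add: \<rho>0_elt reduced_line1 lact1_def ray_line_def)
  show "exponent_sum (the_inv vemb (vemb (line1 n))) = n" for n
    by (simp add: inv1 exponent_sum_line1)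
  show "\<exists>c. \<forall>v\<in>verts tree1. exponent_sum (the_inv vemb (fst (\<rho>0 g) v)) = exponent_sum (the_inv vemb v) + c"
    if g: "g \<in> carrier Gamma0" for g
  proof -
    obtain w where "g = elt w" using g by (auto simp: carrier_Gamma0)
    then show ?thesis using exponent_sum_wact1[of w] by (auto simp: V.verts_word_tree \<rho>0_elt inv1)
  qed
qed (use a_pow_aperiodic in auto)

theorem corollary1p4:
  "\<exists>(T1 :: gen word set set ugraph) (T2 :: gen word set set ugraph) \<phi> \<rho>.
     natural_action T1 T2 \<phi> \<rho> \<and>
     inj_on \<rho> (carrier Gamma0) \<and>
     BMW_group 4 4 T1 T2 (\<rho> ` carrier Gamma0) \<and>
     irreducible_lattice T1 T2 (\<rho> ` carrier Gamma0) \<and>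
     span_anti_torus (prod_points T1 T2) (prod_tree_dist T1 T2) Gamma0
       (\<lambda>g. realize_prod T1 T2 (\<rho> g)) (elt [pos gA]) (elt [pos gX, pos gY])"
  using natural_action_Gamma0 \<rho>0_inj BMW_Gamma0 irreducible_Gamma0 anti_torus_Gamma0 by blast

end
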